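(* Let $N\ge 1$, $0<s<1$, and let $h:[0,\infty)\to[0,\infty)$ be continuous and $f:[0,\infty)\to[0,\infty)$ be continuous and locally Lipschitz with $f(0)=0$. Consider the problem $u_t+\mathcal{L}u=h(t)f(u)$ in $\mathbb{R}^N\times(0,T)$, $u(0)=u_0$ in $\mathbb{R}^N$, where $\mathcal{L}=-\Delta+(-\Delta)^s$. \begin{itemize} \item[(i)] Suppose there is $m>0$ such that $f$ and $\sigma\mapsto f(\sigma)/\sigma$ are nondecreasing on $(0,m]$, and suppose there exists $0\le v_0\in\mathcal{X}$, $v_0\neq 0$, with $\|v_0\|_\infty\le m$ and $$\int_0^{\infty} h(\sigma)\,\frac{f(\|e^{-\sigma\mathcal{L}}v_0\|_\infty)}{\|e^{-\sigma\mathcal{L}}v_0\|_\infty}\,d\sigma<1.$$ Then there exists $\delta>0$ such that, for $u_0=\delta v_0$, the problem has a nontrivial global mild solution. \item[(ii)] Let $0\le u_0\in\mathcal{X}$, $u_0\neq0$, and suppose that $f$ is nondecreasing, $f(\sigma)>0$ for all $\sigma>0$, $\int_{z_0}^\infty \frac{d\sigma}{f(\sigma)}<\infty$ for all $z_0>0$, and $f(e^{-t\mathcal{L}}w_0)\le e^{-t\mathcal{L}}f(w_0)$ for all $t>0$ and all $0\le w_0\in\mathcal{X}$. If there exists $\kappa>0$ such that $$\int_{\|e^{-\kappa\mathcal{L}}u_0\|_\infty}^{\infty}\frac{d\sigma}{f(\sigma)}\le\int_0^{\kappa}h(\sigma)\,d\sigma,$$ then the mild solution $u$ of the problem with initial condition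 $u_0$ is not global (i.e. there is no global mild solution with initial datum $u_0$). \end{itemize}
   Context: $\mathcal{X}:=L^\infty(\mathbb{R}^N)\cap L^1(\mathbb{R}^N)$. For $t>0$ let $\mathfrak{h}^{(s)}_t$ be the heat kernel of $-(-\Delta)^s$ on $\mathbb{R}^N$ (the fractional heat kernel), and define $\mathfrak{p}_t(z)=(4\pi t)^{-N/2}\int_{\mathbb{R}^N}e^{-|z-\xi|^2/(4t)}\mathfrak{h}^{(s)}_t(\xi)\,d\xi$, the heat kernel of $-\mathcal{L}$. The semigroup is $[e^{-t\mathcal{L}}u_0](x)=\int_{\mathbb{R}^N}\mathfrak{p}_t(x-y)u_0(y)\,dy$. A mild solution on $[0,T)$ with initial datum $0\le u_0\in\mathcal{X}$ is a function $u:\mathbb{R}^N\times[0,T)\to[0,\infty)$ with $u\in L^\infty((0,T);\mathcal{X})$ such that $u(t)=e^{-t\mathcal{L}}u_0+\int_0^t e^{-(t-\sigma)\mathcal{L}}h(\sigma)f(u(\sigma))\,d\sigma$ for $0<t<T$; it is global if $T=+\infty$. Nontrivial means not identically zero. *)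

theory Defs
  imports "HOL-Probability.Probability"
begin

text \<open>Fractional heat kernel of -(-Delta)^s on R^N (N = DIM('a)), via its Fourier
 representation (2 pi)^(-N) int exp(i z.xi) exp(-t |xi|^(2s)) dxi; the integrand is even in xi,
 so the imaginary part vanishes and the kernel equals the cosine integral below.\<close>
definition frac_heat_kernel :: "real \<Rightarrow> real \<Rightarrow> 'a::euclidean_space \<Rightarrow> real" where
  "frac_heat_kernel s t z =
     (2 * pi) powr (- real DIM('a)) *
     (LINT \<xi>|lborel. cos (z \<bullet> \<xi>) * exp (- t * (norm \<xi> powr (2 * s))))"

text \<open>Heat kernel p_t of -L, L = -Delta + (-Delta)^s: Gaussian convolved with the fractional kernel.\<close>
definition heatL_kernel :: "real \<Rightarrow> real \<Rightarrow> 'a::euclidean_space \<Rightarrow> real" where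
  "heatL_kernel s t z =
     (4 * pi * t) powr (- real DIM('a) / 2) *
     (LINT \<xi>|lborel. exp (- (norm (z - \<xi>))\<^sup>2 / (4 * t)) * frac_heat_kernel s t \<xi>)"

definition heatL_sg :: "real \<Rightarrow> real \<Rightarrow> ('a::euclidean_space \<Rightarrow> real) \<Rightarrow> 'a \<Rightarrow> real" where
  "heatL_sg s t u0 x = (LINT y|lborel. heatL_kernel s t (x - y) * u0 y)"

definition linf_norm :: "('a::euclidean_space \<Rightarrow> real) \<Rightarrow> real" where
  "linf_norm g = real_of_ereal (esssup lborel (\<lambda>x. ereal \<bar>g x\<bar>))"

definition l1_norm :: "('a::euclidean_space \<Rightarrow> real) \<Rightarrow> real" where
  "l1_norm g = (LINT x|lborel. \<bar>g x\<bar>)"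

definition in_X :: "('a::euclidean_space \<Rightarrow> real) \<Rightarrow> bool" where
  "in_X g \<longleftrightarrow> g \<in> borel_measurable lborel \<and> integrable lborel g
      \<and> esssup lborel (\<lambda>x. ereal \<bar>g x\<bar>) < \<infinity>"

definition nonzero_X :: "('a::euclidean_space \<Rightarrow> real) \<Rightarrow> bool" where
  "nonzero_X g \<longleftrightarrow> \<not> (AE x in lborel. g x = 0)"

text \<open>Mild solution on [0,T) (T an extended real; T = \<infinity> means global).
  u x t is the value at (x,t).  u \<in> L^infty((0,T);X) is rendered as joint Borel measurability
  plus an essential (in t) uniform bound of the X-norm.  The Duhamel integrand is required to be
  integrable so that the integral in the equation is meaningful.\<close>
definition mild_sol ::
  "real \<Rightarrow> ereal \<Rightarrow> (real \<Rightarrow> real) \<Rightarrow> (real \<Rightarrow> real) \<Rightarrow> ('a::euclidean_space \<Rightarrow> real)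
     \<Rightarrow> ('a \<Rightarrow> real \<Rightarrow> real) \<Rightarrow> bool" where
  "mild_sol s T h f u0 u \<longleftrightarrow>
     (\<forall>x t. 0 \<le> t \<and> ereal t < T \<longrightarrow> 0 \<le> u x t)
   \<and> (\<lambda>(x, t). u x t) \<in> borel_measurable borel
   \<and> (\<exists>C. AE t in lborel. 0 < ereal t \<and> ereal t < T \<longrightarrow>
          in_X (\<lambda>x. u x t) \<and> l1_norm (\<lambda>x. u x t) \<le> C \<and> linf_norm (\<lambda>x. u x t) \<le> C)
   \<and> (\<forall>t. 0 < ereal t \<and> ereal t < T \<longrightarrow>
        (AE x in lborel.
           integrable lborel (\<lambda>(\<sigma>, y). indicator {0<..<t} \<sigma> *
               (heatL_kernel s (t - \<sigma>) (x - y) * (h \<sigma> * f (u y \<sigma>))))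
         \<and> u x t = heatL_sg s t u0 x +
              (LINT \<sigma>:{0<..<t}|lborel. heatL_sg s (t - \<sigma>) (\<lambda>y. h \<sigma> * f (u y \<sigma>)) x)))"

definition global_mild_sol ::
  "real \<Rightarrow> (real \<Rightarrow> real) \<Rightarrow> (real \<Rightarrow> real) \<Rightarrow> ('a::euclidean_space \<Rightarrow> real)
     \<Rightarrow> ('a \<Rightarrow> real \<Rightarrow> real) \<Rightarrow> bool" where
  "global_mild_sol s h f u0 u \<longleftrightarrow> mild_sol s \<infinity> h f u0 u"

end

theory Submission
  imports Defs
begin

text \<open>
  The kernel \<open>p\<^sub>t\<close> is the inverse Fourier transform of \<open>exp (- t (|\<xi>|\<^sup>2 + |\<xi>|\<^sup>2\<^sup>s))\<close>. It is nonnegative because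
  \<open>|\<xi>|\<^sup>2\<^sup>s\<close> is a positive multiple of \<open>\<integral> (1 - exp (- r |\<xi>|\<^sup>2)) r\<^sup>-\<^sup>1\<^sup>-\<^sup>s dr\<close> over \<open>r > 0\<close>, so that \<open>exp (- t |\<xi>|\<^sup>2\<^sup>s)\<close> is
  a limit of power series in Gaussian mixtures with nonnegative coefficients. Fourier inversion gives
  total mass 1, and multiplicativity of the symbol in \<open>t\<close> gives the semigroup law.

  (i) Let \<open>I < 1\<close> be the given integral. By monotonicity of \<open>f \<sigma> / \<sigma>\<close>, the source \<open>h f(S(\<sigma>) v\<^sub>0)\<close> is at
  most \<open>h (f(w) / w) S(\<sigma>) v\<^sub>0\<close> with \<open>w = \<parallel>S(\<sigma>) v\<^sub>0\<parallel>\<^sub>\<infinity>\<close>, so \<open>S(t) v\<^sub>0\<close> is a supersolution for the datum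
  \<open>(1 - I) v\<^sub>0\<close>. Monotone iteration from 0 converges below it to a global solution.

  (ii) For a global solution \<open>u\<close> let \<open>\<Phi>(t) = S(\<kappa> - t) u(t) = S(\<kappa>) u\<^sub>0 + \<integral>\<^sub>0\<^sup>t S(\<kappa> - \<sigma>) h f(u(\<sigma>)) d\<sigma>\<close>. The Jensen
  hypothesis gives \<open>\<Phi>' \<ge> h f(\<Phi>)\<close> pointwise in \<open>x\<close>, whence the integral of \<open>1 / f\<close> from \<open>S(\<kappa>) u\<^sub>0(x)\<close> to
  \<open>\<Phi>(\<kappa>)(x)\<close> is at least \<open>\<integral>\<^sub>0\<^sup>\<kappa> h\<close>. Since \<open>\<Phi>(\<kappa>)\<close> is bounded uniformly in \<open>x\<close>, letting \<open>S(\<kappa>) u\<^sub>0(x)\<close> approach its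
  essential supremum gives strict inequality against the hypothesis.
\<close>

section \<open>Fourier transforms of Gaussians\<close>

text \<open>The definition gives no direct access to the sign or the integrability of the kernel:
  its fractional factor is an oscillatory integral. Gaussian damping is used twice to get around
  this. In frequency, the Laplacian itself contributes the factor exp (-t |xi|^2), so positivity is
  only required of symbols multiplied by a Gaussian, and there every bounded measurable symbol is
  integrable. In space, damping the kernel turns Fourier inversion into a statement about Gaussian
  averages of a continuous symbol; once the sign is known, monotone convergence removes the damping
  and yields integrability and mass together. For the evolution problem the mild equation is
  rewritten in extended nonnegative reals, so that Tonelli and monotone convergence apply before any
  finiteness is known. In (ii) the null sets depend on time, whereas the comparison argument runs at
  one fixed point x. Hence \<Phi> is given by a formula that makes sense at every x, and the
  exceptional sets are exchanged by Fubini.\<close>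

lemma gaussian_fourier_1d:
  fixes z a :: real
  assumes a: "0 < a"
  shows "integrable lborel (\<lambda>x. cis (z * x) * complex_of_real (exp (- a * x\<^sup>2)))"
    and "(LINT x|lborel. cis (z * x) * complex_of_real (exp (- a * x\<^sup>2)))
      = complex_of_real (sqrt (pi / a) * exp (- z\<^sup>2 / (4 * a)))"
proof -
  \<comment> \<open>Chosen so that (c x)^2 / 2 = a x^2: the substitution y = c x turns the weight
    into the standard normal density, whose characteristic function is known.\<close>
  define c where "c = sqrt (2 * a)"
  have c: "0 < c" "c\<^sup>2 = 2 * a" using a by (auto simp: c_def)
  define g where "g = (\<lambda>y::real. std_normal_density y *\<^sub>R cis (z / c * y))"
  have cis_exp: "iexp t = cis t" for t by (simp add: cis_conv_exp)
  have int_g: "integrable lborel g"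
  proof (rule Bochner_Integration.integrable_bound)
    show "integrable lborel std_normal_density"
      by (rule integrable_normal_density) simp
    show "g \<in> borel_measurable lborel"
      unfolding g_def by (intro borel_measurable_scaleR)
        (auto intro!: borel_measurable_continuous_onI continuous_intros simp: cis_conv_exp normal_density_def)
  qed (simp add: g_def)
  have "char std_normal_distribution (z / c) = (LINT x|lborel. g x)"
    unfolding char_def g_def
    by (subst integral_density) (auto simp: cis_conv_exp intro!: borel_measurable_continuous_onI continuous_intros)
  then have "(LINT x|lborel. g x) = complex_of_real (exp (- (z / c)\<^sup>2 / 2))"
    by (simp add: char_std_normal_distribution)
  then have val: "\<bar>c\<bar> *\<^sub>R (LINT x|lborel. g (0 + c * x)) = complex_of_real (exp (- (z / c)\<^sup>2 / 2))"
    using lborel_integral_real_affine[of c g 0] c by simp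
  have gc: "cis (z * x) * complex_of_real (exp (- a * x\<^sup>2)) = sqrt (2 * pi) *\<^sub>R g (0 + c * x)" for x
  proof -
    have "(c * x)\<^sup>2 / 2 = a * x\<^sup>2" using c by (simp add: power_mult_distrib)
    then show ?thesis using c(1)
      by (simp add: g_def normal_density_def scaleR_conv_of_real)
  qed
  have int: "integrable lborel (\<lambda>x. g (0 + c * x))"
    using int_g c(1) by (intro lborel_integrable_real_affine) auto
  then show "integrable lborel (\<lambda>x. cis (z * x) * complex_of_real (exp (- a * x\<^sup>2)))"
    unfolding gc by (intro integrable_scaleR_right) auto
  have "(LINT x|lborel. cis (z * x) * complex_of_real (exp (- a * x\<^sup>2)))
    = sqrt (2 * pi) *\<^sub>R (LINT x|lborel. g (0 + c * x))"
    unfolding gc by simp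
  also have "(LINT x|lborel. g (0 + c * x)) = (1 / c) *\<^sub>R complex_of_real (exp (- (z / c)\<^sup>2 / 2))"
    using val c(1) by (simp add: field_simps scaleR_conv_of_real)
  finally have *: "(LINT x|lborel. cis (z * x) * complex_of_real (exp (- a * x\<^sup>2)))
    = sqrt (2 * pi) *\<^sub>R (1 / c) *\<^sub>R complex_of_real (exp (- (z\<^sup>2 / (4 * a))))"
    using c by (simp add: power_divide)
  have "sqrt (2 * pi) * (1 / c) = sqrt (pi / a)"
    using a by (simp add: c_def real_sqrt_mult real_sqrt_divide)
  then show "(LINT x|lborel. cis (z * x) * complex_of_real (exp (- a * x\<^sup>2)))
      = complex_of_real (sqrt (pi / a) * exp (- z\<^sup>2 / (4 * a)))"
    unfolding * scaleR_scaleR by (simp only: scaleR_conv_of_real of_real_mult minus_divide_left)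
qed

text \<open>The character and the Gaussian both factor over the coordinates, and
  \<open>lborel\<close> is the image of the product measure under \<open>?T\<close>, so the
  one-dimensional case suffices.\<close>

lemma gaussian_fourier:
  fixes z :: "'a::euclidean_space"
  assumes a: "0 < a"
  shows "integrable lborel (\<lambda>x::'a. cis (z \<bullet> x) * complex_of_real (exp (- a * (norm x)\<^sup>2)))" (is "integrable _ ?F")
    and "(LINT x|lborel. cis (z \<bullet> x) * complex_of_real (exp (- a * (norm x)\<^sup>2)))
      = complex_of_real ((pi / a) powr (real DIM('a) / 2) * exp (- (norm z)\<^sup>2 / (4 * a)))"
proof -
  interpret product_sigma_finite "\<lambda>_::'a. lborel :: real measure" ..
  let ?T = "\<lambda>f::'a \<Rightarrow> real. \<Sum>b\<in>Basis. f b *\<^sub>R b"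
  define g where "g = (\<lambda>b::'a. \<lambda>x::real. cis ((z \<bullet> b) * x) * complex_of_real (exp (- a * x\<^sup>2)))"
  have F_meas: "?F \<in> borel_measurable borel"
    by (intro borel_measurable_continuous_onI) (auto intro!: continuous_intros simp: cis_conv_exp)
  have T_meas: "?T \<in> measurable (\<Pi>\<^sub>M b\<in>Basis. lborel) borel" by measurable
  have eq: "?F (?T f) = (\<Prod>b\<in>Basis. g b (f b))" for f
  proof -
    have 1: "z \<bullet> ?T f = (\<Sum>b\<in>Basis. (z \<bullet> b) * f b)"
      by (simp add: inner_sum_right mult.commute)
    have "?T f \<bullet> b = f b" if "b \<in> Basis" for b
      using that by simp
    then have 2: "(norm (?T f))\<^sup>2 = (\<Sum>b\<in>Basis. (f b)\<^sup>2)"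
      unfolding power2_norm_eq_inner by (subst euclidean_inner) (simp add: power2_eq_square)
    have "cis (z \<bullet> ?T f) = (\<Prod>b\<in>Basis. cis ((z \<bullet> b) * f b))"
      unfolding 1 by (simp add: cis_conv_exp sum_distrib_left exp_sum)
    moreover have "exp (- a * (norm (?T f))\<^sup>2) = (\<Prod>b\<in>Basis. exp (- a * (f b)\<^sup>2))"
      unfolding 2 by (simp add: sum_distrib_left exp_sum sum_negf[symmetric])
    ultimately show ?thesis by (simp add: g_def prod.distrib)
  qed
  have gi: "integrable lborel (g b)" for b
    unfolding g_def by (rule gaussian_fourier_1d(1)[OF a])
  have "integrable (\<Pi>\<^sub>M b\<in>Basis. lborel) (\<lambda>f. \<Prod>b\<in>Basis. g b (f b))"
    by (rule product_integrable_prod) (auto intro: gi)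
  then show "integrable lborel ?F"
    unfolding lborel_eq[where 'a='a] integrable_distr_eq[OF T_meas F_meas] eq .
  have "(LINT x|lborel. ?F x) = (\<integral>f. (\<Prod>b\<in>Basis. g b (f b)) \<partial>(\<Pi>\<^sub>M b\<in>Basis. lborel))"
    unfolding lborel_eq[where 'a='a] integral_distr[OF T_meas F_meas] eq ..
  also have "\<dots> = (\<Prod>b\<in>Basis. (LINT x|lborel. g b x))"
    by (rule product_integral_prod) (auto intro: gi)
  also have "\<dots> = (\<Prod>b\<in>Basis. complex_of_real (sqrt (pi / a) * exp (- (z \<bullet> b)\<^sup>2 / (4 * a))))"
    unfolding g_def by (intro prod.cong refl gaussian_fourier_1d(2)[OF a])
  also have "\<dots> = complex_of_real (\<Prod>b\<in>Basis. (sqrt (pi / a) * exp (- (z \<bullet> b)\<^sup>2 / (4 * a))))"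
    by simp
  also have "(\<Prod>b\<in>Basis. (sqrt (pi / a) * exp (- (z \<bullet> b)\<^sup>2 / (4 * a))))
    = sqrt (pi / a) ^ DIM('a) * exp (\<Sum>b\<in>Basis. - (z \<bullet> b)\<^sup>2 / (4 * a))"
    by (simp add: prod.distrib exp_sum)
  also have "(\<Sum>b\<in>Basis. - (z \<bullet> b)\<^sup>2 / (4 * a)) = - (norm z)\<^sup>2 / (4 * a)"
    unfolding power2_norm_eq_inner by (subst (2) euclidean_inner)
      (simp add: power2_eq_square sum_negf sum_divide_distrib)
  also have "sqrt (pi / a) ^ DIM('a) = (pi / a) powr (real DIM('a) / 2)"
    using a by (simp add: powr_half_sqrt_powr[symmetric] powr_half_sqrt[symmetric] powr_powr powr_realpow[symmetric])
  finally show "(LINT x|lborel. ?F x)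
      = complex_of_real ((pi / a) powr (real DIM('a) / 2) * exp (- (norm z)\<^sup>2 / (4 * a)))" .
qed

lemma gaussian_integrable:
  assumes "0 < a"
  shows "integrable lborel (\<lambda>x::'a::euclidean_space. exp (- a * (norm x)\<^sup>2))"
  using gaussian_fourier(1)[OF assms, of "0::'a", THEN integrable_Re] by simp

lemma gaussian_cos:
  fixes z :: "'a::euclidean_space"
  assumes "0 < a"
  shows "(LINT x|lborel. cos (z \<bullet> x) * exp (- a * (norm x)\<^sup>2))
      = (pi / a) powr (real DIM('a) / 2) * exp (- (norm z)\<^sup>2 / (4 * a))"
  using integral_Re[OF gaussian_fourier(1)[OF assms, of z], unfolded gaussian_fourier(2)[OF assms, of z]]
  by simp

lemma gaussian_sin:
  fixes z :: "'a::euclidean_space"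
  assumes "0 < a"
  shows "(LINT x|lborel. sin (z \<bullet> x) * exp (- a * (norm x)\<^sup>2)) = 0"
  using integral_Im[OF gaussian_fourier(1)[OF assms, of z], unfolded gaussian_fourier(2)[OF assms, of z]]
  by simp

text \<open>Product-to-sum formula. The two bumps, at \<open>w\<close> and \<open>- w\<close>, are
  merged in \<open>heatL_kernel_gaussian_mean\<close> by the evenness of the symbol.\<close>

lemma gaussian_cos_cos:
  fixes z w :: "'a::euclidean_space"
  assumes a: "0 < a"
  shows "(LINT x|lborel. cos (z \<bullet> x) * cos (w \<bullet> x) * exp (- a * (norm x)\<^sup>2))
      = (pi / a) powr (real DIM('a) / 2) *
        (exp (- (norm (z - w))\<^sup>2 / (4 * a)) + exp (- (norm (z + w))\<^sup>2 / (4 * a))) / 2"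
proof -
  have i: "integrable lborel (\<lambda>x. cos (v \<bullet> x) * exp (- a * (norm x)\<^sup>2))" for v :: 'a
    using gaussian_fourier(1)[OF a, of v, THEN integrable_Re] by simp
  have "(LINT x|lborel. cos (z \<bullet> x) * cos (w \<bullet> x) * exp (- a * (norm x)\<^sup>2))
    = (LINT x|lborel. (cos ((z - w) \<bullet> x) * exp (- a * (norm x)\<^sup>2) + cos ((z + w) \<bullet> x) * exp (- a * (norm x)\<^sup>2)) / 2)"
    by (intro Bochner_Integration.integral_cong refl)
       (simp add: inner_add_left inner_diff_left cos_add cos_diff field_simps)
  also have "\<dots> = ((LINT x|lborel. cos ((z - w) \<bullet> x) * exp (- a * (norm x)\<^sup>2))
      + (LINT x|lborel. cos ((z + w) \<bullet> x) * exp (- a * (norm x)\<^sup>2))) / 2"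
    using i[of "z - w"] i[of "z + w"] by simp
  finally show ?thesis unfolding gaussian_cos[OF a] by (simp add: field_simps)
qed

section \<open>Reflections of Lebesgue measure\<close>

lemma lborel_distr_reflect: "distr lborel borel (\<lambda>x. z - x) = (lborel :: 'a::euclidean_space measure)"
  using lborel_affine[of "-1" z] by (simp add: density_1)

lemma lborel_integral_reflect:
  fixes g :: "'a::euclidean_space \<Rightarrow> 'b::{banach, second_countable_topology}"
  assumes [measurable]: "g \<in> borel_measurable borel"
  shows "(LINT x|lborel. g (z - x)) = (LINT x|lborel. g x)"
  by (subst (2) lborel_distr_reflect[of z, symmetric]) (simp add: integral_distr)

lemma lborel_integrable_reflect:
  fixes g :: "'a::euclidean_space \<Rightarrow> 'b::{banach, second_countable_topology}"
  assumes [measurable]: "g \<in> borel_measurable borel"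
  shows "integrable lborel (\<lambda>x. g (z - x)) \<longleftrightarrow> integrable lborel g"
  by (subst (2) lborel_distr_reflect[of z, symmetric]) (simp add: integrable_distr_eq)

lemma lborel_nn_integral_reflect:
  fixes g :: "'a::euclidean_space \<Rightarrow> ennreal"
  assumes [measurable]: "g \<in> borel_measurable borel"
  shows "(\<integral>\<^sup>+x. g (z - x) \<partial>lborel) = (\<integral>\<^sup>+x. g x \<partial>lborel)"
  by (subst (2) lborel_distr_reflect[of z, symmetric]) (simp add: nn_integral_distr)

text \<open>Reflecting at \<open>z\<close> centres the Gaussian; in the addition formula for the
  cosine the sine term then integrates to zero.\<close>

lemma gaussian_cos_shift:
  fixes z w :: "'a::euclidean_space"
  assumes a: "0 < a"
  shows "(LINT x|lborel. cos (x \<bullet> w) * exp (- a * (norm (z - x))\<^sup>2))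
      = (pi / a) powr (real DIM('a) / 2) * cos (z \<bullet> w) * exp (- (norm w)\<^sup>2 / (4 * a))"
proof -
  have ic: "integrable lborel (\<lambda>x. cos (w \<bullet> x) * exp (- a * (norm x)\<^sup>2))"
    using gaussian_fourier(1)[OF a, of w, THEN integrable_Re] by simp
  have si: "integrable lborel (\<lambda>x. sin (w \<bullet> x) * exp (- a * (norm x)\<^sup>2))"
    using gaussian_fourier(1)[OF a, of w, THEN integrable_Im] by simp
  have "(LINT x|lborel. cos (x \<bullet> w) * exp (- a * (norm (z - x))\<^sup>2))
    = (LINT x|lborel. cos ((z - x) \<bullet> w) * exp (- a * (norm (z - (z - x)))\<^sup>2))"
    by (rule lborel_integral_reflect[symmetric]) simp
  also have "\<dots> = (LINT x|lborel. cos (z \<bullet> w) * (cos (w \<bullet> x) * exp (- a * (norm x)\<^sup>2))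
      + sin (z \<bullet> w) * (sin (w \<bullet> x) * exp (- a * (norm x)\<^sup>2)))"
    by (intro Bochner_Integration.integral_cong refl)
       (simp add: inner_diff_left cos_diff inner_commute[of w] algebra_simps)
  also have "\<dots> = cos (z \<bullet> w) * (LINT x|lborel. cos (w \<bullet> x) * exp (- a * (norm x)\<^sup>2))
      + sin (z \<bullet> w) * (LINT x|lborel. sin (w \<bullet> x) * exp (- a * (norm x)\<^sup>2))"
    using ic si by simp
  finally show ?thesis unfolding gaussian_cos[OF a] gaussian_sin[OF a] by simp
qed

section \<open>Positive definiteness of the fractional symbol\<close>

text \<open>Supplies the Fubini hypothesis whenever an integral over space is exchanged with one
  over frequency or over a mixture parameter: there the integrand is dominated by a product of
  integrable functions.\<close>

lemma integrable_lborel_tensor_bound: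
  fixes f :: "'a::euclidean_space \<Rightarrow> real" and g :: "'b::euclidean_space \<Rightarrow> real"
  assumes f: "integrable lborel f" and g: "integrable lborel g"
    and meas: "(\<lambda>(x, y). F x y) \<in> borel_measurable (lborel \<Otimes>\<^sub>M lborel)"
    and bound: "\<And>x y. \<bar>F x y\<bar> \<le> \<bar>f x\<bar> * \<bar>g y\<bar>"
  shows "integrable (lborel \<Otimes>\<^sub>M lborel) (\<lambda>(x, y). F x y :: real)"
proof (rule Bochner_Integration.integrable_bound[OF _ meas])
  have [measurable]: "f \<in> borel_measurable borel" "g \<in> borel_measurable borel"
    using f g borel_measurable_integrable by auto
  have "integrable lborel (\<lambda>x. \<bar>f x\<bar> * (LINT y|lborel. \<bar>g y\<bar>))"
    using f by simp
  then show "integrable (lborel \<Otimes>\<^sub>M lborel) (\<lambda>(x, y). f x * g y)"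
    using g by (intro lborel_pair.Fubini_integrable) (auto simp: abs_mult)
  show "AE z in lborel \<Otimes>\<^sub>M lborel. norm (case z of (x, y) \<Rightarrow> F x y) \<le> norm (case z of (x, y) \<Rightarrow> f x * g y)"
    using bound by (auto simp: abs_mult)
qed

text \<open>Layer cake: exp (-u) is the integral of exp (-r) over r \<ge> u. After exchanging
  integrals, the sublevel sets of t |xi|^(2s) are balls, and what remains is a Gamma
  integral.\<close>

lemma integrable_exp_norm_powr:
  assumes t: "0 < t" and s: "0 < s"
  shows "integrable lborel (\<lambda>\<xi>::'a::euclidean_space. exp (- t * norm \<xi> powr (2 * s)))"
proof (rule integrableI_bounded)
  \<comment> \<open>Growth exponent of the sublevel sets: the ball where t |xi|^(2s) \<le> r has
    volume \<open>C\<close> r^d.\<close>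
  define d where "d = real DIM('a) / (2 * s)"
  have d: "0 < d" using s by (simp add: d_def)
  define C where "C = unit_ball_vol (real DIM('a)) / t powr d"
  have C: "0 \<le> C" by (simp add: C_def)
  have tail: "(\<integral>\<^sup>+r. ennreal (exp (- r)) * indicator {u..} r \<partial>lborel) = ennreal (exp (- u))" for u :: real
  proof -
    have lim: "((\<lambda>r::real. - exp (- r)) \<longlongrightarrow> 0) at_top"
      using tendsto_minus[OF filterlim_compose[OF exp_at_bot filterlim_uminus_at_bot_at_top]] by simp
    show ?thesis
      by (subst nn_integral_FTC_atLeast[OF _ _ _ lim]) (auto intro!: derivative_eq_intros)
  qed
  have level: "{\<xi>::'a. t * norm \<xi> powr (2 * s) \<le> r} = cball 0 ((r / t) powr (1 / (2 * s)))" if "0 \<le> r" for r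
  proof -
    have "t * norm \<xi> powr (2 * s) \<le> r \<longleftrightarrow> norm \<xi> \<le> (r / t) powr (1 / (2 * s))" for \<xi> :: 'a
    proof -
      have "t * norm \<xi> powr (2 * s) \<le> r \<longleftrightarrow> norm \<xi> powr (2 * s) \<le> ((r / t) powr (1 / (2 * s))) powr (2 * s)"
        using t s that by (simp add: powr_powr field_simps)
      also have "\<dots> \<longleftrightarrow> norm \<xi> \<le> (r / t) powr (1 / (2 * s))"
        using powr_less_mono2[of "2 * s" "(r / t) powr (1 / (2 * s))" "norm \<xi>"]
          powr_mono2[of "2 * s" "norm \<xi>" "(r / t) powr (1 / (2 * s))"] s
        by (cases "norm \<xi> \<le> (r / t) powr (1 / (2 * s))") (auto simp: not_le)
      finally show ?thesis .
    qed
    then show ?thesis unfolding set_eq_iff mem_Collect_eq mem_cball_0 by blast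
  qed
  have "(\<integral>\<^sup>+(\<xi>::'a). norm (exp (- t * norm \<xi> powr (2 * s))) \<partial>lborel)
    = (\<integral>\<^sup>+(\<xi>::'a). \<integral>\<^sup>+r. ennreal (exp (- r)) * indicator {t * norm \<xi> powr (2 * s)..} r \<partial>lborel \<partial>lborel)"
    by (subst tail) simp
  also have "\<dots> = (\<integral>\<^sup>+r. \<integral>\<^sup>+(\<xi>::'a). ennreal (exp (- r)) * indicator {t * norm \<xi> powr (2 * s)..} r \<partial>lborel \<partial>lborel)"
    by (rule lborel_pair.Fubini'[symmetric]) (unfold split_beta' indicator_def of_bool_def atLeast_iff, measurable)
  also have "\<dots> \<le> (\<integral>\<^sup>+r. ennreal C * ennreal (indicator {0..} r * r powr ((d + 1) - 1) / exp r) \<partial>lborel)"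
  proof (rule nn_integral_mono)
    fix r :: real
    show "(\<integral>\<^sup>+(\<xi>::'a). ennreal (exp (- r)) * indicator {t * norm \<xi> powr (2 * s)..} r \<partial>lborel)
      \<le> ennreal C * ennreal (indicator {0..} r * r powr ((d + 1) - 1) / exp r)"
    proof (cases "0 \<le> r")
      case True
      have "(\<integral>\<^sup>+(\<xi>::'a). ennreal (exp (- r)) * indicator {t * norm \<xi> powr (2 * s)..} r \<partial>lborel)
        = (\<integral>\<^sup>+(\<xi>::'a). ennreal (exp (- r)) * indicator {\<xi>. t * norm \<xi> powr (2 * s) \<le> r} \<xi> \<partial>lborel)"
        by (intro nn_integral_cong) (auto simp: indicator_def)
      also have "\<dots> = ennreal (exp (- r)) * emeasure lborel (cball (0::'a) ((r / t) powr (1 / (2 * s))))"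
        unfolding level[OF True] by (subst nn_integral_cmult_indicator) auto
      also have "\<dots> = ennreal (exp (- r) * (unit_ball_vol (real DIM('a)) * ((r / t) powr (1 / (2 * s))) ^ DIM('a)))"
        by (subst emeasure_cball) (auto simp: ennreal_mult)
      also have "((r / t) powr (1 / (2 * s))) ^ DIM('a) = r powr d / t powr d"
        using True t by (cases "r = 0") (simp_all add: powr_power powr_divide d_def power_divide)
      also have "exp (- r) * (unit_ball_vol (real DIM('a)) * (r powr d / t powr d))
        = C * (indicator {0..} r * r powr ((d + 1) - 1) / exp r)"
        using True by (simp add: C_def exp_minus divide_inverse mult_ac)
      finally show ?thesis using True C by (simp flip: ennreal_mult)
    next
      case False
      have "r < t * norm \<xi> powr (2 * s)" for \<xi> :: 'a
      proof -
        have "0 \<le> t * norm \<xi> powr (2 * s)" using t by simp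
        then show ?thesis using False by linarith
      qed
      then show ?thesis by (simp add: not_le)
    qed
  qed
  also have "\<dots> = ennreal C * ennreal (Gamma (d + 1))"
    using Gamma_conv_nn_integral_real[of "d + 1"] d by (subst nn_integral_cmult) auto
  also have "\<dots> < \<infinity>" by (simp add: ennreal_mult_less_top)
  finally show "(\<integral>\<^sup>+(\<xi>::'a). norm (exp (- t * norm \<xi> powr (2 * s))) \<partial>lborel) < \<infinity>" .
qed simp

text \<open>The Levy-Khintchine integrand of the s-stable subordinator, up to a constant;
  \<open>l\<close> will be the squared norm of a frequency.\<close>

definition levy_integrand :: "real \<Rightarrow> real \<Rightarrow> real \<Rightarrow> real" where
  "levy_integrand s l r = indicator {0<..} r * ((1 - exp (- r * l)) * r powr (- 1 - s))"

lemma levy_integrand_measurable [measurable]: "levy_integrand s l \<in> borel_measurable borel"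
  unfolding levy_integrand_def by measurable

lemma levy_integrand_nonneg: "0 \<le> l \<Longrightarrow> 0 \<le> levy_integrand s l r"
  by (auto simp: levy_integrand_def indicator_def)

text \<open>Near 0 the bound 1 - exp (-r) \<le> r leaves r^(-s), integrable as s < 1; from 1 on the
  integrand is at most r^(-1-s), integrable as s > 0.\<close>

lemma levy_integrable_1:
  assumes s: "0 < s" "s < 1"
  shows "integrable lborel (levy_integrand s 1)"
proof (rule Bochner_Integration.integrable_bound)
  have "(\<lambda>r::real. r powr (- s)) absolutely_integrable_on {0<..1}"
    using s by (intro nonnegative_absolutely_integrable_1 integrable_on_powr_from_0') auto
  then have 1: "integrable lborel (\<lambda>r. indicator {0<..1} r * r powr (- s))"
    unfolding set_integrable_def by (subst (asm) integrable_completion) auto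
  have "(\<lambda>r::real. r powr (- 1 - s)) absolutely_integrable_on {1..}"
    using s has_integral_powr_to_inf[of "- 1 - s" 1]
    by (intro nonnegative_absolutely_integrable_1) (auto simp: integrable_on_def)
  then have 2: "integrable lborel (\<lambda>r. indicator {1..} r * r powr (- 1 - s))"
    unfolding set_integrable_def by (subst (asm) integrable_completion) auto
  show "integrable lborel (\<lambda>r. indicator {0<..1} r * r powr (- s) + indicator {1..} r * r powr (- 1 - s))"
    using 1 2 by simp
  have "norm (levy_integrand s 1 r)
    \<le> norm (indicator {0<..1} r * r powr (- s) + indicator {1..} r * r powr (- 1 - s))" for r
  proof -
    consider "r \<le> 0" | "0 < r" "r < 1" | "1 \<le> r" by linarith
    then show ?thesis
    proof cases
      case 2
      have "1 - exp (- r) \<le> r" using exp_ge_add_one_self[of "- r"] by linarith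
      then have "(1 - exp (- r)) * r powr (- 1 - s) \<le> r powr 1 * r powr (- 1 - s)"
        using 2 by (intro mult_right_mono) auto
      also have "\<dots> = r powr (- s)" by (simp flip: powr_add del: powr_one powr_one')
      finally show ?thesis using 2 by (simp add: levy_integrand_def)
    next
      case 3
      have "(1 - exp (- r)) * r powr (- 1 - s) \<le> 1 * r powr (- 1 - s)"
        by (intro mult_right_mono) auto
      then have "\<bar>levy_integrand s 1 r\<bar> \<le> r powr (- 1 - s)"
        using 3 by (simp add: levy_integrand_def)
      also have "\<dots> \<le> \<bar>indicator {0<..1} r * r powr (- s) + indicator {1..} r * r powr (- 1 - s)\<bar>"
        using 3 by (intro order_trans[OF _ abs_ge_self]) (simp add: indicator_def)
      finally show ?thesis by simp
    qed (simp add: levy_integrand_def)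
  qed
  then show "AE r in lborel. norm (levy_integrand s 1 r)
    \<le> norm (indicator {0<..1} r * r powr (- s) + indicator {1..} r * r powr (- 1 - s))" by simp
qed simp

text \<open>Scaling: replacing r by l r extracts l^(1+s) from the integrand and gives back one
  factor l through the substitution. The value at l = 1 is left as an integral.\<close>

lemma levy_integral:
  assumes s: "0 < s" "s < 1" and l: "0 \<le> l"
  shows "integrable lborel (levy_integrand s l)"
    and "(LINT r|lborel. levy_integrand s l r) = l powr s * (LINT r|lborel. levy_integrand s 1 r)"
proof -
  have "integrable lborel (levy_integrand s l) \<and>
    (LINT r|lborel. levy_integrand s l r) = l powr s * (LINT r|lborel. levy_integrand s 1 r)"
  proof (cases "l = 0")
    case True
    then have "levy_integrand s l = (\<lambda>_. 0)" by (auto simp: levy_integrand_def)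
    then show ?thesis using True by simp
  next
    case False
    then have l: "0 < l" using l by simp
    have eq: "levy_integrand s l = (\<lambda>r. l powr (1 + s) * levy_integrand s 1 (0 + l * r))"
    proof
      fix r
      show "levy_integrand s l r = l powr (1 + s) * levy_integrand s 1 (0 + l * r)"
      proof (cases "0 < r")
        case True
        have "l powr (1 + s) * (l * r) powr (- 1 - s) = r powr (- 1 - s)"
          using True l by (simp add: powr_mult flip: mult.assoc powr_add)
        then show ?thesis using True l by (simp add: levy_integrand_def mult.commute mult.left_commute)
      qed (use l in \<open>simp add: levy_integrand_def zero_less_mult_iff\<close>)
    qed
    have "(LINT r|lborel. levy_integrand s 1 r) = l * (LINT r|lborel. levy_integrand s 1 (0 + l * r))"
      using l by (subst lborel_integral_real_affine[of l _ 0]) auto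
    then have "l powr s * (LINT r|lborel. levy_integrand s 1 r) = l powr (s + 1) * (LINT r|lborel. levy_integrand s 1 (0 + l * r))"
      using l by (simp add: powr_add)
    then show ?thesis
      unfolding eq using l lborel_integrable_real_affine[OF levy_integrable_1[OF s], of l 0]
      by (simp add: add.commute)
  qed
  then show "integrable lborel (levy_integrand s l)"
    "(LINT r|lborel. levy_integrand s l r) = l powr s * (LINT r|lborel. levy_integrand s 1 r)" by auto
qed

lemma levy_constant_pos:
  assumes s: "0 < s" "s < 1"
  shows "0 < (LINT r|lborel. levy_integrand s 1 r)"
proof -
  have "(LINT r|lborel. levy_integrand s 1 r) \<noteq> 0"
  proof
    assume "(LINT r|lborel. levy_integrand s 1 r) = 0"
    then have "AE r in lborel. levy_integrand s 1 r = 0"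
      by (subst (asm) integral_nonneg_eq_0_iff_AE[OF levy_integrable_1[OF s]]) (auto simp: levy_integrand_nonneg)
    then have "AE r in lborel. r \<notin> {0<..<1::real}"
      by eventually_elim (auto simp: levy_integrand_def)
    then have "emeasure lborel {0<..<1::real} = 0"
      by (subst (asm) AE_iff_measurable[where N="{0<..<1::real}"]) auto
    then show False by simp
  qed
  moreover have "0 \<le> (LINT r|lborel. levy_integrand s 1 r)"
    by (simp add: levy_integrand_nonneg)
  ultimately show ?thesis by simp
qed

text \<open>
  Positivity of the Fourier transform after damping by an arbitrary Gaussian: unlike plain positive
  definiteness, this condition is visibly stable under multiplication by mixtures of Gaussians,
  because the product of two Gaussian dampings is again one.
\<close>

definition gauss_pd :: "('a::euclidean_space \<Rightarrow> real) \<Rightarrow> bool" where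
  "gauss_pd \<phi> \<longleftrightarrow> \<phi> \<in> borel_measurable borel \<and> (\<exists>B. \<forall>\<xi>. \<bar>\<phi> \<xi>\<bar> \<le> B) \<and>
     (\<forall>a>0. \<forall>z. 0 \<le> (LINT \<xi>|lborel. cos (z \<bullet> \<xi>) * (exp (- a * (norm \<xi>)\<^sup>2) * \<phi> \<xi>)))"

lemma gauss_pd_integrable:
  fixes \<phi> :: "'a::euclidean_space \<Rightarrow> real"
  assumes [measurable]: "\<phi> \<in> borel_measurable borel" and B: "\<And>\<xi>. \<bar>\<phi> \<xi>\<bar> \<le> B" and a: "0 < a"
  shows "integrable lborel (\<lambda>\<xi>. cos (z \<bullet> \<xi>) * (exp (- a * (norm \<xi>)\<^sup>2) * \<phi> \<xi>))"
proof (rule Bochner_Integration.integrable_bound)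
  show "integrable lborel (\<lambda>x::'a. B * exp (- a * (norm x)\<^sup>2))"
    by (intro integrable_mult_right gaussian_integrable a)
  have "\<bar>cos (z \<bullet> x)\<bar> * (exp (- a * (norm x)\<^sup>2) * \<bar>\<phi> x\<bar>) \<le> 1 * (exp (- a * (norm x)\<^sup>2) * B)" for x
    using B by (intro mult_mono) auto
  moreover have "0 \<le> B" using B[of 0] by linarith
  ultimately show "AE x in lborel. norm (cos (z \<bullet> x) * (exp (- a * (norm x)\<^sup>2) * \<phi> x)) \<le> norm (B * exp (- a * (norm x)\<^sup>2))"
    by (simp add: abs_mult mult.commute)
qed simp

section \<open>Closure properties of positivity under Gaussian damping\<close>

lemma gauss_pd_const:
  assumes "0 \<le> c"
  shows "gauss_pd (\<lambda>_::'a::euclidean_space. c)"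
  unfolding gauss_pd_def
proof (intro conjI allI impI)
  fix a :: real and z :: 'a
  assume a: "0 < a"
  have "(LINT \<xi>|lborel. cos (z \<bullet> \<xi>) * (exp (- a * (norm \<xi>)\<^sup>2) * c))
    = (LINT \<xi>|lborel. cos (z \<bullet> \<xi>) * exp (- a * (norm \<xi>)\<^sup>2)) * c"
    by (simp flip: mult.assoc)
  then show "0 \<le> (LINT \<xi>|lborel. cos (z \<bullet> \<xi>) * (exp (- a * (norm \<xi>)\<^sup>2) * c))"
    unfolding gaussian_cos[OF a] using assms by simp
qed auto

lemma gauss_pd_cmult:
  assumes "gauss_pd \<phi>" "0 \<le> c"
  shows "gauss_pd (\<lambda>\<xi>. c * \<phi> \<xi>)"
proof -
  obtain B where B: "\<And>\<xi>. \<bar>\<phi> \<xi>\<bar> \<le> B" using assms by (auto simp: gauss_pd_def)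
  have "\<bar>c * \<phi> \<xi>\<bar> \<le> c * B" for \<xi> using B[of \<xi>] assms(2) by (simp add: abs_mult mult_left_mono)
  then have "\<exists>B. \<forall>\<xi>. \<bar>c * \<phi> \<xi>\<bar> \<le> B" by blast
  moreover have "(LINT \<xi>|lborel. cos (z \<bullet> \<xi>) * (exp (- a * (norm \<xi>)\<^sup>2) * (c * \<phi> \<xi>)))
    = c * (LINT \<xi>|lborel. cos (z \<bullet> \<xi>) * (exp (- a * (norm \<xi>)\<^sup>2) * \<phi> \<xi>))" for a z
    by (subst integral_mult_right_zero[symmetric]) (simp add: algebra_simps)
  moreover have "(\<lambda>\<xi>. c * \<phi> \<xi>) \<in> borel_measurable borel"
    using assms(1) unfolding gauss_pd_def by (intro borel_measurable_times) auto
  ultimately show ?thesis using assms unfolding gauss_pd_def by simp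
qed

lemma gauss_pd_add:
  assumes "gauss_pd \<phi>" "gauss_pd \<psi>"
  shows "gauss_pd (\<lambda>\<xi>. \<phi> \<xi> + \<psi> \<xi>)"
proof -
  obtain B where B: "\<And>\<xi>. \<bar>\<phi> \<xi>\<bar> \<le> B" using assms by (auto simp: gauss_pd_def)
  obtain C where C: "\<And>\<xi>. \<bar>\<psi> \<xi>\<bar> \<le> C" using assms by (auto simp: gauss_pd_def)
  have [measurable]: "\<phi> \<in> borel_measurable borel" "\<psi> \<in> borel_measurable borel"
    using assms by (auto simp: gauss_pd_def)
  have "\<bar>\<phi> \<xi> + \<psi> \<xi>\<bar> \<le> B + C" for \<xi> using B[of \<xi>] C[of \<xi>] by linarith
  then have "\<exists>B. \<forall>\<xi>. \<bar>\<phi> \<xi> + \<psi> \<xi>\<bar> \<le> B" by blast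
  moreover have "(LINT \<xi>|lborel. cos (z \<bullet> \<xi>) * (exp (- a * (norm \<xi>)\<^sup>2) * (\<phi> \<xi> + \<psi> \<xi>)))
    = (LINT \<xi>|lborel. cos (z \<bullet> \<xi>) * (exp (- a * (norm \<xi>)\<^sup>2) * \<phi> \<xi>))
    + (LINT \<xi>|lborel. cos (z \<bullet> \<xi>) * (exp (- a * (norm \<xi>)\<^sup>2) * \<psi> \<xi>))" if "0 < a" for a z
    by (subst Bochner_Integration.integral_add[symmetric])
      (auto simp: algebra_simps intro!: gauss_pd_integrable[OF _ B that, simplified] gauss_pd_integrable[OF _ C that, simplified])
  ultimately show ?thesis using assms unfolding gauss_pd_def by simp
qed

lemma gauss_pd_sum:
  assumes "\<And>i. i \<in> I \<Longrightarrow> gauss_pd (\<phi> i)"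
  shows "gauss_pd (\<lambda>\<xi>. \<Sum>i\<in>I. \<phi> i \<xi>)"
  using assms by (induction I rule: infinite_finite_induct) (auto intro: gauss_pd_const gauss_pd_add)

text \<open>Because of the damping, a common bound on the symbols is enough to supply an integrable
  majorant, \<open>B\<close> times a Gaussian.\<close>

lemma gauss_pd_limit:
  fixes \<phi> :: "'a::euclidean_space \<Rightarrow> real"
  assumes pd: "\<And>n. gauss_pd (\<phi>n n)" and B: "\<And>n \<xi>. \<bar>\<phi>n n \<xi>\<bar> \<le> B"
    and lim: "\<And>\<xi>. (\<lambda>n. \<phi>n n \<xi>) \<longlonglongrightarrow> \<phi> \<xi>"
  shows "gauss_pd \<phi>"
  unfolding gauss_pd_def
proof (intro conjI allI impI exI)
  have [measurable]: "\<phi>n n \<in> borel_measurable borel" for n using pd by (auto simp: gauss_pd_def)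
  show [measurable]: "\<phi> \<in> borel_measurable borel"
    by (rule borel_measurable_LIMSEQ_real[of _ \<phi>n]) (auto intro: lim)
  fix \<xi> show "\<bar>\<phi> \<xi>\<bar> \<le> B"
    by (rule tendsto_upperbound[OF tendsto_rabs[OF lim]]) (auto simp: B)
  fix a :: real and z :: 'a
  assume a: "0 < a"
  have "(\<lambda>n. LINT \<xi>|lborel. cos (z \<bullet> \<xi>) * (exp (- a * (norm \<xi>)\<^sup>2) * \<phi>n n \<xi>))
    \<longlonglongrightarrow> (LINT \<xi>|lborel. cos (z \<bullet> \<xi>) * (exp (- a * (norm \<xi>)\<^sup>2) * \<phi> \<xi>))"
  proof (rule integral_dominated_convergence)
    show "integrable lborel (\<lambda>x::'a. exp (- a * (norm x)\<^sup>2) * B)"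
      by (intro integrable_mult_left gaussian_integrable a)
    fix n
    have "\<bar>cos (z \<bullet> x)\<bar> * (exp (- a * (norm x)\<^sup>2) * \<bar>\<phi>n n x\<bar>) \<le> 1 * (exp (- a * (norm x)\<^sup>2) * B)" for x
      using B by (intro mult_mono) auto
    then show "AE x in lborel. norm (cos (z \<bullet> x) * (exp (- a * (norm x)\<^sup>2) * \<phi>n n x)) \<le> exp (- a * (norm x)\<^sup>2) * B"
      by (simp add: abs_mult)
  qed (auto intro!: tendsto_intros lim)
  then show "0 \<le> (LINT \<xi>|lborel. cos (z \<bullet> \<xi>) * (exp (- a * (norm \<xi>)\<^sup>2) * \<phi> \<xi>))"
    using pd a by (intro tendsto_lowerbound) (auto simp: gauss_pd_def)
qed

lemma gaussian_mixture_bounds: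
  fixes \<xi> :: "'a::euclidean_space"
  assumes k: "integrable lborel k" "\<And>r. 0 \<le> k r" "\<And>r. r < 0 \<Longrightarrow> k r = 0"
  shows "integrable lborel (\<lambda>r. k r * exp (- r * (norm \<xi>)\<^sup>2))"
    and "0 \<le> (LINT r|lborel. k r * exp (- r * (norm \<xi>)\<^sup>2))"
    and "(LINT r|lborel. k r * exp (- r * (norm \<xi>)\<^sup>2)) \<le> (LINT r|lborel. k r)"
proof -
  have [measurable]: "k \<in> borel_measurable borel" using k borel_measurable_integrable by auto
  have kexp: "k r * exp (- r * (norm \<xi>)\<^sup>2) \<le> k r" for r
    using k(2,3)[of r] by (cases "r < 0") (auto simp: mult_left_le)
  show int: "integrable lborel (\<lambda>r. k r * exp (- r * (norm \<xi>)\<^sup>2))"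
    using kexp k(2) by (intro Bochner_Integration.integrable_bound[OF k(1)]) auto
  show "0 \<le> (LINT r|lborel. k r * exp (- r * (norm \<xi>)\<^sup>2))" using k(2) by simp
  show "(LINT r|lborel. k r * exp (- r * (norm \<xi>)\<^sup>2)) \<le> (LINT r|lborel. k r)"
    by (intro integral_mono int k(1) kexp)
qed

lemma gauss_pd_mult_mixture:
  fixes \<phi> :: "'a::euclidean_space \<Rightarrow> real"
  assumes pd: "gauss_pd \<phi>" and k: "integrable lborel k" "\<And>r. 0 \<le> k r" "\<And>r. r < 0 \<Longrightarrow> k r = 0"
  shows "gauss_pd (\<lambda>\<xi>. \<phi> \<xi> * (LINT r|lborel. k r * exp (- r * (norm \<xi>)\<^sup>2)))"
  unfolding gauss_pd_def
proof (intro conjI allI impI)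
  have [measurable]: "\<phi> \<in> borel_measurable borel" "k \<in> borel_measurable borel"
    using pd k borel_measurable_integrable by (auto simp: gauss_pd_def)
  obtain B where B: "\<And>\<xi>. \<bar>\<phi> \<xi>\<bar> \<le> B" using pd by (auto simp: gauss_pd_def)
  have B0: "0 \<le> B" using B[of 0] by linarith
  show "(\<lambda>\<xi>. \<phi> \<xi> * (LINT r|lborel. k r * exp (- r * (norm \<xi>)\<^sup>2))) \<in> borel_measurable borel"
    by measurable
  have "\<bar>LINT r|lborel. k r * exp (- r * (norm \<xi>)\<^sup>2)\<bar> \<le> (LINT r|lborel. k r)" for \<xi> :: 'a
    using gaussian_mixture_bounds(2,3)[OF k, of \<xi>] by simp
  then have "\<bar>\<phi> \<xi> * (LINT r|lborel. k r * exp (- r * (norm \<xi>)\<^sup>2))\<bar> \<le> B * (LINT r|lborel. k r)" for \<xi> :: 'a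
    unfolding abs_mult using B B0 by (intro mult_mono) auto
  then show "\<exists>B. \<forall>\<xi>. \<bar>\<phi> \<xi> * (LINT r|lborel. k r * exp (- r * (norm \<xi>)\<^sup>2))\<bar> \<le> B" by blast
next
  have [measurable]: "\<phi> \<in> borel_measurable borel" "k \<in> borel_measurable borel"
    using pd k borel_measurable_integrable by (auto simp: gauss_pd_def)
  obtain B where B: "\<And>\<xi>. \<bar>\<phi> \<xi>\<bar> \<le> B" using pd by (auto simp: gauss_pd_def)
  have B0: "0 \<le> B" using B[of 0] by linarith
  fix a :: real and z :: 'a
  assume a: "0 < a"
  let ?F = "\<lambda>\<xi> r. cos (z \<bullet> \<xi>) * (exp (- a * (norm \<xi>)\<^sup>2) * (\<phi> \<xi> * (k r * exp (- r * (norm \<xi>)\<^sup>2))))"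
  have "\<bar>?F \<xi> r\<bar> \<le> \<bar>B * exp (- a * (norm \<xi>)\<^sup>2)\<bar> * \<bar>k r\<bar>" for \<xi> r
  proof -
    have "\<bar>k r * exp (- r * (norm \<xi>)\<^sup>2)\<bar> \<le> \<bar>k r\<bar>"
      using k(2,3)[of r] by (cases "r < 0") (auto simp: abs_mult mult_left_le)
    then have "\<bar>?F \<xi> r\<bar> \<le> 1 * (exp (- a * (norm \<xi>)\<^sup>2) * (B * \<bar>k r\<bar>))"
      unfolding abs_mult[of "cos _"] abs_mult[of "exp (- a * _)"] abs_mult[of "\<phi> _"] using B B0 by (intro mult_mono) auto
    then show ?thesis using B0 by (simp add: abs_mult mult.commute mult.left_commute)
  qed
  then have int: "integrable (lborel \<Otimes>\<^sub>M lborel) (\<lambda>(\<xi>, r). ?F \<xi> r)"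
    using gaussian_integrable[OF a, where 'a='a] k(1)
    by (intro integrable_lborel_tensor_bound[where f="\<lambda>\<xi>. B * exp (- a * (norm \<xi>)\<^sup>2)" and g=k]) auto
  have "(LINT \<xi>|lborel. cos (z \<bullet> \<xi>) * (exp (- a * (norm \<xi>)\<^sup>2) * (\<phi> \<xi> * (LINT r|lborel. k r * exp (- r * (norm \<xi>)\<^sup>2)))))
    = (LINT \<xi>|lborel. LINT r|lborel. ?F \<xi> r)" by simp
  also have "\<dots> = (LINT r|lborel. LINT \<xi>|lborel. ?F \<xi> r)"
    by (rule lborel_pair.Fubini_integral[symmetric]) (fact int)
  \<comment> \<open>The mixture Gaussian joins the damping, so the hypothesis on
    \<open>\<phi>\<close> applies with \<open>a + r\<close>; this is positive because
    \<open>k\<close> lives on r \<ge> 0.\<close>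
  also have "\<dots> = (LINT r|lborel. k r * (LINT \<xi>|lborel. cos (z \<bullet> \<xi>) * (exp (- (a + r) * (norm \<xi>)\<^sup>2) * \<phi> \<xi>)))"
  proof (intro Bochner_Integration.integral_cong refl)
    fix r
    have "exp (- (a + r) * (norm \<xi>)\<^sup>2) = exp (- a * (norm \<xi>)\<^sup>2) * exp (- r * (norm \<xi>)\<^sup>2)" for \<xi> :: 'a
      by (simp add: algebra_simps flip: exp_add)
    then have "?F \<xi> r = k r * (cos (z \<bullet> \<xi>) * (exp (- (a + r) * (norm \<xi>)\<^sup>2) * \<phi> \<xi>))" for \<xi>
      by simp
    then show "(LINT \<xi>|lborel. ?F \<xi> r) = k r * (LINT \<xi>|lborel. cos (z \<bullet> \<xi>) * (exp (- (a + r) * (norm \<xi>)\<^sup>2) * \<phi> \<xi>))"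
      by (simp only: integral_mult_right_zero)
  qed
  also have "\<dots> \<ge> 0"
  proof (rule integral_nonneg_AE, rule AE_I2)
    fix r
    show "0 \<le> k r * (LINT \<xi>|lborel. cos (z \<bullet> \<xi>) * (exp (- (a + r) * (norm \<xi>)\<^sup>2) * \<phi> \<xi>))"
    proof (cases "r < 0")
      case False
      then have "0 < a + r" using a by simp
      then have "0 \<le> (LINT \<xi>|lborel. cos (z \<bullet> \<xi>) * (exp (- (a + r) * (norm \<xi>)\<^sup>2) * \<phi> \<xi>))"
        using pd unfolding gauss_pd_def by blast
      then show ?thesis using k(2) by (intro mult_nonneg_nonneg)
    qed (simp add: k(3))
  qed
  finally show "0 \<le> (LINT \<xi>|lborel. cos (z \<bullet> \<xi>) * (exp (- a * (norm \<xi>)\<^sup>2) * (\<phi> \<xi> * (LINT r|lborel. k r * exp (- r * (norm \<xi>)\<^sup>2)))))" .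
qed

text \<open>The partial sums of the exponential series are combinations with nonnegative
  coefficients of powers of the mixture, and powers are reached by multiplying with one more
  mixture. The total mass of \<open>k\<close> bounds the mixture, hence all partial sums
  uniformly.\<close>

lemma gauss_pd_exp_mixture:
  assumes k: "integrable lborel k" "\<And>r. 0 \<le> k r" "\<And>r. r < 0 \<Longrightarrow> k r = 0"
  shows "gauss_pd (\<lambda>\<xi>::'a::euclidean_space. exp (LINT r|lborel. k r * exp (- r * (norm \<xi>)\<^sup>2)))"
proof -
  define m where "m = (\<lambda>\<xi>::'a. LINT r|lborel. k r * exp (- r * (norm \<xi>)\<^sup>2))"
  have m0: "0 \<le> m \<xi>" and m1: "m \<xi> \<le> (LINT r|lborel. k r)" for \<xi>
    unfolding m_def using gaussian_mixture_bounds(2,3)[OF k, of \<xi>] by auto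
  have pow: "gauss_pd (\<lambda>\<xi>. m \<xi> ^ n)" for n
  proof (induction n)
    case (Suc n)
    then show ?case using gauss_pd_mult_mixture[OF Suc k] by (simp add: m_def mult.commute)
  qed (use gauss_pd_const[of 1] in simp)
  have "gauss_pd (\<lambda>\<xi>. exp (m \<xi>))"
  proof (rule gauss_pd_limit)
    fix n :: nat
    show "gauss_pd (\<lambda>\<xi>. \<Sum>i<n. (1 / fact i) * m \<xi> ^ i)"
      by (intro gauss_pd_sum gauss_pd_cmult pow) auto
    fix \<xi>
    have sums: "(\<lambda>i. (1 / fact i) * m \<xi> ^ i) sums exp (m \<xi>)"
      using exp_converges[of "m \<xi>"] by (simp add: field_simps)
    have "(\<Sum>i<n. (1 / fact i) * m \<xi> ^ i) \<le> exp (m \<xi>)"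
      using sum_le_suminf[OF sums_summable[OF sums], of "{..<n}"] sums_unique[OF sums] m0 by simp
    also have "\<dots> \<le> exp (LINT r|lborel. k r)" using m1 by simp
    finally show "\<bar>\<Sum>i<n. (1 / fact i) * m \<xi> ^ i\<bar> \<le> exp (LINT r|lborel. k r)"
      using m0 by (subst abs_of_nonneg) (auto intro!: sum_nonneg)
    show "(\<lambda>n. \<Sum>i<n. (1 / fact i) * m \<xi> ^ i) \<longlonglongrightarrow> exp (m \<xi>)"
      using sums by (simp add: sums_def)
  qed
  then show ?thesis by (simp add: m_def)
qed

text \<open>Compound Poisson approximation: with the Levy density cut off near 0 its mass
  \<open>K n\<close> is finite, so exp (-(K n - m n)) splits into a positive constant and the
  exponential of a mixture. The exponents \<open>K n - m n\<close> converge by dominated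
  convergence.\<close>

lemma gauss_pd_exp_norm_powr:
  assumes s: "0 < s" "s < 1" and t: "0 \<le> t"
  shows "gauss_pd (\<lambda>\<xi>::'a::euclidean_space. exp (- t * norm \<xi> powr (2 * s)))"
proof -
  define c where "c = (LINT r|lborel. levy_integrand s 1 r)"
  have c: "0 < c" unfolding c_def by (rule levy_constant_pos[OF s])
  \<comment> \<open>The factor t / c normalises the limiting exponent to t |xi|^(2s); the cut at 1 /
    (n + 1) removes the non-integrable singularity of r^(-1-s).\<close>
  define k where "k = (\<lambda>n r::real. (t / c) * (indicator {1 / real (Suc n)..} r * r powr (- 1 - s)))"
  have ki: "integrable lborel (k n)" for n
  proof -
    have "(\<lambda>r::real. r powr (- 1 - s)) absolutely_integrable_on {1 / real (Suc n)..}"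
      using s has_integral_powr_to_inf[of "- 1 - s" "1 / real (Suc n)"]
      by (intro nonnegative_absolutely_integrable_1) (auto simp: integrable_on_def)
    then have "integrable lborel (\<lambda>r. indicator {1 / real (Suc n)..} r * r powr (- 1 - s))"
      unfolding set_integrable_def by (subst (asm) integrable_completion) auto
    then show ?thesis unfolding k_def by simp
  qed
  have k0: "0 \<le> k n r" for n r using t c by (simp add: k_def)
  have kneg: "k n r = 0" if "r < 0" for n r
    using that by (simp add: k_def indicator_def) (smt (verit) divide_pos_pos of_nat_0_less_iff zero_less_Suc of_nat_Suc)
  define m where "m = (\<lambda>n (\<xi>::'a). LINT r|lborel. k n r * exp (- r * (norm \<xi>)\<^sup>2))"
  define K where "K = (\<lambda>n. LINT r|lborel. k n r)"
  have kexp: "integrable lborel (\<lambda>r. k n r * exp (- r * (norm \<xi>)\<^sup>2))" for n and \<xi> :: 'a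
    by (intro gaussian_mixture_bounds ki k0 kneg)
  have diff: "K n - m n \<xi> = (LINT r|lborel. (t / c) * (indicator {1 / real (Suc n)..} r * levy_integrand s ((norm \<xi>)\<^sup>2) r))" for n \<xi>
  proof -
    have "K n - m n \<xi> = (LINT r|lborel. k n r - k n r * exp (- r * (norm \<xi>)\<^sup>2))"
      unfolding K_def m_def using ki kexp by simp
    also have "\<dots> = (LINT r|lborel. (t / c) * (indicator {1 / real (Suc n)..} r * levy_integrand s ((norm \<xi>)\<^sup>2) r))"
    proof (intro Bochner_Integration.integral_cong refl)
      fix r :: real
      have "r > 0" if "1 / real (Suc n) \<le> r"
        using that by (smt (verit) divide_pos_pos of_nat_0_less_iff zero_less_Suc)
      then show "k n r - k n r * exp (- r * (norm \<xi>)\<^sup>2)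
        = (t / c) * (indicator {1 / real (Suc n)..} r * levy_integrand s ((norm \<xi>)\<^sup>2) r)"
        by (auto simp: k_def levy_integrand_def indicator_def algebra_simps simp del: of_nat_Suc)
    qed
    finally show ?thesis .
  qed
  show ?thesis
  proof (rule gauss_pd_limit)
    fix n
    have "gauss_pd (\<lambda>\<xi>::'a. exp (- K n) * exp (m n \<xi>))"
      unfolding m_def by (intro gauss_pd_cmult gauss_pd_exp_mixture ki k0 kneg) auto
    then show "gauss_pd (\<lambda>\<xi>::'a. exp (- (K n - m n \<xi>)))"
      by (simp flip: exp_add)
    fix \<xi>
    have "0 \<le> K n - m n \<xi>"
      unfolding diff using t c by (intro integral_nonneg_AE AE_I2) (auto intro!: mult_nonneg_nonneg divide_nonneg_nonneg levy_integrand_nonneg)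
    then show "\<bar>exp (- (K n - m n \<xi>))\<bar> \<le> 1" by simp
  next
    fix \<xi> :: 'a
    have "(\<lambda>n. LINT r|lborel. (t / c) * (indicator {1 / real (Suc n)..} r * levy_integrand s ((norm \<xi>)\<^sup>2) r))
      \<longlonglongrightarrow> (LINT r|lborel. (t / c) * levy_integrand s ((norm \<xi>)\<^sup>2) r)"
    proof (rule integral_dominated_convergence)
      show "integrable lborel (\<lambda>r. (t / c) * levy_integrand s ((norm \<xi>)\<^sup>2) r)"
        using levy_integral(1)[OF s] by simp
      show "AE r in lborel. (\<lambda>n. (t / c) * (indicator {1 / real (Suc n)..} r * levy_integrand s ((norm \<xi>)\<^sup>2) r))
        \<longlonglongrightarrow> (t / c) * levy_integrand s ((norm \<xi>)\<^sup>2) r"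
      proof (intro AE_I2 tendsto_mult_left)
        fix r :: real
        show "(\<lambda>n. indicator {1 / real (Suc n)..} r * levy_integrand s ((norm \<xi>)\<^sup>2) r) \<longlonglongrightarrow> levy_integrand s ((norm \<xi>)\<^sup>2) r"
        proof (cases "0 < r")
          case True
          obtain n0 where n0: "1 / real (Suc n0) < r" using nat_approx_posE[OF True] by blast
          have "1 / real (Suc n) \<le> r" if "n0 \<le> n" for n
          proof -
            have "1 / real (Suc n) \<le> 1 / real (Suc n0)" using that by (intro divide_left_mono) auto
            then show ?thesis using n0 by linarith
          qed
          then have "eventually (\<lambda>n. levy_integrand s ((norm \<xi>)\<^sup>2) r = indicator {1 / real (Suc n)..} r * levy_integrand s ((norm \<xi>)\<^sup>2) r) sequentially"
            by (intro eventually_sequentiallyI[of n0]) auto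
          then show ?thesis by (rule Lim_transform_eventually[OF tendsto_const])
        qed (simp add: levy_integrand_def)
      qed
      show "AE r in lborel. norm ((t / c) * (indicator {1 / real (Suc n)..} r * levy_integrand s ((norm \<xi>)\<^sup>2) r))
        \<le> (t / c) * levy_integrand s ((norm \<xi>)\<^sup>2) r" for n
        using t c levy_integrand_nonneg[of "(norm \<xi>)\<^sup>2" s]
        by (intro AE_I2) (auto simp: abs_mult indicator_def intro!: mult_nonneg_nonneg divide_nonneg_nonneg)
    qed auto
    also have "(LINT r|lborel. (t / c) * levy_integrand s ((norm \<xi>)\<^sup>2) r) = t * norm \<xi> powr (2 * s)"
    proof -
      have "((norm \<xi>)\<^sup>2) powr s = norm \<xi> powr (2 * s)"
        by (cases "\<xi> = 0") (simp_all add: powr_powr flip: powr_numeral)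
      then show ?thesis
        using levy_integral(2)[OF s, of "(norm \<xi>)\<^sup>2"] c by (simp add: c_def[symmetric])
    qed
    finally have "(\<lambda>n. K n - m n \<xi>) \<longlonglongrightarrow> t * norm \<xi> powr (2 * s)"
      unfolding diff .
    then show "(\<lambda>n. exp (- (K n - m n \<xi>))) \<longlonglongrightarrow> exp (- t * norm \<xi> powr (2 * s))"
      by (auto intro!: tendsto_exp tendsto_minus simp del: minus_diff_eq)
  qed
qed

section \<open>The heat kernel: positivity, mass and convolution\<close>

lemma lborel_integral_affine:
  fixes g :: "'a::euclidean_space \<Rightarrow> real"
  assumes [measurable]: "g \<in> borel_measurable borel" and c: "c \<noteq> 0"
  shows "(LINT x|lborel. g x) = \<bar>c\<bar> ^ DIM('a) * (LINT x|lborel. g (w + c *\<^sub>R x))"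
  by (subst lborel_affine[OF c, of w]) (simp add: integral_density integral_distr)

definition heatL_symbol :: "real \<Rightarrow> real \<Rightarrow> 'a::euclidean_space \<Rightarrow> real" where
  "heatL_symbol s t \<xi> = exp (- t * ((norm \<xi>)\<^sup>2 + norm \<xi> powr (2 * s)))"

lemma heatL_symbol_measurable [measurable]: "heatL_symbol s t \<in> borel_measurable borel"
  unfolding heatL_symbol_def by measurable

lemma heatL_symbol_minus [simp]: "heatL_symbol s t (- \<xi>) = heatL_symbol s t \<xi>"
  by (simp add: heatL_symbol_def)

lemma heatL_symbol_zero [simp]: "heatL_symbol s t 0 = 1"
  by (simp add: heatL_symbol_def)

lemma heatL_symbol_nonneg [simp]: "0 \<le> heatL_symbol s t \<xi>"
  by (simp add: heatL_symbol_def)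

lemma heatL_symbol_le_1: "0 \<le> t \<Longrightarrow> heatL_symbol s t \<xi> \<le> 1"
  by (simp add: heatL_symbol_def)

lemma heatL_symbol_add: "heatL_symbol s (t + r) \<xi> = heatL_symbol s t \<xi> * heatL_symbol s r \<xi>"
  by (simp add: heatL_symbol_def algebra_simps flip: exp_add)

lemma heatL_symbol_split:
  "heatL_symbol s t \<xi> = exp (- t * (norm \<xi>)\<^sup>2) * exp (- t * norm \<xi> powr (2 * s))"
  by (simp add: heatL_symbol_def algebra_simps flip: exp_add)

lemma heatL_symbol_continuous: "0 < s \<Longrightarrow> isCont (heatL_symbol s t) \<xi>"
  unfolding heatL_symbol_def by (auto intro!: continuous_intros)

lemma heatL_symbol_integrable:
  assumes "0 < t"
  shows "integrable lborel (heatL_symbol s t :: 'a::euclidean_space \<Rightarrow> real)"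
proof (rule Bochner_Integration.integrable_bound[OF gaussian_integrable[OF assms]])
  show "AE \<xi>::'a in lborel. norm (heatL_symbol s t \<xi>) \<le> norm (exp (- t * (norm \<xi>)\<^sup>2))"
    using assms by (simp add: heatL_symbol_split mult_left_le)
qed simp

text \<open>The Gaussian in the convolution makes the double integral absolutely convergent without
  any knowledge of the size of the fractional kernel. Integrating it first multiplies the fractional
  symbol by exp (-t |xi|^2).\<close>

lemma heatL_kernel_fourier:
  fixes z :: "'a::euclidean_space"
  assumes t: "0 < t" and s: "0 < s"
  shows "heatL_kernel s t z = (2 * pi) powr (- real DIM('a)) * (LINT \<xi>|lborel. cos (z \<bullet> \<xi>) * heatL_symbol s t \<xi>)"
proof -
  \<comment> \<open>The width of the heat Gaussian; then 1 / (4 a) = t is the decay rate of its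
    transform.\<close>
  define a where "a = 1 / (4 * t)"
  have a: "0 < a" using t by (simp add: a_def)
  let ?F = "\<lambda>\<eta> \<xi>. exp (- a * (norm (z - \<eta>))\<^sup>2) * (cos (\<eta> \<bullet> \<xi>) * exp (- t * norm \<xi> powr (2 * s)))"
  have gi: "integrable lborel (\<lambda>\<eta>. exp (- a * (norm (z - \<eta>))\<^sup>2))"
    by (subst lborel_integrable_reflect[of "\<lambda>x. exp (- a * (norm x)\<^sup>2)" z]) (auto intro: gaussian_integrable[OF a, simplified])
  have "\<bar>?F \<eta> \<xi>\<bar> \<le> \<bar>exp (- a * (norm (z - \<eta>))\<^sup>2)\<bar> * \<bar>exp (- t * norm \<xi> powr (2 * s))\<bar>" for \<eta> \<xi>
    unfolding abs_mult by (intro mult_left_mono mult_left_le_one_le) auto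
  then have int: "integrable (lborel \<Otimes>\<^sub>M lborel) (\<lambda>(\<eta>, \<xi>). ?F \<eta> \<xi>)"
    by (intro integrable_lborel_tensor_bound[OF gi integrable_exp_norm_powr[OF t s, where 'a='a]]) auto
  have "heatL_kernel s t z = (4 * pi * t) powr (- real DIM('a) / 2) *
     (LINT \<eta>|lborel. (2 * pi) powr (- real DIM('a)) * (LINT \<xi>|lborel. ?F \<eta> \<xi>))"
  proof -
    have "exp (- (norm (z - \<eta>))\<^sup>2 / (4 * t)) * (c * (LINT \<xi>|lborel. cos (\<eta> \<bullet> \<xi>) * exp (- t * norm \<xi> powr (2 * s))))
      = c * (LINT \<xi>|lborel. ?F \<eta> \<xi>)" for \<eta> c
      by (subst integral_mult_right_zero) (simp add: a_def mult.left_commute)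
    then show ?thesis unfolding heatL_kernel_def frac_heat_kernel_def by (simp only:)
  qed
  also have "\<dots> = (4 * pi * t) powr (- real DIM('a) / 2) * (2 * pi) powr (- real DIM('a)) *
     (LINT \<eta>|lborel. (LINT \<xi>|lborel. ?F \<eta> \<xi>))" by simp
  also have "(LINT \<eta>|lborel. (LINT \<xi>|lborel. ?F \<eta> \<xi>)) = (LINT \<xi>|lborel. (LINT \<eta>|lborel. ?F \<eta> \<xi>))"
    by (rule lborel_pair.Fubini_integral[symmetric]) (fact int)
  also have "\<dots> = (LINT \<xi>|lborel. (4 * pi * t) powr (real DIM('a) / 2) * (cos (z \<bullet> \<xi>) * heatL_symbol s t \<xi>))"
  proof (intro Bochner_Integration.integral_cong refl)
    fix \<xi>
    have "(LINT \<eta>|lborel. ?F \<eta> \<xi>) = (LINT \<eta>|lborel. cos (\<eta> \<bullet> \<xi>) * exp (- a * (norm (z - \<eta>))\<^sup>2)) * exp (- t * norm \<xi> powr (2 * s))"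
      by (subst integral_mult_left_zero[symmetric]) (simp add: mult_ac)
    also have "\<dots> = (pi / a) powr (real DIM('a) / 2) * cos (z \<bullet> \<xi>) * exp (- (norm \<xi>)\<^sup>2 / (4 * a)) * exp (- t * norm \<xi> powr (2 * s))"
      by (simp only: gaussian_cos_shift[OF a])
    finally show "(LINT \<eta>|lborel. ?F \<eta> \<xi>) = (4 * pi * t) powr (real DIM('a) / 2) * (cos (z \<bullet> \<xi>) * heatL_symbol s t \<xi>)"
      using t by (simp add: a_def heatL_symbol_split mult_ac)
  qed
  also have "(4 * pi * t) powr (- real DIM('a) / 2) * (2 * pi) powr (- real DIM('a)) *
    (LINT \<xi>|lborel. (4 * pi * t) powr (real DIM('a) / 2) * (cos (z \<bullet> \<xi>) * heatL_symbol s t \<xi>))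
    = ((4 * pi * t) powr (- real DIM('a) / 2) * (4 * pi * t) powr (real DIM('a) / 2)) * ((2 * pi) powr (- real DIM('a)) *
      (LINT \<xi>|lborel. cos (z \<bullet> \<xi>) * heatL_symbol s t \<xi>))"
    by (subst integral_mult_right_zero) (simp only: mult_ac)
  also have "(4 * pi * t) powr (- real DIM('a) / 2) * (4 * pi * t) powr (real DIM('a) / 2) = 1"
    using t by (simp flip: powr_add)
  finally show ?thesis by simp
qed

text \<open>The Gaussian factor of the symbol is exactly the damping of \<open>gauss_pd\<close> with
  a = t, so no limit in the damping has to be taken.\<close>

lemma heatL_kernel_nonneg:
  assumes t: "0 < t" and s: "0 < s" "s < 1"
  shows "0 \<le> heatL_kernel s t (z::'a::euclidean_space)"
  using gauss_pd_exp_norm_powr[OF s, of t, where 'a='a] t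
  unfolding heatL_kernel_fourier[OF t s(1)] heatL_symbol_split gauss_pd_def
  by (intro mult_nonneg_nonneg) auto

lemma heatL_kernel_minus:
  assumes "0 < t" "0 < s"
  shows "heatL_kernel s t (- z) = heatL_kernel s t z"
  by (simp add: heatL_kernel_fourier[OF assms])

text \<open>Used in \<open>heatL_kernel_convolution\<close> to make the product of two kernels
  integrable.\<close>

lemma heatL_kernel_bound:
  fixes z :: "'a::euclidean_space"
  assumes t: "0 < t" and s: "0 < s"
  shows "\<bar>heatL_kernel s t z\<bar> \<le> (2 * pi) powr (- real DIM('a)) * (LINT \<xi>::'a|lborel. heatL_symbol s t \<xi>)"
proof -
  have "\<bar>cos (z \<bullet> \<xi>) * heatL_symbol s t \<xi>\<bar> \<le> heatL_symbol s t \<xi>" for \<xi>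
    by (simp add: abs_mult mult_left_le_one_le)
  then have "\<bar>LINT \<xi>|lborel. cos (z \<bullet> \<xi>) * heatL_symbol s t \<xi>\<bar> \<le> (LINT \<xi>::'a|lborel. heatL_symbol s t \<xi>)"
    by (intro order_trans[OF integral_abs_bound] integral_mono_AE' heatL_symbol_integrable t) auto
  then show ?thesis
    unfolding heatL_kernel_fourier[OF t s] abs_mult by (simp add: mult_left_mono)
qed

text \<open>Measurability is joint in time and space, as required for Tonelli in the Duhamel
  term.\<close>

lemma heatL_kernel_measurable [measurable]:
  "(\<lambda>x. heatL_kernel s (T x) (Z x :: 'a::euclidean_space)) \<in> borel_measurable M"
  if [measurable]: "T \<in> borel_measurable M" "Z \<in> borel_measurable M"
proof -
  have f: "(\<lambda>p :: real \<times> 'a. frac_heat_kernel s (fst p) (snd p)) \<in> borel_measurable (borel \<Otimes>\<^sub>M borel)"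
    unfolding frac_heat_kernel_def by measurable
  have [measurable]: "(\<lambda>x. frac_heat_kernel s (T' x) (Z' x :: 'a)) \<in> borel_measurable N"
    if "T' \<in> borel_measurable N" "Z' \<in> borel_measurable N" for T' Z' and N :: "'z measure"
    using measurable_compose[OF measurable_Pair[OF that] f] by simp
  show ?thesis unfolding heatL_kernel_def by measurable
qed

text \<open>At this stage the kernel is known to be bounded but not to be integrable, hence the
  damping. A product with a Gaussian becomes, on the Fourier side, an average of the symbol over a
  Gaussian of width of order sqrt a around \<open>\<eta>\<close>.\<close>

lemma heatL_kernel_gaussian_mean:
  fixes \<eta> :: "'a::euclidean_space"
  assumes t: "0 < t" and s: "0 < s" and a: "0 < a"
  shows "integrable lborel (\<lambda>z. heatL_kernel s t z * cos (z \<bullet> \<eta>) * exp (- a * (norm z)\<^sup>2))"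
    and "(LINT z|lborel. heatL_kernel s t z * cos (z \<bullet> \<eta>) * exp (- a * (norm z)\<^sup>2))
      = pi powr (- real DIM('a) / 2) * (LINT y|lborel. heatL_symbol s t (\<eta> + (2 * sqrt a) *\<^sub>R y) * exp (- (norm y)\<^sup>2))"
proof -
  let ?N = "real DIM('a)"
  let ?F = "\<lambda>z \<xi>. (cos (z \<bullet> \<xi>) * heatL_symbol s t \<xi>) * (cos (z \<bullet> \<eta>) * exp (- a * (norm z)\<^sup>2))"
  have "\<bar>?F z \<xi>\<bar> \<le> \<bar>exp (- a * (norm z)\<^sup>2)\<bar> * \<bar>heatL_symbol s t \<xi>\<bar>" for z \<xi>
  proof -
    have "\<bar>?F z \<xi>\<bar> \<le> (1 * \<bar>heatL_symbol s t \<xi>\<bar>) * (1 * \<bar>exp (- a * (norm z)\<^sup>2)\<bar>)"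
      unfolding abs_mult by (intro mult_mono) auto
    then show ?thesis by (simp add: mult.commute)
  qed
  then have int: "integrable (lborel \<Otimes>\<^sub>M lborel) (\<lambda>(z, \<xi>). ?F z \<xi>)"
    by (intro integrable_lborel_tensor_bound[OF gaussian_integrable[OF a] heatL_symbol_integrable[OF t]]) auto
  have eq: "heatL_kernel s t z * cos (z \<bullet> \<eta>) * exp (- a * (norm z)\<^sup>2)
    = (2 * pi) powr (- ?N) * (LINT \<xi>|lborel. ?F z \<xi>)" for z
    unfolding heatL_kernel_fourier[OF t s] by simp
  show "integrable lborel (\<lambda>z. heatL_kernel s t z * cos (z \<bullet> \<eta>) * exp (- a * (norm z)\<^sup>2))"
    unfolding eq using lborel_pair.integrable_fst[OF int] by simp
  \<comment> \<open>The unnormalised average around \<open>w\<close>. The two cosines produce the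
    averages around \<open>\<eta>\<close> and \<open>- \<eta>\<close>, which agree since the symbol
    is even.\<close>
  define G where "G = (\<lambda>w::'a. LINT \<xi>|lborel. heatL_symbol s t \<xi> * exp (- (norm (\<xi> - w))\<^sup>2 / (4 * a)))"
  have Gi: "integrable lborel (\<lambda>\<xi>::'a. heatL_symbol s t \<xi> * exp (- (norm (\<xi> - w))\<^sup>2 / (4 * a)))" for w
    using a by (intro Bochner_Integration.integrable_bound[OF heatL_symbol_integrable[OF t, of s]]) (auto simp: mult_left_le)
  have "G (- \<eta>) = (LINT \<xi>|lborel. heatL_symbol s t (0 - \<xi>) * exp (- (norm ((0 - \<xi>) - (- \<eta>)))\<^sup>2 / (4 * a)))"
    unfolding G_def by (rule lborel_integral_reflect[symmetric]) simp
  also have "\<dots> = G \<eta>" unfolding G_def by (simp add: norm_minus_commute)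
  finally have sym: "G (- \<eta>) = G \<eta>" .
  have "(LINT z|lborel. heatL_kernel s t z * cos (z \<bullet> \<eta>) * exp (- a * (norm z)\<^sup>2))
    = (2 * pi) powr (- ?N) * (LINT z|lborel. LINT \<xi>|lborel. ?F z \<xi>)"
    unfolding eq by simp
  also have "(LINT z|lborel. LINT \<xi>|lborel. ?F z \<xi>) = (LINT \<xi>|lborel. LINT z|lborel. ?F z \<xi>)"
    by (rule lborel_pair.Fubini_integral[symmetric]) (fact int)
  also have "\<dots> = (LINT \<xi>|lborel. (pi / a) powr (?N / 2) * (heatL_symbol s t \<xi> * exp (- (norm (\<xi> - \<eta>))\<^sup>2 / (4 * a))
      + heatL_symbol s t \<xi> * exp (- (norm (\<xi> - (- \<eta>)))\<^sup>2 / (4 * a))) / 2)"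
  proof (intro Bochner_Integration.integral_cong refl)
    fix \<xi>
    have "(LINT z|lborel. ?F z \<xi>) = heatL_symbol s t \<xi> * (LINT z|lborel. cos (\<xi> \<bullet> z) * cos (\<eta> \<bullet> z) * exp (- a * (norm z)\<^sup>2))"
      by (subst integral_mult_right_zero[symmetric]) (simp add: mult_ac inner_commute)
    then show "(LINT z|lborel. ?F z \<xi>) = (pi / a) powr (?N / 2) * (heatL_symbol s t \<xi> * exp (- (norm (\<xi> - \<eta>))\<^sup>2 / (4 * a))
      + heatL_symbol s t \<xi> * exp (- (norm (\<xi> - (- \<eta>)))\<^sup>2 / (4 * a))) / 2"
      unfolding gaussian_cos_cos[OF a] by (simp add: algebra_simps add_divide_distrib)
  qed
  also have "\<dots> = (pi / a) powr (?N / 2) * (G \<eta> + G (- \<eta>)) / 2"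
    unfolding G_def using Gi[of \<eta>] Gi[of "- \<eta>"] by simp
  also have "\<dots> = (pi / a) powr (?N / 2) * G \<eta>" using sym by simp
  \<comment> \<open>Rescaling by 2 sqrt a makes the Gaussian independent of a; all powers of a then
    cancel and a = 1 / (n + 1) may tend to 0.\<close>
  also have "G \<eta> = (2 * sqrt a) ^ DIM('a) * (LINT y|lborel. heatL_symbol s t (\<eta> + (2 * sqrt a) *\<^sub>R y) * exp (- (norm y)\<^sup>2))"
  proof -
    have "G \<eta> = \<bar>2 * sqrt a\<bar> ^ DIM('a) * (LINT y|lborel. heatL_symbol s t (\<eta> + (2 * sqrt a) *\<^sub>R y)
        * exp (- (norm ((\<eta> + (2 * sqrt a) *\<^sub>R y) - \<eta>))\<^sup>2 / (4 * a)))"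
      unfolding G_def using a by (intro lborel_integral_affine) auto
    moreover have "(norm ((\<eta> + (2 * sqrt a) *\<^sub>R y) - \<eta>))\<^sup>2 / (4 * a) = (norm y)\<^sup>2" for y :: 'a
      using a by (simp add: power_mult_distrib)
    ultimately show ?thesis using a by simp
  qed
  also have "(2 * pi) powr (- ?N) * ((pi / a) powr (?N / 2) * ((2 * sqrt a) ^ DIM('a) * I)) = pi powr (- ?N / 2) * I" for I
  proof -
    have "(2 * sqrt a) ^ DIM('a) = (2 * sqrt a) powr ?N" using a by (simp add: powr_realpow)
    also have "\<dots> = 2 powr ?N * a powr (?N / 2)"
      using a by (simp add: powr_mult powr_half_sqrt[symmetric] powr_powr)
    finally have 1: "(2 * sqrt a) ^ DIM('a) = 2 powr ?N * a powr (?N / 2)" .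
    have 2: "(pi / a) powr (?N / 2) * a powr (?N / 2) = pi powr (?N / 2)"
      using a by (simp add: powr_divide)
    have 3: "(2 * pi) powr (- ?N) * 2 powr ?N * pi powr (?N / 2) = pi powr (- ?N / 2)"
    proof -
      have "(2 * pi) powr (- ?N) * 2 powr ?N * pi powr (?N / 2)
        = (2 powr (- ?N) * 2 powr ?N) * (pi powr (- ?N) * pi powr (?N / 2))" by (simp add: powr_mult)
      also have "\<dots> = pi powr (- ?N + ?N / 2)" by (simp only: powr_add[symmetric]) simp
      finally show ?thesis by simp
    qed
    show ?thesis unfolding 1 by (simp only: mult_ac 2[symmetric] 3[symmetric])
  qed
  finally show "(LINT z|lborel. heatL_kernel s t z * cos (z \<bullet> \<eta>) * exp (- a * (norm z)\<^sup>2))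
      = pi powr (- real DIM('a) / 2) * (LINT y|lborel. heatL_symbol s t (\<eta> + (2 * sqrt a) *\<^sub>R y) * exp (- (norm y)\<^sup>2))" .
qed

text \<open>The averages concentrate at \<open>\<eta>\<close>, where the symbol is continuous; its
  bound 1 gives the majorant.\<close>

lemma heatL_kernel_gaussian_mean_tendsto:
  fixes \<eta> :: "'a::euclidean_space"
  assumes t: "0 < t" and s: "0 < s"
  shows "(\<lambda>n. LINT z|lborel. heatL_kernel s t z * cos (z \<bullet> \<eta>) * exp (- (1 / real (Suc n)) * (norm z)\<^sup>2))
    \<longlonglongrightarrow> heatL_symbol s t \<eta>"
proof -
  have "(\<lambda>n. LINT y|lborel. heatL_symbol s t (\<eta> + (2 * sqrt (1 / real (Suc n))) *\<^sub>R y) * exp (- (norm y)\<^sup>2))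
    \<longlonglongrightarrow> (LINT y|lborel. heatL_symbol s t \<eta> * exp (- (norm (y::'a))\<^sup>2))"
  proof (rule integral_dominated_convergence)
    show "integrable lborel (\<lambda>y::'a. exp (- (norm y)\<^sup>2))"
      using gaussian_integrable[of 1, where 'a='a] by simp
    have "(\<lambda>n. 2 * sqrt (1 / real (Suc n))) \<longlonglongrightarrow> 2 * sqrt 0"
      by (intro tendsto_intros LIMSEQ_Suc lim_1_over_n)
    then have "(\<lambda>n. \<eta> + (2 * sqrt (1 / real (Suc n))) *\<^sub>R y) \<longlonglongrightarrow> \<eta>" for y
      using tendsto_add[OF tendsto_const[of \<eta>] tendsto_scaleR[OF _ tendsto_const[of y]]] by fastforce
    then show "AE y in lborel. (\<lambda>n. heatL_symbol s t (\<eta> + (2 * sqrt (1 / real (Suc n))) *\<^sub>R y) * exp (- (norm y)\<^sup>2))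
      \<longlonglongrightarrow> heatL_symbol s t \<eta> * exp (- (norm y)\<^sup>2)"
      by (intro AE_I2 tendsto_mult_right isCont_tendsto_compose[OF heatL_symbol_continuous[OF s]])
    show "AE y in lborel. norm (heatL_symbol s t (\<eta> + (2 * sqrt (1 / real (Suc n))) *\<^sub>R y) * exp (- (norm y)\<^sup>2))
      \<le> exp (- (norm y)\<^sup>2)" for n
      using t by (auto simp: abs_mult heatL_symbol_le_1 mult_left_le_one_le)
  qed auto
  also have "(LINT y|lborel. heatL_symbol s t \<eta> * exp (- (norm (y::'a))\<^sup>2)) = heatL_symbol s t \<eta> * pi powr (real DIM('a) / 2)"
    using gaussian_cos[of 1 "0::'a"] by simp
  finally have "(\<lambda>n. pi powr (- real DIM('a) / 2) * (LINT y|lborel. heatL_symbol s t (\<eta> + (2 * sqrt (1 / real (Suc n))) *\<^sub>R y) * exp (- (norm y)\<^sup>2)))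
    \<longlonglongrightarrow> pi powr (- real DIM('a) / 2) * (heatL_symbol s t \<eta> * pi powr (real DIM('a) / 2))"
    by (rule tendsto_mult_left)
  also have "pi powr (- real DIM('a) / 2) * (heatL_symbol s t \<eta> * pi powr (real DIM('a) / 2)) = heatL_symbol s t \<eta>"
    by (simp add: powr_minus field_simps)
  finally show ?thesis
    by (subst heatL_kernel_gaussian_mean(2)[OF t s]) auto
qed

text \<open>At frequency 0 the damped integrals tend to the value 1 of the symbol. As the kernel is
  nonnegative, the damped kernels increase to it, and monotone convergence gives the mass without
  presupposing integrability.\<close>

lemma heatL_kernel_mass:
  assumes t: "0 < t" and s: "0 < s" "s < 1"
  shows "(\<integral>\<^sup>+z. ennreal (heatL_kernel s t (z::'a::euclidean_space)) \<partial>lborel) = 1"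
proof -
  let ?f = "\<lambda>n (z::'a). ennreal (heatL_kernel s t z * exp (- (1 / real (Suc n)) * (norm z)\<^sup>2))"
  have pos: "0 \<le> heatL_kernel s t (z::'a)" for z by (rule heatL_kernel_nonneg[OF t s])
  have eq: "(\<integral>\<^sup>+z. ?f n z \<partial>lborel)
    = ennreal (LINT z|lborel. heatL_kernel s t (z::'a) * cos (z \<bullet> 0) * exp (- (1 / real (Suc n)) * (norm z)\<^sup>2))" for n
    using heatL_kernel_gaussian_mean(1)[OF t s(1), of "1 / real (Suc n)" "0::'a"] pos
    by (subst nn_integral_eq_integral) auto
  have "(\<lambda>n. \<integral>\<^sup>+z. ?f n z \<partial>lborel) \<longlonglongrightarrow> ennreal 1"
    unfolding eq using heatL_kernel_gaussian_mean_tendsto[OF t s(1), of "0::'a"]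
    by (intro tendsto_ennrealI) simp
  moreover have "(\<lambda>n. \<integral>\<^sup>+z. ?f n z \<partial>lborel) \<longlonglongrightarrow> (\<integral>\<^sup>+z. ennreal (heatL_kernel s t (z::'a)) \<partial>lborel)"
  proof (rule nn_integral_LIMSEQ)
    show "incseq ?f"
    proof (intro incseq_SucI le_funI ennreal_leI mult_left_mono pos)
      fix n and z :: 'a
      have "(norm z)\<^sup>2 / real (Suc (Suc n)) \<le> (norm z)\<^sup>2 / real (Suc n)"
        by (intro divide_left_mono) auto
      then show "exp (- (1 / real (Suc n)) * (norm z)\<^sup>2) \<le> exp (- (1 / real (Suc (Suc n))) * (norm z)\<^sup>2)" by simp
    qed
    fix z :: 'a
    have "(\<lambda>n. heatL_kernel s t z * exp (- (1 / real (Suc n)) * (norm z)\<^sup>2)) \<longlonglongrightarrow> heatL_kernel s t z * exp (- 0 * (norm z)\<^sup>2)"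
      by (intro tendsto_intros LIMSEQ_Suc lim_1_over_n)
    then show "(\<lambda>n. ?f n z) \<longlonglongrightarrow> ennreal (heatL_kernel s t z)" by (intro tendsto_ennrealI) simp
  qed simp
  ultimately show ?thesis using LIMSEQ_unique by fastforce
qed

lemma heatL_kernel_integrable:
  assumes t: "0 < t" and s: "0 < s" "s < 1"
  shows "integrable lborel (heatL_kernel s t :: 'a::euclidean_space \<Rightarrow> real)"
  by (rule integrableI_nonneg) (auto simp: heatL_kernel_mass[OF assms] heatL_kernel_nonneg[OF assms])

text \<open>With the kernel itself as integrable majorant, the damping can now be removed at every
  frequency.\<close>

lemma heatL_kernel_fourier_cos:
  fixes \<eta> :: "'a::euclidean_space"
  assumes t: "0 < t" and s: "0 < s" "s < 1"
  shows "(LINT z|lborel. heatL_kernel s t z * cos (z \<bullet> \<eta>)) = heatL_symbol s t \<eta>"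
proof (rule LIMSEQ_unique[OF _ heatL_kernel_gaussian_mean_tendsto[OF t s(1)]])
  show "(\<lambda>n. LINT z|lborel. heatL_kernel s t z * cos (z \<bullet> \<eta>) * exp (- (1 / real (Suc n)) * (norm z)\<^sup>2))
    \<longlonglongrightarrow> (LINT z|lborel. heatL_kernel s t z * cos (z \<bullet> \<eta>))"
  proof (rule integral_dominated_convergence)
    show "integrable lborel (heatL_kernel s t :: 'a \<Rightarrow> real)" by (rule heatL_kernel_integrable[OF assms])
    have "(\<lambda>n. heatL_kernel s t z * cos (z \<bullet> \<eta>) * exp (- (1 / real (Suc n)) * (norm z)\<^sup>2))
      \<longlonglongrightarrow> heatL_kernel s t z * cos (z \<bullet> \<eta>) * exp (- 0 * (norm z)\<^sup>2)" for z
      by (intro tendsto_intros LIMSEQ_Suc lim_1_over_n)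
    then show "AE z in lborel. (\<lambda>n. heatL_kernel s t z * cos (z \<bullet> \<eta>) * exp (- (1 / real (Suc n)) * (norm z)\<^sup>2))
      \<longlonglongrightarrow> heatL_kernel s t z * cos (z \<bullet> \<eta>)" by simp
    show "AE z in lborel. norm (heatL_kernel s t z * cos (z \<bullet> \<eta>) * exp (- (1 / real (Suc n)) * (norm z)\<^sup>2)) \<le> heatL_kernel s t z" for n
    proof (rule AE_I2)
      fix z
      have "\<bar>heatL_kernel s t z\<bar> * \<bar>cos (z \<bullet> \<eta>)\<bar> * \<bar>exp (- (1 / real (Suc n)) * (norm z)\<^sup>2)\<bar> \<le> heatL_kernel s t z * 1 * 1"
        using heatL_kernel_nonneg[OF assms, of z] by (intro mult_mono) auto
      then show "norm (heatL_kernel s t z * cos (z \<bullet> \<eta>) * exp (- (1 / real (Suc n)) * (norm z)\<^sup>2)) \<le> heatL_kernel s t z"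
        by (simp only: abs_mult real_norm_def mult_1_right)
    qed
  qed auto
qed

lemma heatL_kernel_fourier_sin:
  fixes \<eta> :: "'a::euclidean_space"
  assumes t: "0 < t" and s: "0 < s"
  shows "(LINT z|lborel. heatL_kernel s t z * sin (z \<bullet> \<eta>)) = 0"
proof -
  have "(LINT z|lborel. heatL_kernel s t z * sin (z \<bullet> \<eta>)) = (LINT z|lborel. heatL_kernel s t (0 - z) * sin ((0 - z) \<bullet> \<eta>))"
    by (rule lborel_integral_reflect[symmetric]) simp
  also have "\<dots> = - (LINT z|lborel. heatL_kernel s t z * sin (z \<bullet> \<eta>))"
    by (simp add: heatL_kernel_minus[OF assms])
  finally show ?thesis by simp
qed

text \<open>Only the second kernel is replaced by its Fourier integral. Integrating over
  \<open>y\<close> first yields the transform of the shifted first kernel, and the product of the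
  two symbols is the symbol at time t + r.\<close>

lemma heatL_kernel_convolution:
  fixes x :: "'a::euclidean_space"
  assumes t: "0 < t" and r: "0 < r" and s: "0 < s" "s < 1"
  shows "(\<integral>\<^sup>+y. ennreal (heatL_kernel s t (x - y)) * ennreal (heatL_kernel s r y) \<partial>lborel) = ennreal (heatL_kernel s (t + r) x)"
proof -
  let ?c = "(2 * pi) powr (- real DIM('a))"
  note ti = heatL_kernel_integrable[OF t s, where 'a='a] and ri = heatL_kernel_integrable[OF r s, where 'a='a]
  have tix: "integrable lborel (\<lambda>y. heatL_kernel s t (x - y))"
    using ti by (subst lborel_integrable_reflect) auto
  have shift: "(LINT y|lborel. heatL_kernel s t (x - y) * cos (y \<bullet> \<xi>)) = cos (x \<bullet> \<xi>) * heatL_symbol s t \<xi>" for \<xi>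
  proof -
    have ci: "integrable lborel (\<lambda>y. heatL_kernel s t y * cos (y \<bullet> \<xi>))"
      by (rule Bochner_Integration.integrable_bound[OF ti]) (auto simp: abs_mult mult_left_le)
    have si: "integrable lborel (\<lambda>y. heatL_kernel s t y * sin (y \<bullet> \<xi>))"
      by (rule Bochner_Integration.integrable_bound[OF ti]) (auto simp: abs_mult mult_left_le)
    have "(LINT y|lborel. heatL_kernel s t (x - y) * cos (y \<bullet> \<xi>))
      = (LINT y|lborel. heatL_kernel s t (x - (x - y)) * cos ((x - y) \<bullet> \<xi>))"
      by (rule lborel_integral_reflect[symmetric]) simp
    also have "\<dots> = (LINT y|lborel. cos (x \<bullet> \<xi>) * (heatL_kernel s t y * cos (y \<bullet> \<xi>)) + sin (x \<bullet> \<xi>) * (heatL_kernel s t y * sin (y \<bullet> \<xi>)))"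
      by (simp add: inner_diff_left cos_diff algebra_simps)
    also have "\<dots> = cos (x \<bullet> \<xi>) * heatL_symbol s t \<xi>"
      using ci si by (simp add: heatL_kernel_fourier_cos[OF t s] heatL_kernel_fourier_sin[OF t s(1)])
    finally show ?thesis .
  qed
  let ?F = "\<lambda>y \<xi>. heatL_kernel s t (x - y) * (cos (y \<bullet> \<xi>) * heatL_symbol s r \<xi>)"
  have "\<bar>?F y \<xi>\<bar> \<le> \<bar>heatL_kernel s t (x - y)\<bar> * \<bar>heatL_symbol s r \<xi>\<bar>" for y \<xi>
    unfolding abs_mult by (intro mult_left_mono mult_left_le_one_le) auto
  then have int: "integrable (lborel \<Otimes>\<^sub>M lborel) (\<lambda>(y, \<xi>). ?F y \<xi>)"
    by (intro integrable_lborel_tensor_bound[OF tix heatL_symbol_integrable[OF r]]) auto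
  have conv: "integrable lborel (\<lambda>y. heatL_kernel s t (x - y) * heatL_kernel s r y)"
  proof (rule Bochner_Integration.integrable_bound)
    show "integrable lborel (\<lambda>y. heatL_kernel s t (x - y) * (?c * (LINT \<xi>::'a|lborel. heatL_symbol s r \<xi>)))"
      using tix by simp
    show "AE y in lborel. norm (heatL_kernel s t (x - y) * heatL_kernel s r y)
      \<le> norm (heatL_kernel s t (x - y) * (?c * (LINT \<xi>::'a|lborel. heatL_symbol s r \<xi>)))"
    proof (rule AE_I2)
      fix y
      show "norm (heatL_kernel s t (x - y) * heatL_kernel s r y)
        \<le> norm (heatL_kernel s t (x - y) * (?c * (LINT \<xi>::'a|lborel. heatL_symbol s r \<xi>)))"
        unfolding real_norm_def abs_mult[of "heatL_kernel s t (x - y)"]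
        by (intro mult_left_mono order_trans[OF heatL_kernel_bound[OF r s(1)] abs_ge_self]) simp
    qed
  qed simp
  have "(\<integral>\<^sup>+y. ennreal (heatL_kernel s t (x - y)) * ennreal (heatL_kernel s r y) \<partial>lborel)
    = ennreal (LINT y|lborel. heatL_kernel s t (x - y) * heatL_kernel s r y)"
    using heatL_kernel_nonneg[OF t s, where 'a='a] heatL_kernel_nonneg[OF r s, where 'a='a]
    by (subst nn_integral_eq_integral[OF conv, symmetric]) (auto simp: ennreal_mult)
  also have "(LINT y|lborel. heatL_kernel s t (x - y) * heatL_kernel s r y) = ?c * (LINT y|lborel. LINT \<xi>|lborel. ?F y \<xi>)"
  proof -
    have "heatL_kernel s t (x - y) * heatL_kernel s r y = ?c * (LINT \<xi>|lborel. ?F y \<xi>)" for y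
      by (simp add: heatL_kernel_fourier[OF r s(1)])
    then show ?thesis by (simp only: integral_mult_right_zero)
  qed
  also have "(LINT y|lborel. LINT \<xi>|lborel. ?F y \<xi>) = (LINT \<xi>|lborel. LINT y|lborel. ?F y \<xi>)"
    by (rule lborel_pair.Fubini_integral[symmetric]) (fact int)
  also have "\<dots> = (LINT \<xi>|lborel. (LINT y|lborel. heatL_kernel s t (x - y) * cos (y \<bullet> \<xi>)) * heatL_symbol s r \<xi>)"
    by (simp flip: mult.assoc)
  also have "\<dots> = (LINT \<xi>|lborel. cos (x \<bullet> \<xi>) * heatL_symbol s (t + r) \<xi>)"
    by (simp add: shift heatL_symbol_add mult.assoc)
  also have "?c * \<dots> = heatL_kernel s (t + r) x"
    using t r s by (subst heatL_kernel_fourier) auto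
  finally show ?thesis .
qed

section \<open>The heat semigroup on nonnegative functions\<close>

text \<open>Values in \<open>ennreal\<close> let Tonelli and monotone convergence apply
  unconditionally. The coercion of the kernel cuts nothing off for t > 0, where the kernel is
  nonnegative.\<close>

definition heatL_nn :: "real \<Rightarrow> real \<Rightarrow> ('a::euclidean_space \<Rightarrow> ennreal) \<Rightarrow> 'a \<Rightarrow> ennreal" where
  "heatL_nn s t g x = (\<integral>\<^sup>+y. ennreal (heatL_kernel s t (x - y)) * g y \<partial>lborel)"

lemma heatL_nn_measurable:
  fixes X :: "'b \<Rightarrow> 'a::euclidean_space"
  assumes [measurable]: "T \<in> borel_measurable M" "X \<in> borel_measurable M"
    "(\<lambda>(p, y). G p y) \<in> borel_measurable (M \<Otimes>\<^sub>M lborel)"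
  shows "(\<lambda>p. heatL_nn s (T p) (G p) (X p)) \<in> borel_measurable M"
  unfolding heatL_nn_def by measurable

lemma heatL_nn_mono_AE: "AE y in lborel. g y \<le> k y \<Longrightarrow> heatL_nn s t g x \<le> heatL_nn s t k x"
  unfolding heatL_nn_def by (intro nn_integral_mono_AE) (auto elim!: eventually_mono intro: mult_left_mono)

lemma heatL_nn_cong_AE: "AE y in lborel. g y = k y \<Longrightarrow> heatL_nn s t g x = heatL_nn s t k x"
  unfolding heatL_nn_def by (intro nn_integral_cong_AE) auto

lemma heatL_nn_cmult:
  assumes [measurable]: "g \<in> borel_measurable borel"
  shows "heatL_nn s t (\<lambda>y. c * g y) x = c * heatL_nn s t g x"
  unfolding heatL_nn_def by (subst nn_integral_cmult[symmetric]) (auto simp: mult.left_commute)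

lemma heatL_nn_add:
  assumes [measurable]: "g \<in> borel_measurable borel" "k \<in> borel_measurable borel"
  shows "heatL_nn s t (\<lambda>y. g y + k y) x = heatL_nn s t g x + heatL_nn s t k x"
  unfolding heatL_nn_def by (subst nn_integral_add[symmetric]) (auto simp: distrib_left)

lemma heatL_nn_const:
  assumes "0 < t" "0 < s" "s < 1"
  shows "heatL_nn s t (\<lambda>_::'a::euclidean_space. c) x = c"
proof -
  have "heatL_nn s t (\<lambda>_. c) x = (\<integral>\<^sup>+y. ennreal (heatL_kernel s t (x - y)) \<partial>lborel) * c"
    unfolding heatL_nn_def by (rule nn_integral_multc) simp
  also have "(\<integral>\<^sup>+y. ennreal (heatL_kernel s t (x - y)) \<partial>lborel) = 1"
    by (subst lborel_nn_integral_reflect[of "\<lambda>z. ennreal (heatL_kernel s t z)"]) (simp_all add: heatL_kernel_mass[OF assms])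
  finally show ?thesis by simp
qed

lemma heatL_nn_le_const:
  assumes "0 < t" "0 < s" "s < 1" and "AE y in lborel. g y \<le> c"
  shows "heatL_nn s t g (x::'a::euclidean_space) \<le> c"
  using heatL_nn_mono_AE[OF assms(4), of s t x] by (simp add: heatL_nn_const[OF assms(1-3)])

lemma heatL_nn_semigroup:
  fixes x :: "'a::euclidean_space"
  assumes t: "0 < t" and r: "0 < r" and s: "0 < s" "s < 1" and [measurable]: "g \<in> borel_measurable borel"
  shows "heatL_nn s t (heatL_nn s r g) x = heatL_nn s (t + r) g x"
proof -
  let ?p = "\<lambda>t z. ennreal (heatL_kernel s t (z::'a))"
  have "heatL_nn s t (heatL_nn s r g) x = (\<integral>\<^sup>+y. \<integral>\<^sup>+z. ?p t (x - y) * (?p r (y - z) * g z) \<partial>lborel \<partial>lborel)"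
    unfolding heatL_nn_def by (intro nn_integral_cong nn_integral_cmult[symmetric]) measurable
  also have "\<dots> = (\<integral>\<^sup>+z. \<integral>\<^sup>+y. ?p t (x - y) * (?p r (y - z) * g z) \<partial>lborel \<partial>lborel)"
    by (rule lborel_pair.Fubini'[symmetric]) measurable
  also have "\<dots> = (\<integral>\<^sup>+z. ?p (t + r) (x - z) * g z \<partial>lborel)"
  proof (intro nn_integral_cong)
    fix z
    have "(\<integral>\<^sup>+y. ?p t (x - y) * (?p r (y - z) * g z) \<partial>lborel) = (\<integral>\<^sup>+y. ?p t (x - y) * ?p r (y - z) \<partial>lborel) * g z"
      by (subst nn_integral_multc[symmetric]) (auto simp: mult.assoc)
    \<comment> \<open>Reflecting at x brings the product to the shape of
      \<open>heatL_kernel_convolution\<close> at the point x - z, with the two times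
      interchanged.\<close>
    also have "(\<integral>\<^sup>+y. ?p t (x - y) * ?p r (y - z) \<partial>lborel)
      = (\<integral>\<^sup>+y. ?p t (x - (x - y)) * ?p r ((x - y) - z) \<partial>lborel)"
      by (rule lborel_nn_integral_reflect[symmetric]) measurable
    also have "\<dots> = (\<integral>\<^sup>+y. ?p r ((x - z) - y) * ?p t y \<partial>lborel)"
      by (simp add: algebra_simps)
    also have "\<dots> = ?p (t + r) (x - z)"
      by (subst heatL_kernel_convolution[OF r t s]) (simp add: add.commute)
    finally show "(\<integral>\<^sup>+y. ?p t (x - y) * (?p r (y - z) * g z) \<partial>lborel) = ?p (t + r) (x - z) * g z" .
  qed
  finally show ?thesis unfolding heatL_nn_def .
qed

text \<open>By evenness of the kernel, integrating out the target variable is again the action of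
  the semigroup, on a constant.\<close>

lemma heatL_nn_mass:
  fixes g :: "'a::euclidean_space \<Rightarrow> ennreal"
  assumes t: "0 < t" and s: "0 < s" "s < 1" and [measurable]: "g \<in> borel_measurable borel"
  shows "(\<integral>\<^sup>+x. heatL_nn s t g x \<partial>lborel) = (\<integral>\<^sup>+x. g x \<partial>lborel)"
proof -
  have "(\<integral>\<^sup>+x. heatL_nn s t g x \<partial>lborel) = (\<integral>\<^sup>+y. \<integral>\<^sup>+x. ennreal (heatL_kernel s t (x - y)) * g y \<partial>lborel \<partial>lborel)"
    unfolding heatL_nn_def by (rule lborel_pair.Fubini') measurable
  also have "\<dots> = (\<integral>\<^sup>+y. heatL_nn s t (\<lambda>_. g y) y \<partial>lborel)"
    unfolding heatL_nn_def
  proof (intro nn_integral_cong)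
    fix x y :: 'a
    show "ennreal (heatL_kernel s t (y - x)) * g x = ennreal (heatL_kernel s t (x - y)) * g x"
      using heatL_kernel_minus[OF t s(1), of "y - x"] by simp
  qed
  also have "\<dots> = (\<integral>\<^sup>+y. g y \<partial>lborel)" by (simp add: heatL_nn_const[OF t s])
  finally show ?thesis .
qed

text \<open>No finiteness is assumed: if the integral diverges, both sides take the default value
  0.\<close>

lemma heatL_sg_eq_heatL_nn:
  fixes w :: "'a::euclidean_space \<Rightarrow> real"
  assumes t: "0 < t" and s: "0 < s" "s < 1" and [measurable]: "w \<in> borel_measurable borel" and w: "\<And>y. 0 \<le> w y"
  shows "heatL_sg s t w x = enn2real (heatL_nn s t (\<lambda>y. ennreal (w y)) x)"
  unfolding heatL_sg_def heatL_nn_def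
  using heatL_kernel_nonneg[OF t s, where 'a='a] w
  by (subst integral_eq_nn_integral) (auto simp: ennreal_mult)

text \<open>By Tonelli the integrability clause of \<open>mild_sol\<close> says exactly that the
  nonnegative Duhamel term \<open>N\<close> is finite, and in that case the iterated Bochner
  integral computes it.\<close>

lemma heatL_duhamel:
  fixes G :: "real \<Rightarrow> 'a::euclidean_space \<Rightarrow> real" and x :: 'a
  assumes t: "0 < t" and s: "0 < s" "s < 1"
    and [measurable]: "(\<lambda>(\<sigma>, y). G \<sigma> y) \<in> borel_measurable (borel \<Otimes>\<^sub>M borel)" and G: "\<And>\<sigma> y. 0 \<le> G \<sigma> y"
  defines "K \<equiv> (\<lambda>(\<sigma>, y). indicator {0<..<t} \<sigma> * (heatL_kernel s (t - \<sigma>) (x - y) * G \<sigma> y))"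
    and "N \<equiv> (\<integral>\<^sup>+\<sigma>. indicator {0<..<t} \<sigma> * heatL_nn s (t - \<sigma>) (\<lambda>y. ennreal (G \<sigma> y)) x \<partial>lborel)"
  shows "integrable lborel K \<longleftrightarrow> N < \<infinity>"
    and "N < \<infinity> \<Longrightarrow> (LINT \<sigma>:{0<..<t}|lborel. heatL_sg s (t - \<sigma>) (G \<sigma>) x) = enn2real N"
proof -
  have K_meas: "K \<in> borel_measurable (lborel \<Otimes>\<^sub>M lborel)"
    unfolding K_def by measurable
  have K0: "0 \<le> K p" for p
    using G heatL_kernel_nonneg[OF _ s, where 'a='a] by (auto simp: K_def split_beta indicator_def)
  have "(\<integral>\<^sup>+p. ennreal (K p) \<partial>(lborel \<Otimes>\<^sub>M lborel)) = (\<integral>\<^sup>+\<sigma>. \<integral>\<^sup>+y. ennreal (K (\<sigma>, y)) \<partial>lborel \<partial>lborel)"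
    using K_meas by (subst lborel.nn_integral_fst[symmetric]) auto
  also have "\<dots> = N"
    unfolding N_def
  proof (intro nn_integral_cong)
    fix \<sigma> :: real
    show "(\<integral>\<^sup>+y. ennreal (K (\<sigma>, y)) \<partial>lborel) = indicator {0<..<t} \<sigma> * heatL_nn s (t - \<sigma>) (\<lambda>y. ennreal (G \<sigma> y)) x"
      using heatL_kernel_nonneg[OF _ s, of "t - \<sigma>", where 'a='a] G
      by (auto simp: K_def heatL_nn_def indicator_def ennreal_mult)
  qed
  finally have KN: "(\<integral>\<^sup>+p. ennreal (K p) \<partial>lborel) = N" by (simp add: lborel_prod)
  show "integrable lborel K \<longleftrightarrow> N < \<infinity>"
    using K_meas K0 by (simp add: integrable_iff_bounded lborel_prod KN)
  assume fin: "N < \<infinity>"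
  let ?A = "\<lambda>\<sigma>. heatL_nn s (t - \<sigma>) (\<lambda>y. ennreal (G \<sigma> y)) x"
  have A: "?A \<in> borel_measurable lborel"
    by (rule heatL_nn_measurable) measurable
  have A_real: "(\<lambda>\<sigma>. indicator {0<..<t} \<sigma> * enn2real (?A \<sigma>)) \<in> borel_measurable lborel"
    by (intro borel_measurable_times borel_measurable_indicator measurable_compose[OF A]) auto
  have A_ennreal: "(\<lambda>\<sigma>. indicator {0<..<t} \<sigma> * ?A \<sigma>) \<in> borel_measurable lborel"
    by (intro borel_measurable_times_ennreal borel_measurable_indicator A) auto
  have "(LINT \<sigma>:{0<..<t}|lborel. heatL_sg s (t - \<sigma>) (G \<sigma>) x) = (LINT \<sigma>|lborel. indicator {0<..<t} \<sigma> * enn2real (?A \<sigma>))"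
    unfolding set_lebesgue_integral_def using G s
    by (intro Bochner_Integration.integral_cong refl) (auto simp: indicator_def heatL_sg_eq_heatL_nn)
  also have "\<dots> = enn2real (\<integral>\<^sup>+\<sigma>. ennreal (indicator {0<..<t} \<sigma> * enn2real (?A \<sigma>)) \<partial>lborel)"
    by (rule integral_eq_nn_integral[OF A_real]) simp
  also have "(\<integral>\<^sup>+\<sigma>. ennreal (indicator {0<..<t} \<sigma> * enn2real (?A \<sigma>)) \<partial>lborel) = N"
    unfolding N_def
  proof (rule nn_integral_cong_AE)
    \<comment> \<open>An infinite inner integral would be turned into 0 by \<open>enn2real\<close>;
      finiteness of \<open>N\<close> confines this to a null set of times.\<close>
    have "AE \<sigma> in lborel. indicator {0<..<t} \<sigma> * ?A \<sigma> \<noteq> \<infinity>"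
      using fin unfolding N_def by (intro nn_integral_noteq_infinite A_ennreal) simp
    then show "AE \<sigma> in lborel. ennreal (indicator {0<..<t} \<sigma> * enn2real (?A \<sigma>)) = indicator {0<..<t} \<sigma> * ?A \<sigma>"
      by eventually_elim (auto simp: indicator_def less_top)
  qed
  finally show "(LINT \<sigma>:{0<..<t}|lborel. heatL_sg s (t - \<sigma>) (G \<sigma>) x) = enn2real N" .
qed

section \<open>Essential suprema and the L-infinity norm\<close>

lemma esssup_lborel_nonneg:
  assumes "g \<in> borel_measurable lborel"
  shows "0 \<le> esssup lborel (\<lambda>x::'a::euclidean_space. ereal \<bar>g x\<bar>)"
proof -
  have "esssup lborel (\<lambda>x::'a. 0::ereal) = 0" by (rule esssup_const) (simp add: emeasure_lborel_UNIV)
  moreover have "esssup lborel (\<lambda>x::'a. 0::ereal) \<le> esssup lborel (\<lambda>x::'a. ereal \<bar>g x\<bar>)"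
    by (rule esssup_mono) auto
  ultimately show ?thesis by simp
qed

lemma linf_norm_nonneg:
  "g \<in> borel_measurable lborel \<Longrightarrow> 0 \<le> linf_norm g"
  unfolding linf_norm_def using esssup_lborel_nonneg[of g] by (simp add: real_of_ereal_pos)

lemma linf_norm_AE:
  fixes g :: "'a::euclidean_space \<Rightarrow> real"
  assumes "g \<in> borel_measurable lborel" "esssup lborel (\<lambda>x. ereal \<bar>g x\<bar>) < \<infinity>"
  shows "AE x in lborel. \<bar>g x\<bar> \<le> linf_norm g"
proof -
  have "esssup lborel (\<lambda>x. ereal \<bar>g x\<bar>) = ereal (linf_norm g)"
    unfolding linf_norm_def using assms(2) esssup_lborel_nonneg[OF assms(1)] by (subst ereal_real) auto
  then show ?thesis using esssup_AE[of "\<lambda>x. ereal \<bar>g x\<bar>" lborel] by simp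
qed

lemma linf_norm_le:
  fixes g :: "'a::euclidean_space \<Rightarrow> real"
  assumes g: "g \<in> borel_measurable lborel" and "AE x in lborel. \<bar>g x\<bar> \<le> c"
  shows "linf_norm g \<le> c" and "esssup lborel (\<lambda>x. ereal \<bar>g x\<bar>) < \<infinity>"
proof -
  have *: "esssup lborel (\<lambda>x. ereal \<bar>g x\<bar>) \<le> ereal c"
    using assms by (intro esssup_I) auto
  then show "esssup lborel (\<lambda>x. ereal \<bar>g x\<bar>) < \<infinity>" by (rule le_less_trans) simp
  show "linf_norm g \<le> c"
    unfolding linf_norm_def using * esssup_lborel_nonneg[OF g]
    by (cases "esssup lborel (\<lambda>x. ereal \<bar>g x\<bar>)") auto
qed

text \<open>
  Meant for a \<open>q\<close> built from the norm of \<open>S(\<sigma>) v\<^sub>0\<close>, whose measurability in \<open>\<sigma>\<close> is not at hand; dividing by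
  \<open>c\<close> instead of multiplying keeps the integrand measurable.
\<close>

lemma nn_integral_le_cmult:
  assumes [measurable]: "g \<in> borel_measurable M" and le: "\<And>x. g x \<le> c * q x" and c: "c < (\<infinity>::ennreal)"
  shows "(\<integral>\<^sup>+x. g x \<partial>M) \<le> c * (\<integral>\<^sup>+x. q x \<partial>M)"
proof (cases "c = 0")
  case True
  then have "g x = 0" for x using le[of x] by simp
  then show ?thesis by simp
next
  case False
  have "g x = c * (g x / c)" for x
    using False c by (simp add: ennreal_times_divide ennreal_mult_divide_eq mult.commute[of c "g x"])
  then have "(\<integral>\<^sup>+x. g x \<partial>M) = c * (\<integral>\<^sup>+x. g x / c \<partial>M)"
    by (subst nn_integral_cmult[symmetric]) auto
  also have "\<dots> \<le> c * (\<integral>\<^sup>+x. q x \<partial>M)"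
    using False le by (intro mult_left_mono nn_integral_mono divide_le_posI_ennreal) (auto simp: zero_less_iff_neq_zero)
  finally show ?thesis .
qed

text \<open>An integral inequality does not make \<open>\<phi>\<close> differentiable, but its left
  side is C^1 and lies below \<open>\<phi>\<close>. Calling it \<open>\<psi>\<close>, monotonicity
  of \<open>f\<close> gives \<psi>' = h f(\<phi>) \<ge> h f(\<psi>), and \<psi>' / f(\<psi>) can be
  integrated. Starting at a > 0 keeps 1 / f continuous along the way.\<close>

lemma osgood_comparison:
  fixes f h \<phi> :: "real \<Rightarrow> real"
  assumes \<kappa>: "0 \<le> \<kappa>" and a: "0 < a"
    and f_cont: "continuous_on {0..} f" and f_mono: "mono_on {0..} f" and f_pos: "\<And>z. 0 < z \<Longrightarrow> 0 < f z"
    and h_cont: "continuous_on {0..\<kappa>} h" and h_nonneg: "\<And>t. t \<in> {0..\<kappa>} \<Longrightarrow> 0 \<le> h t"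
    and \<phi>_cont: "continuous_on {0..\<kappa>} \<phi>" and \<phi>_pos: "\<And>t. t \<in> {0..\<kappa>} \<Longrightarrow> 0 \<le> \<phi> t"
    and \<phi>: "\<And>t. t \<in> {0..\<kappa>} \<Longrightarrow> a + integral {0..t} (\<lambda>\<sigma>. h \<sigma> * f (\<phi> \<sigma>)) \<le> \<phi> t"
  shows "integral {0..\<kappa>} h \<le> integral {a..\<phi> \<kappa>} (\<lambda>z. 1 / f z)"
proof -
  define g where "g = (\<lambda>\<sigma>. h \<sigma> * f (\<phi> \<sigma>))"
  define \<psi> where "\<psi> = (\<lambda>t. a + integral {0..t} g)"
  have f_nonneg: "0 \<le> f z" if "0 \<le> z" for z
  proof -
    have "f 0 \<ge> 0"
    proof -
      have "(f \<longlongrightarrow> f 0) (at_right 0)"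
        using f_cont by (auto simp: continuous_on_def intro: tendsto_within_subset)
      moreover have "eventually (\<lambda>z. 0 \<le> f z) (at_right 0)"
        using f_pos by (intro eventually_at_right_less[THEN eventually_mono]) (auto intro: less_imp_le)
      ultimately show ?thesis by (rule tendsto_lowerbound) simp
    qed
    then show ?thesis using f_pos[of z] that by (cases "z = 0") auto
  qed
  have g_cont: "continuous_on {0..\<kappa>} g"
    unfolding g_def using \<phi>_pos
    by (intro continuous_on_mult h_cont continuous_on_compose2[OF f_cont \<phi>_cont]) auto
  have g_nonneg: "0 \<le> g t" if "t \<in> {0..\<kappa>}" for t
    unfolding g_def using that h_nonneg f_nonneg \<phi>_pos by (intro mult_nonneg_nonneg) auto
  have g_int: "g integrable_on {c..d}" if "0 \<le> c" "d \<le> \<kappa>" for c d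
    using that by (intro integrable_continuous_interval continuous_on_subset[OF g_cont]) auto
  have \<psi>_le: "\<psi> t \<le> \<phi> t" if "t \<in> {0..\<kappa>}" for t using \<phi>[OF that] by (simp add: \<psi>_def g_def)
  have \<psi>_mono: "\<psi> c \<le> \<psi> d" if "0 \<le> c" "c \<le> d" "d \<le> \<kappa>" for c d
    unfolding \<psi>_def using that
    by (intro add_left_mono integral_subset_le g_int) (auto intro: g_nonneg)
  have \<psi>0: "\<psi> 0 = a" by (simp add: \<psi>_def)
  have \<psi>_ge: "a \<le> \<psi> t" if "t \<in> {0..\<kappa>}" for t using \<psi>_mono[of 0 t] that by (simp add: \<psi>0)
  define b where "b = \<psi> \<kappa>"
  have img: "\<psi> ` {0..\<kappa>} \<subseteq> {a..b}" unfolding b_def using \<psi>_ge \<psi>_mono by auto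
  have inv_cont: "continuous_on {a..c} (\<lambda>z. 1 / f z)" for c
  proof -
    have "f z \<noteq> 0" if "z \<in> {a..c}" for z using that a f_pos[of z] by auto
    then show ?thesis using a by (intro continuous_intros continuous_on_subset[OF f_cont]) auto
  qed
  define F where "F = (\<lambda>z. integral {a..z} (\<lambda>z. 1 / f z))"
  \<comment> \<open>\<open>F\<close> is differentiated only within the interval from a to b, so the
    chain rule uses derivatives within the image of \<open>\<psi>\<close>; this also covers the
    endpoints.\<close>
  have "((F \<circ> \<psi>) has_real_derivative (1 / f (\<psi> t) * g t)) (at t within {0..\<kappa>})" if t: "t \<in> {0..\<kappa>}" for t
  proof (rule DERIV_image_chain)
    have "\<psi> t \<in> {a..b}" using img t by blast
    then have "(F has_real_derivative 1 / f (\<psi> t)) (at (\<psi> t) within {a..b})"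
      unfolding F_def by (rule integral_has_real_derivative[OF inv_cont])
    then show "(F has_real_derivative 1 / f (\<psi> t)) (at (\<psi> t) within \<psi> ` {0..\<kappa>})"
      by (rule DERIV_subset[OF _ img])
    show "(\<psi> has_real_derivative g t) (at t within {0..\<kappa>})"
      unfolding \<psi>_def using DERIV_add[OF DERIV_const integral_has_real_derivative[OF g_cont t]] by simp
  qed
  then have ftc: "((\<lambda>t. 1 / f (\<psi> t) * g t) has_integral (F \<circ> \<psi>) \<kappa> - (F \<circ> \<psi>) 0) {0..\<kappa>}"
    using \<kappa> by (intro fundamental_theorem_of_calculus) (auto simp: has_real_derivative_iff_has_vector_derivative comp_def)
  have "integral {0..\<kappa>} h \<le> (F \<circ> \<psi>) \<kappa> - (F \<circ> \<psi>) 0"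
  proof (rule has_integral_le[OF integrable_integral[OF integrable_continuous_interval[OF h_cont]] ftc])
    fix t assume t: "t \<in> {0..\<kappa>}"
    have "0 < f (\<psi> t)" using \<psi>_ge[OF t] a by (intro f_pos) simp
    moreover have "f (\<psi> t) \<le> f (\<phi> t)"
      using \<psi>_ge[OF t] \<psi>_le[OF t] a by (intro mono_onD[OF f_mono]) auto
    then have "h t * f (\<psi> t) \<le> g t" unfolding g_def using h_nonneg[OF t] by (intro mult_left_mono)
    ultimately show "h t \<le> 1 / f (\<psi> t) * g t" by (simp add: field_simps)
  qed
  also have "\<dots> = integral {a..\<psi> \<kappa>} (\<lambda>z. 1 / f z)" by (simp add: F_def \<psi>0)
  also have "\<dots> \<le> integral {a..\<phi> \<kappa>} (\<lambda>z. 1 / f z)"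
    using \<psi>_le[of \<kappa>] \<kappa> a f_pos
    by (intro integral_subset_le integrable_continuous_interval inv_cont) (auto intro: less_imp_le)
  finally show ?thesis .
qed

section \<open>Global solutions and blow-up\<close>

lemma borel_measurable_extend_nonneg:
  fixes g :: "real \<Rightarrow> real"
  assumes "continuous_on {0..} g"
  shows "(\<lambda>z. g (max 0 z)) \<in> borel_measurable borel"
  by (intro borel_measurable_continuous_onI continuous_on_compose2[OF assms]) (auto intro!: continuous_intros)

lemma borel_measurable_space_time:
  fixes u :: "'a::euclidean_space \<Rightarrow> real \<Rightarrow> real"
  assumes "(\<lambda>(x, t). u x t) \<in> borel_measurable borel"
    and X: "X \<in> borel_measurable M" and T: "T \<in> borel_measurable M"
  shows "(\<lambda>p. u (X p) (T p)) \<in> borel_measurable M"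
proof -
  have "(\<lambda>(x, t). u x t) \<in> borel_measurable (borel \<Otimes>\<^sub>M borel)"
    using assms(1) by (simp only: borel_prod)
  from measurable_compose[OF measurable_Pair[OF X T] this] show ?thesis by simp
qed

text \<open>The dictionary between the Bochner form of the equation and its nonnegative form.
  Existence reads it from right to left, non-existence from left to right.\<close>

lemma mild_equation_iff:
  fixes u :: "'a::euclidean_space \<Rightarrow> real \<Rightarrow> real"
  assumes t: "0 < t" and s: "0 < s" "s < 1"
    and h_cont: "continuous_on {0..} h" and h_nonneg: "\<And>t. 0 \<le> t \<Longrightarrow> 0 \<le> h t"
    and f_cont: "continuous_on {0..} f" and f_nonneg: "\<And>z. 0 \<le> z \<Longrightarrow> 0 \<le> f z"
    and u_meas: "(\<lambda>(x, t). u x t) \<in> borel_measurable borel" and u_nonneg: "\<And>x t. 0 \<le> t \<Longrightarrow> 0 \<le> u x t"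
    and v_meas: "v \<in> borel_measurable borel" and v_nonneg: "\<And>x. 0 \<le> v x"
    and fin: "heatL_nn s t (\<lambda>y. ennreal (v y)) x < \<infinity>"
  defines "N \<equiv> (\<integral>\<^sup>+\<sigma>. indicator {0<..<t} \<sigma> *
      heatL_nn s (t - \<sigma>) (\<lambda>y. ennreal (h (max 0 \<sigma>) * f (max 0 (u y \<sigma>)))) x \<partial>lborel)"
  shows "(integrable lborel (\<lambda>(\<sigma>, y). indicator {0<..<t} \<sigma> *
               (heatL_kernel s (t - \<sigma>) (x - y) * (h \<sigma> * f (u y \<sigma>))))
         \<and> u x t = heatL_sg s t v x +
              (LINT \<sigma>:{0<..<t}|lborel. heatL_sg s (t - \<sigma>) (\<lambda>y. h \<sigma> * f (u y \<sigma>)) x))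
    \<longleftrightarrow> N < \<infinity> \<and> ennreal (u x t) = heatL_nn s t (\<lambda>y. ennreal (v y)) x + N"
proof -
  define G where "G = (\<lambda>\<sigma> y. h (max 0 \<sigma>) * f (max 0 (u y \<sigma>)))"
  have [measurable]: "(\<lambda>z. h (max 0 z)) \<in> borel_measurable borel" "(\<lambda>z. f (max 0 z)) \<in> borel_measurable borel"
    by (rule borel_measurable_extend_nonneg[OF h_cont] borel_measurable_extend_nonneg[OF f_cont])+
  have um: "(\<lambda>p. u (snd p) (fst p)) \<in> borel_measurable (borel \<Otimes>\<^sub>M borel)"
    by (rule borel_measurable_space_time[OF u_meas]) auto
  have G_meas: "(\<lambda>(\<sigma>, y). G \<sigma> y) \<in> borel_measurable (borel \<Otimes>\<^sub>M borel)"
    unfolding G_def split_beta'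
    using measurable_compose[OF um, of "\<lambda>z. f (max 0 z)" borel] by measurable
  have G_nonneg: "0 \<le> G \<sigma> y" for \<sigma> y
    unfolding G_def by (intro mult_nonneg_nonneg h_nonneg f_nonneg) auto
  have G_eq: "h \<sigma> * f (u y \<sigma>) = G \<sigma> y" if "\<sigma> \<in> {0<..<t}" for \<sigma> y
    using that u_nonneg[of \<sigma> y] by (simp add: G_def max_def)
  note duh = heatL_duhamel[OF t s G_meas G_nonneg, of x]
  have 1: "(\<lambda>(\<sigma>, y). indicator {0<..<t} \<sigma> * (heatL_kernel s (t - \<sigma>) (x - y) * (h \<sigma> * f (u y \<sigma>))))
    = (\<lambda>(\<sigma>, y). indicator {0<..<t} \<sigma> * (heatL_kernel s (t - \<sigma>) (x - y) * G \<sigma> y))"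
    using G_eq by (auto simp: indicator_def fun_eq_iff)
  have 2: "(LINT \<sigma>:{0<..<t}|lborel. heatL_sg s (t - \<sigma>) (\<lambda>y. h \<sigma> * f (u y \<sigma>)) x)
    = (LINT \<sigma>:{0<..<t}|lborel. heatL_sg s (t - \<sigma>) (G \<sigma>) x)"
    unfolding set_lebesgue_integral_def using G_eq
    by (intro Bochner_Integration.integral_cong refl) (auto simp: indicator_def)
  have N: "N = (\<integral>\<^sup>+\<sigma>. indicator {0<..<t} \<sigma> * heatL_nn s (t - \<sigma>) (\<lambda>y. ennreal (G \<sigma> y)) x \<partial>lborel)"
    by (simp add: N_def G_def)
  have P: "heatL_sg s t v x = enn2real (heatL_nn s t (\<lambda>y. ennreal (v y)) x)"
    by (rule heatL_sg_eq_heatL_nn[OF t s v_meas v_nonneg])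
  have "u x t = enn2real (heatL_nn s t (\<lambda>y. ennreal (v y)) x) + enn2real N
    \<longleftrightarrow> ennreal (u x t) = heatL_nn s t (\<lambda>y. ennreal (v y)) x + N" if "N < \<infinity>"
  proof -
    have "u x t = enn2real (heatL_nn s t (\<lambda>y. ennreal (v y)) x) + enn2real N
      \<longleftrightarrow> ennreal (u x t) = ennreal (enn2real (heatL_nn s t (\<lambda>y. ennreal (v y)) x) + enn2real N)"
      using u_nonneg[of t x] t by (subst ennreal_inj) auto
    then show ?thesis using that fin by (simp add: less_top)
  qed
  then show ?thesis
    unfolding 1 2 P duh(1)[folded N] using duh(2)[folded N] by auto
qed

text \<open>Since \<open>f\<close> is monotone only up to \<open>m\<close>, the iteration must not
  leave that range. The averaging property gives S(t) v0 \<le> m everywhere, and all iterates stay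
  below S(t) v0.\<close>

lemma global_mild_sol_exists:
  fixes v0 :: "'a::euclidean_space \<Rightarrow> real"
  assumes s: "0 < s" "s < 1"
    and h_cont: "continuous_on {0..} h" and h_nonneg: "\<And>t. 0 \<le> t \<Longrightarrow> 0 \<le> h t"
    and f_cont: "continuous_on {0..} f" and f_nonneg: "\<And>z. 0 \<le> z \<Longrightarrow> 0 \<le> f z" and f0: "f 0 = 0"
    and m: "0 < m" and f_mono: "mono_on {0<..m} f" and f_ratio: "mono_on {0<..m} (\<lambda>\<sigma>. f \<sigma> / \<sigma>)"
    and v0: "\<And>x. 0 \<le> v0 x" "in_X v0" "nonzero_X v0" "linf_norm v0 \<le> m"
    and small: "(\<integral>\<^sup>+ \<sigma>\<in>{0<..}. ennreal (h \<sigma> * f (linf_norm (heatL_sg s \<sigma> v0))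
                  / linf_norm (heatL_sg s \<sigma> v0)) \<partial>lborel) < 1"
  shows "\<exists>\<delta>>0. \<exists>u. global_mild_sol s h f (\<lambda>x. \<delta> * v0 x) u \<and> \<not> (\<forall>x t. u x t = 0)"
proof -
  have v0_meas [measurable]: "v0 \<in> borel_measurable borel" and v0_int: "integrable lborel v0"
    using v0(2) by (auto simp: in_X_def)
  have v0_fin: "esssup lborel (\<lambda>x. ereal \<bar>v0 x\<bar>) < \<infinity>" using v0(2) by (auto simp: in_X_def)
  have v0_AE: "AE y in lborel. ennreal (v0 y) \<le> ennreal m"
    using linf_norm_AE[OF _ v0_fin] v0(4) by (auto elim!: eventually_mono intro!: ennreal_leI)
  \<comment> \<open>Continuity of \<open>h\<close> and \<open>f\<close> is given on [0, \<infinity>)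
    only; freezing them at their value at 0 makes them Borel on the whole line.\<close>
  define H where "H = (\<lambda>\<sigma>. h (max 0 \<sigma>))"
  define F where "F = (\<lambda>z. f (max 0 z))"
  have H_meas [measurable]: "H \<in> borel_measurable borel" and F_meas [measurable]: "F \<in> borel_measurable borel"
    unfolding H_def F_def
    by (rule borel_measurable_extend_nonneg[OF h_cont] borel_measurable_extend_nonneg[OF f_cont])+
  have H0: "0 \<le> H \<sigma>" for \<sigma> unfolding H_def by (rule h_nonneg) simp
  have F0: "0 \<le> F z" for z unfolding F_def by (rule f_nonneg) simp
  have F_mono: "F a \<le> F b" if "0 \<le> a" "a \<le> b" "b \<le> m" for a b
    using that f0 f_nonneg[of b] mono_onD[OF f_mono, of a b] by (cases "a = 0") (auto simp: F_def max_def)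
  define P where "P = (\<lambda>t. heatL_nn s t (\<lambda>y. ennreal (v0 y)))"
  have P_le_m: "P t x \<le> ennreal m" if "0 < t" for t x
    unfolding P_def by (rule heatL_nn_le_const[OF that s v0_AE])
  have P_fin: "P t x < \<top>" if "0 < t" for t x
    using P_le_m[OF that] by (rule le_less_trans) simp
  have P_meas: "(\<lambda>p. P (T p) (X p)) \<in> borel_measurable M"
    if "T \<in> borel_measurable M" "X \<in> borel_measurable M" for T X and M :: "'b measure"
    unfolding P_def using that by (intro heatL_nn_measurable) auto
  define w where "w = (\<lambda>\<sigma>. linf_norm (heatL_sg s \<sigma> v0))"
  have sg_P: "heatL_sg s \<sigma> v0 = (\<lambda>y. enn2real (P \<sigma> y))" if "0 < \<sigma>" for \<sigma>
    unfolding P_def using heatL_sg_eq_heatL_nn[OF that s v0_meas v0(1)] by auto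
  have w: "AE y in lborel. P \<sigma> y \<le> ennreal (w \<sigma>)" "0 \<le> w \<sigma>" "w \<sigma> \<le> m" if \<sigma>: "0 < \<sigma>" for \<sigma>
  proof -
    have "P \<sigma> \<in> borel_measurable borel" by (rule P_meas) auto
    then have meas: "heatL_sg s \<sigma> v0 \<in> borel_measurable lborel" unfolding sg_P[OF \<sigma>] by simp
    have "AE y in lborel. \<bar>heatL_sg s \<sigma> v0 y\<bar> \<le> m"
      unfolding sg_P[OF \<sigma>] using P_le_m[OF \<sigma>] m by (intro AE_I2) (auto intro!: enn2real_leI)
    note le = linf_norm_le[OF meas this]
    show "w \<sigma> \<le> m" "0 \<le> w \<sigma>" unfolding w_def using le(1) linf_norm_nonneg[OF meas] by auto
    have "AE y in lborel. enn2real (P \<sigma> y) \<le> w \<sigma>"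
      using linf_norm_AE[OF meas le(2)] unfolding w_def sg_P[OF \<sigma>] by simp
    then show "AE y in lborel. P \<sigma> y \<le> ennreal (w \<sigma>)"
      by (rule eventually_mono) (auto intro!: enn2real_le P_fin[OF \<sigma>, THEN less_imp_neq])
  qed
  define q where "q = (\<lambda>\<sigma>. ennreal (h \<sigma> * f (w \<sigma>) / w \<sigma>) * indicator {0<..} \<sigma>)"
  define I where "I = (\<integral>\<^sup>+\<sigma>. q \<sigma> \<partial>lborel)"
  have I: "I < 1" using small by (simp add: I_def q_def w_def)
  \<comment> \<open>With \<delta> + I = 1, the datum contributes \<delta> P and the source at most I
    P, so the map \<open>S\<close> preserves the bound by \<open>P\<close>.\<close>
  define \<delta> where "\<delta> = 1 - enn2real I"
  have I_real: "I = ennreal (enn2real I)" using less_trans[OF I ennreal_one_less_top] by simp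
  have \<delta>: "0 < \<delta>" "\<delta> \<le> 1"
    using I unfolding \<delta>_def by (subst (asm) I_real, simp add: ennreal_less_one_iff) simp
  have \<delta>I: "ennreal \<delta> + I = 1"
    using \<delta> by (subst I_real) (simp add: \<delta>_def flip: ennreal_plus)
  \<comment> \<open>For almost every y the value p of \<open>P \<sigma> y\<close> satisfies p \<le>
    w \<le> m, so the ratio f p / p is at most f w / w. The case p = 0, which includes w = 0, is
    settled by f 0 = 0.\<close>
  have key: "AE y in lborel. ennreal (H \<sigma>) * ennreal (F (enn2real (U y))) \<le> q \<sigma> * P \<sigma> y"
    if \<sigma>: "0 < \<sigma>" and U: "\<And>y. U y \<le> P \<sigma> y" for \<sigma> and U :: "'a \<Rightarrow> ennreal"
    using w(1)[OF \<sigma>]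
  proof eventually_elim
    case (elim y)
    define p where "p = enn2real (P \<sigma> y)"
    have Pp: "P \<sigma> y = ennreal p" using P_fin[OF \<sigma>] by (simp add: p_def)
    have p: "0 \<le> p" by (simp add: p_def)
    have pw: "p \<le> w \<sigma>" using elim w(2)[OF \<sigma>] unfolding Pp by simp
    have pm: "p \<le> m" using pw w(3)[OF \<sigma>] by simp
    have "enn2real (U y) \<le> p" unfolding p_def using U P_fin[OF \<sigma>] by (rule enn2real_mono)
    then have 1: "F (enn2real (U y)) \<le> F p" using pm by (intro F_mono) auto
    have 2: "F p \<le> f (w \<sigma>) / w \<sigma> * p"
    proof (cases "p = 0")
      case False
      then have "0 < p" using p by simp
      then have "f p / p \<le> f (w \<sigma>) / w \<sigma>"
        using pw w(3)[OF \<sigma>] by (intro mono_onD[OF f_ratio]) auto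
      then show ?thesis using \<open>0 < p\<close> by (simp add: F_def field_simps)
    qed (simp add: F_def f0)
    have "H \<sigma> * F (enn2real (U y)) \<le> H \<sigma> * (f (w \<sigma>) / w \<sigma> * p)"
      using 1 2 H0 by (intro mult_left_mono) auto
    also have "\<dots> = h \<sigma> * f (w \<sigma>) / w \<sigma> * p" using \<sigma> by (simp add: H_def)
    finally have "ennreal (H \<sigma> * F (enn2real (U y))) \<le> ennreal (h \<sigma> * f (w \<sigma>) / w \<sigma> * p)"
      by (rule ennreal_leI)
    also have "\<dots> = q \<sigma> * P \<sigma> y"
    proof -
      have "q \<sigma> = ennreal (h \<sigma> * f (w \<sigma>) / w \<sigma>)" using \<sigma> by (simp add: q_def)
      then show ?thesis by (simp only: Pp ennreal_mult''[OF p])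
    qed
    finally show ?case by (simp only: ennreal_mult''[OF F0])
  qed
  define D where "D = (\<lambda>(U :: real \<Rightarrow> 'a \<Rightarrow> ennreal) t \<sigma> x.
    indicator {0<..<t} \<sigma> * heatL_nn s (t - \<sigma>) (\<lambda>y. ennreal (H \<sigma>) * ennreal (F (enn2real (U \<sigma> y)))) x)"
  \<comment> \<open>The Duhamel map for the datum \<delta> v0; its fixed points are the solutions
    sought.\<close>
  define S where "S = (\<lambda>U t x. ennreal \<delta> * P t x + (\<integral>\<^sup>+\<sigma>. D U t \<sigma> x \<partial>lborel))"
  define meas where "meas = (\<lambda>U :: real \<Rightarrow> 'a \<Rightarrow> ennreal. (\<lambda>(t, x). U t x) \<in> borel_measurable (borel \<Otimes>\<^sub>M borel))"
  have meas_comp: "(\<lambda>p. U (T p) (X p)) \<in> borel_measurable M"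
    if "meas U" "T \<in> borel_measurable M" "X \<in> borel_measurable M" for U T X and M :: "'c measure"
    using measurable_compose[OF measurable_Pair[OF that(2,3)] that(1)[unfolded meas_def]] by simp
  have source_meas: "(\<lambda>p. ennreal (H (T p)) * ennreal (F (enn2real (U (T p) (X p))))) \<in> borel_measurable M"
    if "meas U" "T \<in> borel_measurable M" "X \<in> borel_measurable M" for U T X and M :: "'d measure"
    using meas_comp[OF that] that(2) by measurable
  have D_meas: "(\<lambda>p. D U (T p) (Z p) (X p)) \<in> borel_measurable M"
    if U: "meas U" and [measurable]: "T \<in> borel_measurable M" "Z \<in> borel_measurable M" "X \<in> borel_measurable M"
    for U T Z X and M :: "'e measure"
  proof -
    have [measurable]: "(\<lambda>p. heatL_nn s (T p - Z p) (\<lambda>y. ennreal (H (Z p)) * ennreal (F (enn2real (U (Z p) y)))) (X p))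
      \<in> borel_measurable M"
      using source_meas[OF U, of "\<lambda>p. Z (fst p)" "M \<Otimes>\<^sub>M lborel" snd]
      by (intro heatL_nn_measurable) (auto simp: split_beta')
    show ?thesis
      unfolding D_def indicator_def of_bool_def greaterThanLessThan_iff by measurable
  qed
  have S_meas: "meas (S U)" if "meas U" for U
  proof -
    have [measurable]: "(\<lambda>p. P (fst p) (snd p)) \<in> borel_measurable (borel \<Otimes>\<^sub>M borel)"
      by (rule P_meas) auto
    have [measurable]: "(\<lambda>(p, \<sigma>). D U (fst p) \<sigma> (snd p)) \<in> borel_measurable ((borel \<Otimes>\<^sub>M borel) \<Otimes>\<^sub>M lborel)"
      unfolding split_beta' by (rule D_meas[OF that]) measurable
    show ?thesis unfolding meas_def S_def split_beta' by measurable
  qed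
  have S_le: "S U t x \<le> P t x" if t: "0 < t" and U: "meas U" "\<And>\<sigma> y. 0 < \<sigma> \<Longrightarrow> U \<sigma> y \<le> P \<sigma> y" for U t x
  proof -
    \<comment> \<open>The semigroup law removes \<sigma> from the spatial factor: S(t - \<sigma>)
      S(\<sigma>) v0 = S(t) v0. Only \<open>q\<close> is left to integrate.\<close>
    have "D U t \<sigma> x \<le> P t x * q \<sigma>" for \<sigma>
    proof (cases "\<sigma> \<in> {0<..<t}")
      case True
      then have \<sigma>: "0 < \<sigma>" "0 < t - \<sigma>" by auto
      have P\<sigma>: "P \<sigma> \<in> borel_measurable borel" by (rule P_meas) auto
      have "D U t \<sigma> x \<le> heatL_nn s (t - \<sigma>) (\<lambda>y. q \<sigma> * P \<sigma> y) x"
        using True heatL_nn_mono_AE[OF key[of \<sigma> "U \<sigma>"]] U \<sigma> by (simp add: D_def)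
      also have "\<dots> = q \<sigma> * heatL_nn s (t - \<sigma>) (P \<sigma>) x" by (rule heatL_nn_cmult[OF P\<sigma>])
      also have "heatL_nn s (t - \<sigma>) (P \<sigma>) x = P t x"
        unfolding P_def by (subst heatL_nn_semigroup[OF \<sigma>(2,1) s]) auto
      finally show ?thesis by (simp add: mult.commute)
    qed (simp add: D_def)
    then have "(\<integral>\<^sup>+\<sigma>. D U t \<sigma> x \<partial>lborel) \<le> P t x * I"
      unfolding I_def using P_fin[OF t] by (intro nn_integral_le_cmult D_meas U) auto
    then have "S U t x \<le> ennreal \<delta> * P t x + P t x * I" unfolding S_def by (rule add_left_mono)
    also have "\<dots> = (ennreal \<delta> + I) * P t x" by (simp only: distrib_right mult.commute[of "P t x" I])
    finally show ?thesis by (simp add: \<delta>I)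
  qed
  have source_mono: "ennreal (H \<sigma>) * ennreal (F (enn2real a)) \<le> ennreal (H \<sigma>) * ennreal (F (enn2real b))"
    if "0 < \<sigma>" "a \<le> b" "b \<le> P \<sigma> y" for \<sigma> a b y
  proof -
    have b: "b \<le> ennreal m" using that P_le_m order_trans by blast
    then have "enn2real a \<le> enn2real b" using that by (intro enn2real_mono) (auto intro: le_less_trans)
    moreover have "enn2real b \<le> m" using b m by (intro enn2real_leI) auto
    ultimately show ?thesis by (intro mult_left_mono ennreal_leI F_mono) auto
  qed
  have D_mono: "D U t \<sigma> x \<le> D U' t \<sigma> x" if "\<And>\<sigma> y. 0 < \<sigma> \<Longrightarrow> U \<sigma> y \<le> U' \<sigma> y" "\<And>\<sigma> y. 0 < \<sigma> \<Longrightarrow> U' \<sigma> y \<le> P \<sigma> y" for U U' t \<sigma> x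
  proof (cases "\<sigma> \<in> {0<..<t}")
    case True
    then have "0 < \<sigma>" by simp
    with True show ?thesis unfolding D_def
      by (intro mult_left_mono heatL_nn_mono_AE AE_I2 source_mono[OF _ that(1) that(2)]) auto
  qed (simp add: D_def)
  have S_mono: "S U t x \<le> S U' t x" if "\<And>\<sigma> y. 0 < \<sigma> \<Longrightarrow> U \<sigma> y \<le> U' \<sigma> y" "\<And>\<sigma> y. 0 < \<sigma> \<Longrightarrow> U' \<sigma> y \<le> P \<sigma> y" for U U' t x
    unfolding S_def by (intro add_left_mono nn_integral_mono D_mono that)
  define u where "u = (\<lambda>k. (S ^^ k) (\<lambda>_ _. 0))"
  have u_Suc: "u (Suc k) = S (u k)" for k by (simp add: u_def)
  have u_meas: "meas (u k)" for k
    by (induction k) (auto simp: u_Suc S_meas, simp add: u_def meas_def)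
  have u_le: "u k t x \<le> P t x" if "0 < t" for k t x
    using that by (induction k arbitrary: t x) (auto simp: u_Suc intro!: S_le u_meas, simp add: u_def)
  have u_mono: "u k t x \<le> u (Suc k) t x" if "0 < t" for k t x
    using that
  proof (induction k arbitrary: t x)
    case 0
    show ?case by (simp add: u_def)
  next
    case (Suc k)
    have "S (u k) t x \<le> S (u (Suc k)) t x" by (intro S_mono Suc.IH u_le)
    then show ?case by (simp only: u_Suc)
  qed
  have u_inc: "incseq (\<lambda>k. u k t x)" if "0 < t" for t x
    by (intro incseq_SucI u_mono that)
  define uu where "uu = (\<lambda>t x. SUP k. u k t x)"
  have uu_le: "uu t x \<le> P t x" if "0 < t" for t x
    unfolding uu_def by (intro SUP_least u_le that)
  have uu_meas: "meas uu"
    using u_meas unfolding meas_def uu_def split_beta' by (intro borel_measurable_SUP) auto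
  have lim: "(\<lambda>k. u k t x) \<longlonglongrightarrow> uu t x" if "0 < t" for t x
    unfolding uu_def by (rule LIMSEQ_SUP[OF u_inc[OF that]])
  have source_lim: "(\<lambda>k. ennreal (H \<sigma>) * ennreal (F (enn2real (u k \<sigma> y)))) \<longlonglongrightarrow> ennreal (H \<sigma>) * ennreal (F (enn2real (uu \<sigma> y)))"
    if "0 < \<sigma>" for \<sigma> y
  proof (rule ennreal_tendsto_cmult)
    have "uu \<sigma> y < \<top>" using uu_le[OF that] P_fin[OF that] by (rule le_less_trans)
    then have "(\<lambda>k. u k \<sigma> y) \<longlonglongrightarrow> ennreal (enn2real (uu \<sigma> y))" using lim[OF that] by simp
    then have *: "(\<lambda>k. enn2real (u k \<sigma> y)) \<longlonglongrightarrow> enn2real (uu \<sigma> y)" by (rule tendsto_enn2real) simp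
    have "continuous_on UNIV F"
      unfolding F_def by (rule continuous_on_compose2[OF f_cont]) (auto intro!: continuous_intros)
    then have F_cont: "isCont F z" for z by (simp add: continuous_on_eq_continuous_at)
    show "(\<lambda>k. ennreal (F (enn2real (u k \<sigma> y)))) \<longlonglongrightarrow> ennreal (F (enn2real (uu \<sigma> y)))"
      by (rule tendsto_ennrealI[OF isCont_tendsto_compose[OF F_cont *]])
  qed simp
  have D_lim: "(\<lambda>k. D (u k) t \<sigma> x) \<longlonglongrightarrow> D uu t \<sigma> x" for t \<sigma> x
  proof (cases "\<sigma> \<in> {0<..<t}")
    case True
    then have \<sigma>: "0 < \<sigma>" by simp
    have "(\<lambda>k. heatL_nn s (t - \<sigma>) (\<lambda>y. ennreal (H \<sigma>) * ennreal (F (enn2real (u k \<sigma> y)))) x)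
      \<longlonglongrightarrow> heatL_nn s (t - \<sigma>) (\<lambda>y. ennreal (H \<sigma>) * ennreal (F (enn2real (uu \<sigma> y)))) x"
      unfolding heatL_nn_def
    proof (rule nn_integral_LIMSEQ)
      show "incseq (\<lambda>k y. ennreal (heatL_kernel s (t - \<sigma>) (x - y)) * (ennreal (H \<sigma>) * ennreal (F (enn2real (u k \<sigma> y)))))"
        by (intro incseq_SucI le_funI, rule mult_left_mono, rule source_mono[OF \<sigma> u_mono[OF \<sigma>] u_le[OF \<sigma>]]) simp
      show "(\<lambda>y. ennreal (heatL_kernel s (t - \<sigma>) (x - y)) * (ennreal (H \<sigma>) * ennreal (F (enn2real (u k \<sigma> y))))) \<in> borel_measurable lborel" for k
        using source_meas[OF u_meas, of "\<lambda>_. \<sigma>" lborel "\<lambda>y. y" k] by measurable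
      show "(\<lambda>k. ennreal (heatL_kernel s (t - \<sigma>) (x - y)) * (ennreal (H \<sigma>) * ennreal (F (enn2real (u k \<sigma> y)))))
        \<longlonglongrightarrow> ennreal (heatL_kernel s (t - \<sigma>) (x - y)) * (ennreal (H \<sigma>) * ennreal (F (enn2real (uu \<sigma> y))))" for y
        by (intro ennreal_tendsto_cmult source_lim[OF \<sigma>]) simp
    qed
    then show ?thesis using True by (simp add: D_def)
  qed (simp add: D_def)
  \<comment> \<open>Both sides of u (k + 1) = S (u k) converge. On the right, monotone convergence
    is applied in space (\<open>D_lim\<close>) and then in time.\<close>
  have fixpoint: "uu t x = S uu t x" if t: "0 < t" for t x
  proof (rule LIMSEQ_unique[OF LIMSEQ_Suc[OF lim[OF t]]])
    have "(\<lambda>k. \<integral>\<^sup>+\<sigma>. D (u k) t \<sigma> x \<partial>lborel) \<longlonglongrightarrow> (\<integral>\<^sup>+\<sigma>. D uu t \<sigma> x \<partial>lborel)"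
    proof (rule nn_integral_LIMSEQ)
      show "incseq (\<lambda>k \<sigma>. D (u k) t \<sigma> x)"
        by (intro incseq_SucI le_funI D_mono u_mono u_le)
      show "(\<lambda>\<sigma>. D (u k) t \<sigma> x) \<in> borel_measurable lborel" for k by (intro D_meas u_meas) auto
    qed (rule D_lim)
    then show "(\<lambda>k. u (Suc k) t x) \<longlonglongrightarrow> S uu t x"
      unfolding u_Suc S_def by (intro tendsto_add tendsto_const)
  qed
  \<comment> \<open>The value 0 for t \<le> 0 is a free choice, since \<open>mild_sol\<close>
    imposes the equation for t > 0 only and receives the datum through the semigroup term.\<close>
  define W where "W = (\<lambda>x t. if 0 < t then enn2real (uu t x) else 0)"
  have W_ennreal: "ennreal (W x t) = uu t x" if "0 < t" for x t
    using that le_less_trans[OF uu_le[OF that] P_fin[OF that]] by (simp add: W_def)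
  have W_nonneg: "0 \<le> W x t" for x t by (simp add: W_def)
  have W_meas: "(\<lambda>(x, t). W x t) \<in> borel_measurable borel"
  proof -
    have [measurable]: "(\<lambda>p. uu (snd p) (fst p)) \<in> borel_measurable (borel \<Otimes>\<^sub>M borel)"
      by (rule meas_comp[OF uu_meas]) auto
    show ?thesis unfolding W_def split_beta' borel_prod[symmetric] by measurable
  qed
  have W_meas1: "(\<lambda>x. W x t) \<in> borel_measurable borel" for t
    by (rule borel_measurable_space_time[OF W_meas]) auto
  have W_m: "W x t \<le> m" if "0 < t" for x t
    using that m order_trans[OF uu_le[OF that] P_le_m[OF that]] by (auto simp: W_def intro!: enn2real_leI)
  \<comment> \<open>The mass of v0: conservation of mass makes it a bound for the L1 norm at all
    times.\<close>
  define c where "c = enn2real (\<integral>\<^sup>+y. ennreal (v0 y) \<partial>lborel)"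
  have W_mass: "(\<integral>\<^sup>+x. ennreal (W x t) \<partial>lborel) \<le> ennreal c" if t: "0 < t" for t
  proof -
    have "(\<integral>\<^sup>+x. ennreal (W x t) \<partial>lborel) \<le> (\<integral>\<^sup>+x. P t x \<partial>lborel)"
      unfolding W_ennreal[OF t] by (intro nn_integral_mono uu_le t)
    also have "\<dots> = (\<integral>\<^sup>+y. ennreal (v0 y) \<partial>lborel)" unfolding P_def by (rule heatL_nn_mass[OF t s]) simp
    also have "\<dots> = ennreal c" using v0_int v0(1) by (simp add: c_def nn_integral_eq_integral)
    finally show ?thesis .
  qed
  have "global_mild_sol s h f (\<lambda>x. \<delta> * v0 x) W"
    unfolding global_mild_sol_def mild_sol_def
  proof (intro conjI allI impI exI AE_I2)
    fix t :: real
    assume "0 < ereal t \<and> ereal t < \<infinity>"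
    then have t: "0 < t" by simp
    have le: "AE x in lborel. \<bar>W x t\<bar> \<le> m" using W_nonneg W_m[OF t] by simp
    have meas1: "(\<lambda>x. W x t) \<in> borel_measurable lborel" using W_meas1 by simp
    have int: "integrable lborel (\<lambda>x. W x t)"
      using W_nonneg le_less_trans[OF W_mass[OF t]] by (intro integrableI_nonneg meas1) auto
    show "in_X (\<lambda>x. W x t)"
      unfolding in_X_def using meas1 int linf_norm_le(2)[OF meas1 le] by blast
    show "linf_norm (\<lambda>x. W x t) \<le> max m c" using linf_norm_le(1)[OF meas1 le] by simp
    have "ennreal (l1_norm (\<lambda>x. W x t)) \<le> ennreal c"
      unfolding l1_norm_def using W_nonneg W_mass[OF t] nn_integral_eq_integral[OF int] by simp
    then have "l1_norm (\<lambda>x. W x t) \<le> c" by (subst (asm) ennreal_le_iff) (auto simp: c_def)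
    then show "l1_norm (\<lambda>x. W x t) \<le> max m c" by simp
  next
    fix t :: real and x :: 'a
    assume "0 < ereal t \<and> ereal t < \<infinity>"
    then have t: "0 < t" by simp
    have \<delta>v: "heatL_nn s t (\<lambda>y. ennreal (\<delta> * v0 y)) x = ennreal \<delta> * P t x"
      unfolding P_def using \<delta> v0(1) by (subst heatL_nn_cmult[symmetric]) (auto simp: ennreal_mult)
    have D_eq: "(\<integral>\<^sup>+\<sigma>. indicator {0<..<t} \<sigma> * heatL_nn s (t - \<sigma>) (\<lambda>y. ennreal (h (max 0 \<sigma>) * f (max 0 (W y \<sigma>)))) x \<partial>lborel)
      = (\<integral>\<^sup>+\<sigma>. D uu t \<sigma> x \<partial>lborel)"
    proof (intro nn_integral_cong)
      fix \<sigma>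
      show "indicator {0<..<t} \<sigma> * heatL_nn s (t - \<sigma>) (\<lambda>y. ennreal (h (max 0 \<sigma>) * f (max 0 (W y \<sigma>)))) x = D uu t \<sigma> x"
      proof (cases "\<sigma> \<in> {0<..<t}")
        case True
        then show ?thesis
          using H0[of \<sigma>] F0 unfolding D_def H_def[symmetric] F_def[symmetric] fun_cong[OF F_def, symmetric] fun_cong[OF H_def, symmetric]
          by (simp add: W_def ennreal_mult)
      qed (simp add: D_def)
    qed
    have sum: "ennreal (W x t) = ennreal \<delta> * P t x + (\<integral>\<^sup>+\<sigma>. D uu t \<sigma> x \<partial>lborel)"
      using fixpoint[OF t] by (simp add: W_ennreal[OF t] S_def)
    have "(\<integral>\<^sup>+\<sigma>. D uu t \<sigma> x \<partial>lborel) \<le> ennreal (W x t)"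
      unfolding sum by (rule add_increasing) auto
    then have fin: "(\<integral>\<^sup>+\<sigma>. D uu t \<sigma> x \<partial>lborel) < \<infinity>"
      by (rule le_less_trans) simp
    have \<delta>v_meas: "(\<lambda>x. \<delta> * v0 x) \<in> borel_measurable borel" by measurable
    have \<delta>v_nonneg: "0 \<le> \<delta> * v0 x" for x using \<delta> v0(1) by simp
    have \<delta>v_fin: "heatL_nn s t (\<lambda>y. ennreal (\<delta> * v0 y)) x < \<infinity>"
      using P_fin[OF t] by (simp add: \<delta>v ennreal_mult_less_top)
    have iff: "integrable lborel (\<lambda>(\<sigma>, y). indicator {0<..<t} \<sigma> *
               (heatL_kernel s (t - \<sigma>) (x - y) * (h \<sigma> * f (W y \<sigma>))))
         \<and> W x t = heatL_sg s t (\<lambda>x. \<delta> * v0 x) x +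
              (LINT \<sigma>:{0<..<t}|lborel. heatL_sg s (t - \<sigma>) (\<lambda>y. h \<sigma> * f (W y \<sigma>)) x)"
      by (rule mild_equation_iff[OF t s h_cont h_nonneg f_cont f_nonneg W_meas W_nonneg \<delta>v_meas \<delta>v_nonneg \<delta>v_fin,
            unfolded D_eq \<delta>v, THEN iffD2]) (use fin sum in simp_all)
    show "integrable lborel (\<lambda>(\<sigma>, y). indicator {0<..<t} \<sigma> *
               (heatL_kernel s (t - \<sigma>) (x - y) * (h \<sigma> * f (W y \<sigma>))))" using iff by blast
    show "W x t = heatL_sg s t (\<lambda>x. \<delta> * v0 x) x +
              (LINT \<sigma>:{0<..<t}|lborel. heatL_sg s (t - \<sigma>) (\<lambda>y. h \<sigma> * f (W y \<sigma>)) x)" using iff by blast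
  qed (use W_nonneg W_meas in auto)
  \<comment> \<open>A vanishing solution would force S(1) v0 = 0, as \<delta> > 0, and conservation
    of mass would then give v0 = 0.\<close>
  moreover have "\<not> (\<forall>x t. W x t = 0)"
  proof
    assume "\<forall>x t. W x t = 0"
    then have "S uu 1 x = 0" for x using W_ennreal[of 1 x] fixpoint[of 1 x] by simp
    then have "P 1 x = 0" for x using \<delta> by (simp add: S_def)
    then have "(\<integral>\<^sup>+y. ennreal (v0 y) \<partial>lborel) = 0"
      using heatL_nn_mass[OF zero_less_one s, of "\<lambda>y. ennreal (v0 y)"] by (simp add: P_def)
    then have "AE x in lborel. v0 x = 0"
      by (subst (asm) nn_integral_0_iff_AE) (auto elim!: eventually_mono simp: v0(1) ennreal_eq_0_iff antisym)
    then show False using v0(3) by (simp add: nonzero_X_def)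
  qed
  ultimately show ?thesis using \<delta>(1) by blast
qed

text \<open>The equation and the Jensen inequality hold at each time off a null set of x depending
  on that time. The aim is one point x, with S(\<kappa>) u0 near its essential supremum, at which
  the differential inequality holds for almost every time.\<close>

lemma no_global_mild_sol:
  fixes u0 :: "'a::euclidean_space \<Rightarrow> real"
  assumes s: "0 < s" "s < 1"
    and h_cont: "continuous_on {0..} h" and h_nonneg: "\<And>t. 0 \<le> t \<Longrightarrow> 0 \<le> h t"
    and f_cont: "continuous_on {0..} f" and f_nonneg: "\<And>z. 0 \<le> z \<Longrightarrow> 0 \<le> f z"
    and u0: "\<And>x. 0 \<le> u0 x" "in_X u0" "nonzero_X u0"
    and f_mono: "mono_on {0..} f" and f_pos: "\<And>z. 0 < z \<Longrightarrow> 0 < f z"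
    and jensen: "\<And>t (w0 :: 'a \<Rightarrow> real). 0 < t \<Longrightarrow> (\<And>x. 0 \<le> w0 x) \<Longrightarrow> in_X w0 \<Longrightarrow>
        AE x in lborel. f (heatL_sg s t w0 x) \<le> heatL_sg s t (\<lambda>y. f (w0 y)) x"
    and \<kappa>: "0 < \<kappa>"
    and blowup: "(\<integral>\<^sup>+ \<sigma>\<in>{linf_norm (heatL_sg s \<kappa> u0)..}. ennreal (1 / f \<sigma>) \<partial>lborel)
                   \<le> (\<integral>\<^sup>+ \<sigma>\<in>{0..\<kappa>}. ennreal (h \<sigma>) \<partial>lborel)"
  shows "\<not> global_mild_sol s h f u0 u"
proof
  assume "global_mild_sol s h f u0 u"
  then have sol: "mild_sol s \<infinity> h f u0 u" by (simp add: global_mild_sol_def)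
  have u_nonneg: "0 \<le> u x t" if "0 \<le> t" for x t
    using sol that by (simp add: mild_sol_def)
  have u_meas: "(\<lambda>(x, t). u x t) \<in> borel_measurable borel"
    using sol by (simp add: mild_sol_def)
  have u_X: "\<exists>C. AE t in lborel. 0 < t \<longrightarrow> in_X (\<lambda>x. u x t) \<and> linf_norm (\<lambda>x. u x t) \<le> C"
    using sol unfolding mild_sol_def by (auto elim!: eventually_mono)
  have u_eq: "AE x in lborel. integrable lborel (\<lambda>(\<sigma>, y). indicator {0<..<t} \<sigma> *
               (heatL_kernel s (t - \<sigma>) (x - y) * (h \<sigma> * f (u y \<sigma>))))
         \<and> u x t = heatL_sg s t u0 x +
              (LINT \<sigma>:{0<..<t}|lborel. heatL_sg s (t - \<sigma>) (\<lambda>y. h \<sigma> * f (u y \<sigma>)) x)" if "0 < t" for t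
    using sol that unfolding mild_sol_def by simp
  have u0_meas [measurable]: "u0 \<in> borel_measurable borel" using u0(2) by (auto simp: in_X_def)
  have u0_fin: "esssup lborel (\<lambda>x. ereal \<bar>u0 x\<bar>) < \<infinity>" using u0(2) by (auto simp: in_X_def)
  define M0 where "M0 = linf_norm u0"
  have M0: "0 \<le> M0" unfolding M0_def by (rule linf_norm_nonneg) simp
  have u0_AE: "AE y in lborel. ennreal (u0 y) \<le> ennreal M0"
    using linf_norm_AE[OF _ u0_fin] by (auto elim!: eventually_mono intro!: ennreal_leI simp: M0_def)
  define H where "H = (\<lambda>\<sigma>. h (max 0 \<sigma>))"
  define F where "F = (\<lambda>z. f (max 0 z))"
  have H_meas [measurable]: "H \<in> borel_measurable borel" and F_meas [measurable]: "F \<in> borel_measurable borel"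
    unfolding H_def F_def
    by (rule borel_measurable_extend_nonneg[OF h_cont] borel_measurable_extend_nonneg[OF f_cont])+
  have H0: "0 \<le> H \<sigma>" for \<sigma> unfolding H_def by (rule h_nonneg) simp
  have F0: "0 \<le> F z" for z unfolding F_def by (rule f_nonneg) simp
  have F_mono: "F a \<le> F b" if "a \<le> b" for a b
    unfolding F_def using that by (intro mono_onD[OF f_mono]) auto
  have um [measurable]: "(\<lambda>p. u (X p) (T p)) \<in> borel_measurable M"
    if "X \<in> borel_measurable M" "T \<in> borel_measurable M" for X T and M :: "'b measure"
    by (rule borel_measurable_space_time[OF u_meas that])
  define P where "P = (\<lambda>t. heatL_nn s t (\<lambda>y. ennreal (u0 y)))"
  define g where "g = (\<lambda>\<sigma>. heatL_nn s (\<kappa> - \<sigma>) (\<lambda>y. ennreal (F (u y \<sigma>))))"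
  define A where "A = (\<lambda>t \<sigma>. heatL_nn s (t - \<sigma>) (\<lambda>y. ennreal (H \<sigma> * F (u y \<sigma>))))"
  \<comment> \<open>Arrival time \<open>T\<close> and cut-off \<open>t\<close> are kept apart:
    \<open>N t t\<close> is the Duhamel term of u(t), while \<open>N \<kappa> t\<close> is this term
    carried on to time \<open>\<kappa>\<close>.\<close>
  define N where "N = (\<lambda>T t x. \<integral>\<^sup>+\<sigma>. indicator {0<..<t} \<sigma> * A T \<sigma> x \<partial>lborel)"
  \<comment> \<open>Unlike S(\<kappa> - t) u(t), this expression remains meaningful at t = \<kappa>,
    where \<open>heatL_nn\<close> at time 0 would not be the identity.\<close>
  define \<Phi> where "\<Phi> = (\<lambda>t x. P \<kappa> x + N \<kappa> t x)"
  have P_le: "P t x \<le> ennreal M0" if "0 < t" for t x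
    unfolding P_def by (rule heatL_nn_le_const[OF that s u0_AE])
  have P_fin: "P t x < \<infinity>" if "0 < t" for t x
    using P_le[OF that, of x] by (rule le_less_trans) simp
  have P_meas [measurable]: "P t \<in> borel_measurable borel" for t
    unfolding P_def by (rule heatL_nn_measurable) measurable
  have source_meas: "(\<lambda>(p, y). ennreal (H (Z p) * F (u y (Z p)))) \<in> borel_measurable (M \<Otimes>\<^sub>M lborel)"
    if [measurable]: "Z \<in> borel_measurable M" for Z and M :: "'c measure"
    unfolding split_beta' using um[of snd "M \<Otimes>\<^sub>M lborel" "\<lambda>p. Z (fst p)"] by measurable
  have source_meas': "(\<lambda>(p, y). ennreal (F (u y (Z p)))) \<in> borel_measurable (M \<Otimes>\<^sub>M lborel)"
    if [measurable]: "Z \<in> borel_measurable M" for Z and M :: "'d measure"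
    unfolding split_beta' using um[of snd "M \<Otimes>\<^sub>M lborel" "\<lambda>p. Z (fst p)"] by measurable
  have A_meas: "(\<lambda>p. A t (Z p) (X p)) \<in> borel_measurable M"
    if [measurable]: "Z \<in> borel_measurable M" "X \<in> borel_measurable M" for t Z X and M :: "'e measure"
    unfolding A_def by (rule heatL_nn_measurable) (use source_meas in auto)
  have g_meas: "(\<lambda>p. g (Z p) (X p)) \<in> borel_measurable M"
    if [measurable]: "Z \<in> borel_measurable M" "X \<in> borel_measurable M" for Z X and M :: "'f measure"
    unfolding g_def by (rule heatL_nn_measurable) (use source_meas' in auto)
  have N_meas: "(\<lambda>p. N t (Z p) (X p)) \<in> borel_measurable M"
    if [measurable]: "Z \<in> borel_measurable M" "X \<in> borel_measurable M" for t Z X and M :: "'g measure"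
  proof -
    have [measurable]: "(\<lambda>p. A t (snd p) (X (fst p))) \<in> borel_measurable (M \<Otimes>\<^sub>M lborel)"
      by (rule A_meas) measurable
    show ?thesis
      unfolding N_def indicator_def of_bool_def greaterThanLessThan_iff by measurable
  qed
  have A_split: "A \<kappa> \<sigma> x = ennreal (H \<sigma>) * g \<sigma> x" for \<sigma> x
  proof -
    have "(\<lambda>y. ennreal (F (u y \<sigma>))) \<in> borel_measurable borel" by measurable
    then show ?thesis
      unfolding A_def g_def ennreal_mult''[OF F0] by (rule heatL_nn_cmult)
  qed
  have mild: "AE x in lborel. ennreal (u x t) = P t x + N t t x" if t: "0 < t" for t
    using u_eq[OF t]
  proof (rule eventually_mono)
    fix x
    assume eq: "integrable lborel (\<lambda>(\<sigma>, y). indicator {0<..<t} \<sigma> *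
               (heatL_kernel s (t - \<sigma>) (x - y) * (h \<sigma> * f (u y \<sigma>))))
         \<and> u x t = heatL_sg s t u0 x +
              (LINT \<sigma>:{0<..<t}|lborel. heatL_sg s (t - \<sigma>) (\<lambda>y. h \<sigma> * f (u y \<sigma>)) x)"
    show "ennreal (u x t) = P t x + N t t x"
      unfolding P_def N_def A_def H_def F_def
      by (rule mild_equation_iff[OF t s h_cont h_nonneg f_cont f_nonneg u_meas u_nonneg u0_meas u0(1) P_fin[OF t, unfolded P_def],
            THEN iffD1, THEN conjunct2]) (use eq in simp_all)
  qed
  have transported: "heatL_nn s (\<kappa> - t) (\<lambda>y. ennreal (u y t)) x = \<Phi> t x" if t: "0 < t" "t < \<kappa>" for t x
  proof -
    have r: "0 < \<kappa> - t" using t by simp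
    have "heatL_nn s (\<kappa> - t) (\<lambda>y. ennreal (u y t)) x = heatL_nn s (\<kappa> - t) (\<lambda>y. P t y + N t t y) x"
      by (rule heatL_nn_cong_AE[OF mild[OF t(1)]])
    also have "\<dots> = heatL_nn s (\<kappa> - t) (P t) x + heatL_nn s (\<kappa> - t) (N t t) x"
      by (rule heatL_nn_add) (auto intro: N_meas)
    also have "heatL_nn s (\<kappa> - t) (P t) x = P \<kappa> x"
      unfolding P_def by (subst heatL_nn_semigroup[OF r t(1) s]) auto
    also have "heatL_nn s (\<kappa> - t) (N t t) x
      = (\<integral>\<^sup>+y. \<integral>\<^sup>+\<sigma>. ennreal (heatL_kernel s (\<kappa> - t) (x - y)) * (indicator {0<..<t} \<sigma> * A t \<sigma> y) \<partial>lborel \<partial>lborel)"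
      unfolding heatL_nn_def N_def
      by (intro nn_integral_cong nn_integral_cmult[symmetric] borel_measurable_times_ennreal A_meas) auto
    also have "\<dots> = (\<integral>\<^sup>+\<sigma>. \<integral>\<^sup>+y. ennreal (heatL_kernel s (\<kappa> - t) (x - y)) * (indicator {0<..<t} \<sigma> * A t \<sigma> y) \<partial>lborel \<partial>lborel)"
    proof (rule lborel_pair.Fubini'[symmetric])
      have [measurable]: "(\<lambda>p. A t (snd p) (fst p :: 'a)) \<in> borel_measurable (lborel \<Otimes>\<^sub>M lborel)"
        by (rule A_meas) measurable
      show "(\<lambda>(y, \<sigma>). ennreal (heatL_kernel s (\<kappa> - t) (x - y)) * (indicator {0<..<t} \<sigma> * A t \<sigma> y)) \<in> borel_measurable (lborel \<Otimes>\<^sub>M lborel)"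
        unfolding indicator_def of_bool_def greaterThanLessThan_iff split_beta' by measurable
    qed
    also have "\<dots> = N \<kappa> t x"
      unfolding N_def
    proof (intro nn_integral_cong)
      fix \<sigma>
      show "(\<integral>\<^sup>+y. ennreal (heatL_kernel s (\<kappa> - t) (x - y)) * (indicator {0<..<t} \<sigma> * A t \<sigma> y) \<partial>lborel)
        = indicator {0<..<t} \<sigma> * A \<kappa> \<sigma> x"
      proof (cases "\<sigma> \<in> {0<..<t}")
        case True
        then have r': "0 < t - \<sigma>" by simp
        have "(\<lambda>y. ennreal (H \<sigma> * F (u y \<sigma>))) \<in> borel_measurable borel" by measurable
        from heatL_nn_semigroup[OF r r' s this, of x] show ?thesis
          using True by (simp add: A_def heatL_nn_def)
      qed simp
    qed
    finally show ?thesis by (simp add: \<Phi>_def)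
  qed
  obtain C0 where C0: "AE t in lborel. 0 < t \<longrightarrow> in_X (\<lambda>x. u x t) \<and> linf_norm (\<lambda>x. u x t) \<le> C0"
    using u_X by blast
  \<comment> \<open>Jensen for w0 = u(\<sigma>) over the time \<kappa> - \<sigma>, where S(\<kappa>
    - \<sigma>) u(\<sigma>) = \<Phi>(\<sigma>). The essential bound \<open>C0\<close> of the
    solution controls \<open>g\<close> at every x.\<close>
  have good: "AE \<sigma> in lborel. \<sigma> \<in> {0<..<\<kappa>} \<longrightarrow> (AE x in lborel. ennreal (F (enn2real (\<Phi> \<sigma> x))) \<le> g \<sigma> x)
      \<and> (\<forall>x. g \<sigma> x \<le> ennreal (F C0))"
    using C0
  proof (rule eventually_mono, intro impI)
    fix \<sigma>
    assume X: "0 < \<sigma> \<longrightarrow> in_X (\<lambda>x. u x \<sigma>) \<and> linf_norm (\<lambda>x. u x \<sigma>) \<le> C0" and "\<sigma> \<in> {0<..<\<kappa>}"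
    then have \<sigma>: "0 < \<sigma>" "\<sigma> < \<kappa>" and r: "0 < \<kappa> - \<sigma>" by auto
    have X: "in_X (\<lambda>x. u x \<sigma>)" "linf_norm (\<lambda>x. u x \<sigma>) \<le> C0" using X \<sigma> by auto
    have nonneg: "0 \<le> u y \<sigma>" for y using u_nonneg \<sigma> by simp
    have m1: "(\<lambda>y. u y \<sigma>) \<in> borel_measurable borel" by measurable
    have m2: "(\<lambda>y. F (u y \<sigma>)) \<in> borel_measurable borel" by measurable
    have sg1: "heatL_sg s (\<kappa> - \<sigma>) (\<lambda>y. u y \<sigma>) x = enn2real (\<Phi> \<sigma> x)" for x
      using heatL_sg_eq_heatL_nn[OF r s m1 nonneg] transported[OF \<sigma>] by simp
    have "(\<lambda>y. f (u y \<sigma>)) = (\<lambda>y. F (u y \<sigma>))" using nonneg by (simp add: F_def max_def)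
    then have sg2: "heatL_sg s (\<kappa> - \<sigma>) (\<lambda>y. f (u y \<sigma>)) x = enn2real (g \<sigma> x)" for x
      using heatL_sg_eq_heatL_nn[OF r s m2 F0] by (simp add: g_def)
    have "AE y in lborel. u y \<sigma> \<le> C0"
      using linf_norm_AE[of "\<lambda>y. u y \<sigma>"] X by (auto simp: in_X_def elim!: eventually_mono)
    then have "AE y in lborel. ennreal (F (u y \<sigma>)) \<le> ennreal (F C0)"
      by (auto elim!: eventually_mono intro!: ennreal_leI F_mono)
    then have g_le: "g \<sigma> x \<le> ennreal (F C0)" for x
      unfolding g_def by (rule heatL_nn_le_const[OF r s])
    have "AE x in lborel. f (enn2real (\<Phi> \<sigma> x)) \<le> enn2real (g \<sigma> x)"
      using jensen[OF r nonneg X(1)] unfolding sg1 sg2 .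
    then have "AE x in lborel. ennreal (F (enn2real (\<Phi> \<sigma> x))) \<le> g \<sigma> x"
    proof (rule eventually_mono)
      fix x assume le: "f (enn2real (\<Phi> \<sigma> x)) \<le> enn2real (g \<sigma> x)"
      have "g \<sigma> x < \<top>" using g_le by (rule le_less_trans) simp
      moreover have "ennreal (F (enn2real (\<Phi> \<sigma> x))) \<le> ennreal (enn2real (g \<sigma> x))"
        using le by (intro ennreal_leI) (simp add: F_def)
      ultimately show "ennreal (F (enn2real (\<Phi> \<sigma> x))) \<le> g \<sigma> x" by simp
    qed
    with g_le show "(AE x in lborel. ennreal (F (enn2real (\<Phi> \<sigma> x))) \<le> g \<sigma> x) \<and> (\<forall>x. g \<sigma> x \<le> ennreal (F C0))"
      by blast
  qed
  have "continuous_on {0..\<kappa>} h" by (rule continuous_on_subset[OF h_cont]) auto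
  note h_cont\<kappa> = this
  obtain h1 where h1: "\<And>\<sigma>. \<sigma> \<in> {0..\<kappa>} \<Longrightarrow> h \<sigma> \<le> h1" and h1_nonneg: "0 \<le> h1"
  proof -
    have "bounded (h ` {0..\<kappa>})" by (intro compact_imp_bounded compact_continuous_image h_cont\<kappa> compact_Icc)
    then obtain b where "0 < b" "\<And>\<sigma>. \<sigma> \<in> {0..\<kappa>} \<Longrightarrow> \<bar>h \<sigma>\<bar> \<le> b" by (auto simp: bounded_pos)
    then show ?thesis by (intro that[of b]) (auto simp: abs_le_iff)
  qed
  \<comment> \<open>A Lipschitz constant of \<Phi> in time, the same for all x.\<close>
  define B where "B = h1 * F C0"
  have B: "0 \<le> B" using h1_nonneg F0 by (simp add: B_def)
  have A_le: "AE \<sigma> in lborel. \<sigma> \<in> {0<..<\<kappa>} \<longrightarrow> (\<forall>x. A \<kappa> \<sigma> x \<le> ennreal B)"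
    using good
  proof (rule eventually_mono, intro impI allI)
    fix \<sigma> x
    assume *: "\<sigma> \<in> {0<..<\<kappa>} \<longrightarrow> (AE x in lborel. ennreal (F (enn2real (\<Phi> \<sigma> x))) \<le> g \<sigma> x) \<and> (\<forall>x. g \<sigma> x \<le> ennreal (F C0))"
      and \<sigma>: "\<sigma> \<in> {0<..<\<kappa>}"
    have "A \<kappa> \<sigma> x \<le> ennreal h1 * ennreal (F C0)"
      unfolding A_split using * \<sigma> h1[of \<sigma>] by (intro mult_mono ennreal_leI) (auto simp: H_def)
    then show "A \<kappa> \<sigma> x \<le> ennreal B" by (simp add: B_def ennreal_mult''[OF F0])
  qed
  have N_incr: "N \<kappa> t x \<le> N \<kappa> r x + ennreal (B * (t - r))" if rt: "0 \<le> r" "r \<le> t" "t \<le> \<kappa>" for r t x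
  proof -
    have "N \<kappa> t x \<le> (\<integral>\<^sup>+\<sigma>. indicator {0<..<r} \<sigma> * A \<kappa> \<sigma> x + ennreal B * indicator {r..t} \<sigma> \<partial>lborel)"
      unfolding N_def
    proof (rule nn_integral_mono_AE)
      show "AE \<sigma> in lborel. indicator {0<..<t} \<sigma> * A \<kappa> \<sigma> x \<le> indicator {0<..<r} \<sigma> * A \<kappa> \<sigma> x + ennreal B * indicator {r..t} \<sigma>"
        using A_le by (rule eventually_mono) (use rt in \<open>auto simp: indicator_def\<close>)
    qed
    also have "\<dots> = N \<kappa> r x + (\<integral>\<^sup>+\<sigma>. ennreal B * indicator {r..t} \<sigma> \<partial>lborel)"
      unfolding N_def by (intro nn_integral_add borel_measurable_times_ennreal A_meas) auto
    also have "(\<integral>\<^sup>+\<sigma>. ennreal B * indicator {r..t} \<sigma> \<partial>lborel) = ennreal (B * (t - r))"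
      using rt B by (simp add: nn_integral_cmult_indicator ennreal_mult)
    finally show ?thesis .
  qed
  have N_mono: "N \<kappa> r x \<le> N \<kappa> t x" if "r \<le> t" for r t x
    unfolding N_def using that by (intro nn_integral_mono mult_right_mono) (auto simp: indicator_def)
  have N_0: "N \<kappa> 0 x = 0" for x by (simp add: N_def)
  \<comment> \<open>Bounds \<Phi> up to time \<open>\<kappa>\<close>, uniformly in x:
    \<open>M0\<close> for the datum, rate \<open>B\<close> over a time span \<open>\<kappa>\<close>
    for the source.\<close>
  define b where "b = M0 + B * \<kappa>"
  have \<Phi>_le: "\<Phi> t x \<le> ennreal b" if "t \<in> {0..\<kappa>}" for t x
  proof -
    have "N \<kappa> t x \<le> ennreal (B * \<kappa>)"
      using N_incr[of 0 \<kappa> x] N_mono[of t \<kappa> x] that \<kappa> by (auto simp: N_0)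
    then have "\<Phi> t x \<le> ennreal M0 + ennreal (B * \<kappa>)" unfolding \<Phi>_def by (intro add_mono P_le \<kappa>)
    then show ?thesis using M0 B \<kappa> by (simp add: b_def ennreal_plus)
  qed
  have b: "M0 \<le> b" using B \<kappa> by (simp add: b_def)
  have ae: "AE \<sigma> in lborel. AE x in lborel. \<sigma> \<in> {0<..<\<kappa>} \<longrightarrow> ennreal (F (enn2real (\<Phi> \<sigma> x))) \<le> g \<sigma> x"
    using good
  proof (rule eventually_mono)
    fix \<sigma>
    assume *: "\<sigma> \<in> {0<..<\<kappa>} \<longrightarrow> (AE x in lborel. ennreal (F (enn2real (\<Phi> \<sigma> x))) \<le> g \<sigma> x) \<and> (\<forall>x. g \<sigma> x \<le> ennreal (F C0))"
    show "AE x in lborel. \<sigma> \<in> {0<..<\<kappa>} \<longrightarrow> ennreal (F (enn2real (\<Phi> \<sigma> x))) \<le> g \<sigma> x"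
    proof (cases "\<sigma> \<in> {0<..<\<kappa>}")
      case True
      then show ?thesis using * by (auto elim!: eventually_mono)
    qed auto
  qed
  have sets: "{p \<in> space (lborel \<Otimes>\<^sub>M lborel). fst p \<in> {0<..<\<kappa>} \<longrightarrow> ennreal (F (enn2real (\<Phi> (fst p) (snd p)))) \<le> g (fst p) (snd p)}
    \<in> sets (lborel \<Otimes>\<^sub>M (lborel :: 'a measure))"
  proof -
    have [measurable]: "(\<lambda>p. \<Phi> (fst p) (snd p)) \<in> borel_measurable (lborel \<Otimes>\<^sub>M (lborel :: 'a measure))"
      unfolding \<Phi>_def by (intro borel_measurable_add N_meas measurable_compose[OF _ P_meas]) auto
    have [measurable]: "(\<lambda>p. g (fst p) (snd p)) \<in> borel_measurable (lborel \<Otimes>\<^sub>M (lborel :: 'a measure))"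
      by (rule g_meas) auto
    show ?thesis unfolding greaterThanLessThan_iff by measurable
  qed
  \<comment> \<open>Fubini for null sets: the order of the two almost-everywhere quantifiers is
    exchanged, which is where the joint measurability in \<open>sets\<close> enters.\<close>
  have ode_AE: "AE x in lborel. AE \<sigma> in lborel. \<sigma> \<in> {0<..<\<kappa>} \<longrightarrow> ennreal (F (enn2real (\<Phi> \<sigma> x))) \<le> g \<sigma> x"
    by (rule lborel_pair.AE_commute[where P="\<lambda>\<sigma> x. \<sigma> \<in> {0<..<\<kappa>} \<longrightarrow> ennreal (F (enn2real (\<Phi> \<sigma> x))) \<le> g \<sigma> x",
          THEN iffD1, OF sets ae])
  define L where "L = linf_norm (heatL_sg s \<kappa> u0)"
  have sg_P: "heatL_sg s \<kappa> u0 = (\<lambda>x. enn2real (P \<kappa> x))"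
    unfolding P_def using heatL_sg_eq_heatL_nn[OF \<kappa> s u0_meas u0(1)] by auto
  have sg_meas: "heatL_sg s \<kappa> u0 \<in> borel_measurable lborel" unfolding sg_P by simp
  have sg_le: "AE x in lborel. \<bar>heatL_sg s \<kappa> u0 x\<bar> \<le> M0"
    unfolding sg_P using P_le[OF \<kappa>] M0 by (intro AE_I2) (auto intro!: enn2real_leI)
  have L_le: "L \<le> M0" unfolding L_def by (rule linf_norm_le(1)[OF sg_meas sg_le])
  \<comment> \<open>If S(\<kappa>) u0 vanished almost everywhere, conservation of mass would make u0
    trivial. A positive \<open>L\<close> keeps the integrals of 1 / f away from 0.\<close>
  have "L \<noteq> 0"
  proof
    assume L0: "L = 0"
    have "AE x in lborel. \<bar>enn2real (P \<kappa> x)\<bar> \<le> L"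
      using linf_norm_AE[OF sg_meas linf_norm_le(2)[OF sg_meas sg_le]] unfolding L_def[symmetric] unfolding sg_P .
    then have "AE x in lborel. enn2real (P \<kappa> x) = 0" by (rule eventually_mono) (use L0 in linarith)
    then have "AE x in lborel. P \<kappa> x = 0"
      using P_fin[OF \<kappa>, THEN less_imp_neq] by (simp add: enn2real_eq_0_iff)
    then have "(\<integral>\<^sup>+x. P \<kappa> x \<partial>lborel) = 0" by (subst nn_integral_0_iff_AE) auto
    then have "(\<integral>\<^sup>+y. ennreal (u0 y) \<partial>lborel) = 0"
      unfolding P_def by (subst (asm) heatL_nn_mass[OF \<kappa> s]) auto
    then have "AE x in lborel. u0 x = 0"
      by (subst (asm) nn_integral_0_iff_AE) (auto elim!: eventually_mono simp: u0(1) ennreal_eq_0_iff antisym)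
    then show False using u0(3) by (simp add: nonzero_X_def)
  qed
  then have L: "0 < L" using linf_norm_nonneg[OF sg_meas] unfolding L_def by simp
  have inv_cont: "continuous_on {c..d} (\<lambda>z. 1 / f z)" if "0 < c" for c d
  proof -
    have "f z \<noteq> 0" if "z \<in> {c..d}" for z using that \<open>0 < c\<close> f_pos[of z] by auto
    then show ?thesis using that by (intro continuous_intros continuous_on_subset[OF f_cont]) auto
  qed
  note inv_int = integrable_continuous_interval[OF inv_cont]
  define J where "J = integral {0..\<kappa>} h"
  have J_le_eps: "J \<le> integral {L - e..b} (\<lambda>z. 1 / f z)" if e: "0 < e" "e < L" for e
  proof -
    \<comment> \<open>Otherwise S(\<kappa>) u0 \<le> L - e almost everywhere, against the choice of
      \<open>L\<close> as essential supremum.\<close>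
    have "\<exists>x. L - e < enn2real (P \<kappa> x) \<and> (AE \<sigma> in lborel. \<sigma> \<in> {0<..<\<kappa>} \<longrightarrow> ennreal (F (enn2real (\<Phi> \<sigma> x))) \<le> g \<sigma> x)"
    proof (rule ccontr)
      assume "\<not> ?thesis"
      with ode_AE have "AE x in lborel. \<bar>heatL_sg s \<kappa> u0 x\<bar> \<le> L - e"
        unfolding sg_P by (auto elim!: eventually_mono simp: not_less)
      then have "L \<le> L - e" unfolding L_def by (rule linf_norm_le(1)[OF sg_meas])
      then show False using e by simp
    qed
    then obtain x where x: "L - e < enn2real (P \<kappa> x)"
      and ode: "AE \<sigma> in lborel. \<sigma> \<in> {0<..<\<kappa>} \<longrightarrow> ennreal (F (enn2real (\<Phi> \<sigma> x))) \<le> g \<sigma> x" by blast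
    define \<phi> where "\<phi> = (\<lambda>t. enn2real (\<Phi> t x))"
    have \<Phi>_\<phi>: "\<Phi> t x = ennreal (\<phi> t)" if "t \<in> {0..\<kappa>}" for t
      unfolding \<phi>_def using le_less_trans[OF \<Phi>_le[OF that]] by simp
    have \<phi>_nonneg: "0 \<le> \<phi> t" for t by (simp add: \<phi>_def)
    have \<phi>_lip: "\<phi> r \<le> \<phi> t" "\<phi> t \<le> \<phi> r + B * (t - r)" if rt: "0 \<le> r" "r \<le> t" "t \<le> \<kappa>" for r t
    proof -
      have "\<Phi> r x \<le> \<Phi> t x" unfolding \<Phi>_def by (intro add_left_mono N_mono rt)
      then show "\<phi> r \<le> \<phi> t" using rt \<phi>_nonneg by (simp add: \<Phi>_\<phi>)
      have "\<Phi> t x \<le> \<Phi> r x + ennreal (B * (t - r))"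
        unfolding \<Phi>_def add.assoc by (intro add_left_mono N_incr rt)
      also have "\<dots> = ennreal (\<phi> r + B * (t - r))"
        using rt B \<phi>_nonneg by (subst \<Phi>_\<phi>) (auto simp: ennreal_plus)
      finally have "ennreal (\<phi> t) \<le> ennreal (\<phi> r + B * (t - r))"
        using rt by (simp only: \<Phi>_\<phi> atLeastAtMost_iff order_trans[OF rt(1,2)])
      moreover have "0 \<le> \<phi> r + B * (t - r)" using rt B \<phi>_nonneg by simp
      ultimately show "\<phi> t \<le> \<phi> r + B * (t - r)" by (simp only: ennreal_le_iff)
    qed
    have "B-lipschitz_on {0..\<kappa>} \<phi>"
    proof (rule lipschitz_onI)
      fix r t assume "r \<in> {0..\<kappa>}" "t \<in> {0..\<kappa>}"
      then show "dist (\<phi> r) (\<phi> t) \<le> B * dist r t"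
        using \<phi>_lip[of r t] \<phi>_lip[of t r] by (cases "r \<le> t") (auto simp: dist_real_def abs_real_def)
    qed (rule B)
    then have \<phi>_cont: "continuous_on {0..\<kappa>} \<phi>" by (rule lipschitz_on_continuous_on)
    have hf_cont: "continuous_on {0..\<kappa>} (\<lambda>\<sigma>. h \<sigma> * f (\<phi> \<sigma>))"
      using \<phi>_nonneg by (intro continuous_on_mult h_cont\<kappa> continuous_on_compose2[OF f_cont \<phi>_cont]) auto
    have lower: "(L - e) + integral {0..t} (\<lambda>\<sigma>. h \<sigma> * f (\<phi> \<sigma>)) \<le> \<phi> t" if t: "t \<in> {0..\<kappa>}" for t
    proof -
      define i where "i = integral {0..t} (\<lambda>\<sigma>. h \<sigma> * f (\<phi> \<sigma>))"
      have "((\<lambda>\<sigma>. h \<sigma> * f (\<phi> \<sigma>)) has_integral i) {0..t}"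
        unfolding i_def using t by (intro integrable_integral integrable_continuous_interval continuous_on_subset[OF hf_cont]) auto
      \<comment> \<open>The comparison lemma speaks of gauge integrals over closed intervals, the
        Duhamel term of nonnegative integrals over open ones; the endpoints are dropped to
        match.\<close>
      then have hi: "((\<lambda>\<sigma>. h \<sigma> * f (\<phi> \<sigma>)) has_integral i) {0<..<t}" by (simp add: has_integral_Icc_iff_Ioo)
      have nonneg: "0 \<le> h \<sigma> * f (\<phi> \<sigma>)" if "\<sigma> \<in> {0<..<t}" for \<sigma>
        using that h_nonneg[of \<sigma>] f_nonneg[OF \<phi>_nonneg] by simp
      have i_nonneg: "0 \<le> i" by (rule has_integral_nonneg[OF hi nonneg])
      have "ennreal i = (\<integral>\<^sup>+\<sigma>. ennreal (indicator {0<..<t} \<sigma> * (h \<sigma> * f (\<phi> \<sigma>))) \<partial>lborel)"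
        by (rule nn_integral_has_integral_lebesgue[OF nonneg hi, symmetric])
      also have "\<dots> \<le> N \<kappa> t x"
        unfolding N_def
      proof (rule nn_integral_mono_AE, rule eventually_mono[OF ode])
        fix \<sigma>
        assume *: "\<sigma> \<in> {0<..<\<kappa>} \<longrightarrow> ennreal (F (enn2real (\<Phi> \<sigma> x))) \<le> g \<sigma> x"
        show "ennreal (indicator {0<..<t} \<sigma> * (h \<sigma> * f (\<phi> \<sigma>))) \<le> indicator {0<..<t} \<sigma> * A \<kappa> \<sigma> x"
        proof (cases "\<sigma> \<in> {0<..<t}")
          case True
          have "ennreal (h \<sigma> * f (\<phi> \<sigma>)) = ennreal (H \<sigma>) * ennreal (F (\<phi> \<sigma>))"
            using True \<phi>_nonneg f_nonneg[OF \<phi>_nonneg] by (simp add: H_def F_def ennreal_mult'')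
          also have "\<dots> \<le> A \<kappa> \<sigma> x"
            unfolding A_split using * True t by (intro mult_left_mono) (auto simp: \<phi>_def)
          finally show ?thesis using True by simp
        qed simp
      qed
      finally have "P \<kappa> x + ennreal i \<le> \<Phi> t x" unfolding \<Phi>_def by (rule add_left_mono)
      moreover have "P \<kappa> x = ennreal (enn2real (P \<kappa> x))" using P_fin[OF \<kappa>, of x] by simp
      ultimately have "ennreal (enn2real (P \<kappa> x) + i) \<le> ennreal (\<phi> t)"
        using i_nonneg by (simp add: \<Phi>_\<phi>[OF t] ennreal_plus)
      then have "enn2real (P \<kappa> x) + i \<le> \<phi> t" using \<phi>_nonneg by simp
      then show ?thesis using x unfolding i_def by linarith
    qed
    have "J \<le> integral {L - e..\<phi> \<kappa>} (\<lambda>z. 1 / f z)"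
      unfolding J_def using \<kappa> e h_nonneg \<phi>_nonneg f_pos
      by (intro osgood_comparison[OF _ _ f_cont f_mono _ h_cont\<kappa> _ \<phi>_cont _ lower]) auto
    also have "\<dots> \<le> integral {L - e..b} (\<lambda>z. 1 / f z)"
    proof (intro integral_subset_le inv_int)
      have "\<phi> \<kappa> \<le> b"
        unfolding \<phi>_def using \<Phi>_le[of \<kappa> x] \<kappa> M0 b by (intro enn2real_leI) auto
      then show "{L - e..\<phi> \<kappa>} \<subseteq> {L - e..b}" by auto
      show "\<forall>z\<in>{L - e..b}. 0 \<le> 1 / f z" using e f_pos by (auto intro: less_imp_le)
    qed (use e in auto)
    finally show ?thesis .
  qed
  have J_le: "J \<le> integral {L..b} (\<lambda>z. 1 / f z)"
  proof (rule field_le_epsilon)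
    fix \<epsilon> :: real assume \<epsilon>: "0 < \<epsilon>"
    have fL: "0 < f (L / 2)" using L by (intro f_pos) simp
    \<comment> \<open>On the slice from L - e to L, 1 / f is at most 1 / f(L / 2), so the second
      entry of the minimum limits its integral to \<epsilon>; the first keeps the slice above L /
      2.\<close>
    define e where "e = min (L / 2) (\<epsilon> * f (L / 2))"
    have e: "0 < e" "e \<le> L / 2" "e \<le> \<epsilon> * f (L / 2)" using L \<epsilon> fL by (auto simp: e_def)
    have "J \<le> integral {L - e..b} (\<lambda>z. 1 / f z)" using e L by (intro J_le_eps) auto
    also have "\<dots> = integral {L - e..L} (\<lambda>z. 1 / f z) + integral {L..b} (\<lambda>z. 1 / f z)"
      using e L L_le b by (intro Henstock_Kurzweil_Integration.integral_combine[symmetric] inv_int) auto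
    also have "integral {L - e..L} (\<lambda>z. 1 / f z) \<le> integral {L - e..L} (\<lambda>z. 1 / f (L / 2))"
    proof (intro integral_le inv_int)
      fix z assume z: "z \<in> {L - e..L}"
      then have "f (L / 2) \<le> f z" using e L by (intro mono_onD[OF f_mono]) auto
      then show "1 / f z \<le> 1 / f (L / 2)" using fL by (intro divide_left_mono) auto
    qed (use e L in auto)
    also have "integral {L - e..L} (\<lambda>z. 1 / f (L / 2)) = e / f (L / 2)" using e by simp
    also have "e / f (L / 2) \<le> \<epsilon>" using e fL by (simp add: field_simps)
    finally show "J \<le> integral {L..b} (\<lambda>z. 1 / f z) + \<epsilon>" by simp
  qed
  \<comment> \<open>Strictness comes from the extra unit interval beyond the uniform bound
    \<open>b\<close>, where 1 / f \<ge> 1 / f(b + 1) > 0. The integral in the hypothesis runs to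
    infinity and so includes this interval.\<close>
  have "J < integral {L..b + 1} (\<lambda>z. 1 / f z)"
  proof -
    have fb: "0 < f (b + 1)" using L L_le b by (intro f_pos) simp
    have "1 / f (b + 1) = integral {b..b + 1} (\<lambda>z. 1 / f (b + 1))" by simp
    also have "\<dots> \<le> integral {b..b + 1} (\<lambda>z. 1 / f z)"
    proof (intro integral_le inv_int)
      fix z assume z: "z \<in> {b..b + 1}"
      then have "f z \<le> f (b + 1)" using L L_le b by (intro mono_onD[OF f_mono]) auto
      moreover have "0 < f z" using z L L_le b by (intro f_pos) auto
      ultimately show "1 / f (b + 1) \<le> 1 / f z" by (intro divide_left_mono) auto
    qed (use L L_le b in auto)
    finally have "0 < integral {b..b + 1} (\<lambda>z. 1 / f z)" using fb by (smt (verit) divide_pos_pos)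
    moreover have "integral {L..b + 1} (\<lambda>z. 1 / f z) = integral {L..b} (\<lambda>z. 1 / f z) + integral {b..b + 1} (\<lambda>z. 1 / f z)"
      using L L_le b by (intro Henstock_Kurzweil_Integration.integral_combine[symmetric] inv_int) auto
    ultimately show ?thesis using J_le by simp
  qed
  moreover have "ennreal (integral {L..b + 1} (\<lambda>z. 1 / f z)) \<le> ennreal J"
  proof -
    have "ennreal (integral {L..b + 1} (\<lambda>z. 1 / f z)) = (\<integral>\<^sup>+\<sigma>\<in>{L..b + 1}. ennreal (1 / f \<sigma>) \<partial>lborel)"
    proof (rule nn_integral_has_integral_lebesgue'[symmetric])
      show "0 \<le> 1 / f z" if "z \<in> {L..b + 1}" for z using that L f_pos[of z] by simp
    qed (rule integrable_integral[OF inv_int[OF L]])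
    also have "\<dots> \<le> (\<integral>\<^sup>+\<sigma>\<in>{L..}. ennreal (1 / f \<sigma>) \<partial>lborel)"
      by (intro nn_integral_mono) (auto simp: indicator_def)
    also have "\<dots> \<le> (\<integral>\<^sup>+ \<sigma>\<in>{0..\<kappa>}. ennreal (h \<sigma>) \<partial>lborel)" using blowup unfolding L_def .
    also have "\<dots> = ennreal J"
      unfolding J_def using h_nonneg
      by (intro nn_integral_has_integral_lebesgue' integrable_integral integrable_continuous_interval h_cont\<kappa>) auto
    finally show ?thesis .
  qed
  moreover have "0 \<le> J" unfolding J_def using h_nonneg by (intro integral_nonneg integrable_continuous_interval h_cont\<kappa>) auto
  ultimately show False by (simp add: ennreal_le_iff)
qed

theorem theorem3p1:
  fixes s :: real and h f :: "real \<Rightarrow> real"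
  assumes s: "0 < s" "s < 1"
    and h_cont: "continuous_on {0..} h" and h_nonneg: "\<And>t. 0 \<le> t \<Longrightarrow> 0 \<le> h t"
    and f_cont: "continuous_on {0..} f" and f_nonneg: "\<And>z. 0 \<le> z \<Longrightarrow> 0 \<le> f z"
    and f_loclip: "\<And>M. \<exists>L. \<forall>x\<in>{0..M}. \<forall>y\<in>{0..M}. \<bar>f x - f y\<bar> \<le> L * \<bar>x - y\<bar>"
    and f0: "f 0 = 0"
  shows
    "(\<forall>(v0 :: 'a::euclidean_space \<Rightarrow> real) m.
        0 < m \<and> mono_on {0<..m} f \<and> mono_on {0<..m} (\<lambda>\<sigma>. f \<sigma> / \<sigma>)
        \<and> (\<forall>x. 0 \<le> v0 x) \<and> in_X v0 \<and> nonzero_X v0 \<and> linf_norm v0 \<le> m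
        \<and> (\<integral>\<^sup>+ \<sigma>\<in>{0<..}. ennreal (h \<sigma> * f (linf_norm (heatL_sg s \<sigma> v0))
                                   / linf_norm (heatL_sg s \<sigma> v0)) \<partial>lborel) < 1
        \<longrightarrow> (\<exists>\<delta>>0. \<exists>u. global_mild_sol s h f (\<lambda>x. \<delta> * v0 x) u \<and> \<not> (\<forall>x t. u x t = 0)))
   \<and> (\<forall>(u0 :: 'a::euclidean_space \<Rightarrow> real).
        (\<forall>x. 0 \<le> u0 x) \<and> in_X u0 \<and> nonzero_X u0
        \<and> mono_on {0..} f \<and> (\<forall>z>0. 0 < f z)
        \<and> (\<forall>z0>0. (\<integral>\<^sup>+ \<sigma>\<in>{z0..}. ennreal (1 / f \<sigma>) \<partial>lborel) < \<infinity>)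
        \<and> (\<forall>t>0. \<forall>w0 :: 'a \<Rightarrow> real. (\<forall>x. 0 \<le> w0 x) \<and> in_X w0 \<longrightarrow>
              (AE x in lborel. f (heatL_sg s t w0 x) \<le> heatL_sg s t (\<lambda>y. f (w0 y)) x))
        \<and> (\<exists>\<kappa>>0. (\<integral>\<^sup>+ \<sigma>\<in>{linf_norm (heatL_sg s \<kappa> u0)..}. ennreal (1 / f \<sigma>) \<partial>lborel)
                   \<le> (\<integral>\<^sup>+ \<sigma>\<in>{0..\<kappa>}. ennreal (h \<sigma>) \<partial>lborel))
        \<longrightarrow> \<not> (\<exists>u. global_mild_sol s h f u0 u))"
proof (intro conjI allI impI, goal_cases)
  case (1 v0 m)
  then show ?case
    by (intro global_mild_sol_exists[OF s h_cont h_nonneg f_cont f_nonneg f0, of m]) auto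
next
  case (2 u0)
  then obtain \<kappa> where "0 < \<kappa>" "(\<integral>\<^sup>+ \<sigma>\<in>{linf_norm (heatL_sg s \<kappa> u0)..}. ennreal (1 / f \<sigma>) \<partial>lborel)
      \<le> (\<integral>\<^sup>+ \<sigma>\<in>{0..\<kappa>}. ennreal (h \<sigma>) \<partial>lborel)" by blast
  note \<kappa> = this
  have "\<not> global_mild_sol s h f u0 u" for u
    using 2 by (intro no_global_mild_sol[OF s h_cont h_nonneg f_cont f_nonneg _ _ _ _ _ _ \<kappa>]) auto
  then show ?case by blast
qed

end
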